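(* Let $d\geq 2$ and let $C:F=x^d+y^d+z^d=0$ be the smooth Fermat curve of degree $d$ in $\mathbb{P}^2$. For each root $\epsilon\in\mathbb{C}$ of $t^d+1=0$, let $L_\epsilon:y=\epsilon x$ be the tangent line to $C$ at $p_\epsilon=(1:\epsilon:0)$; these are $d$ lines meeting at one point, and their union is $x^d+y^d=0$. Then: (1) the union $C':F'=(x^d+y^d)F=0$ of $C$ with these $d$ lines is a free curve of degree $2d$ with exponents $(d-1,d)$; when $d=3$, the curve $C'$ is maximizing of degree $6$; (2) the union $C'':F''=zF'=0$ of $C'$ with the line $L:z=0$ passing through all the points $p_\epsilon$ is a free curve of degree $2d+1$ with exponents $(d-1,d+1)$; when $d=3$, the curve $C''$ is maximizing of degree $7$.
   Context: Let $S=\mathbb{C}[x,y,z]$. For a reduced plane curve $G=0$ in $\mathbb{P}^2$ with $G\in S$ homogeneous, let $D_0(G)=\{a\partial_x+b\partial_y+c\partial_z : a,b,c\in S,\ aG_x+bG_y+cG_z=0\}$, a graded $S$-module of rank 2 (a derivation has degree $r$ if $a,b,c$ are homogeneous of degree $r$). The curve $G=0$ is free if $D_0(G)$ is a free graded $S$-module; its exponents $(d_1,d_2)$ are then the degrees of the elements of a homogeneous basis of $D_0(G)$. A reduced plane curve of degree $e$ having only ADE (simple) singularities, with total Tjurina number $\tau$ (the sum of the Tjurina numbers of all its singular points), is maximizing if either $e=2m$ and $\tau=3m(m-1)+1$, or $e=2m+1$ and $\tau=3m^2+1$. *)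

theory Defs
  imports
    "HOL-Analysis.Analysis"
    "HOL-Computational_Algebra.Computational_Algebra"
begin

section \<open>The ring S = C[x,y,z]\<close>

text \<open>
  S is the iterated polynomial ring C[x][y][z]: the innermost variable is x, the outermost is z,
  so the coefficient of x^i y^j z^k in G is \<open>coeff (coeff (coeff G k) j) i\<close>.
\<close>

type_synonym S = "complex poly poly poly"

definition cst :: "complex \<Rightarrow> S" where "cst c = [:[:[:c:]:]:]"
definition vx :: S where "vx = [:[:[:0, 1:]:]:]"
definition vy :: S where "vy = [:[:0, 1:]:]"
definition vz :: S where "vz = [:0, 1:]"

definition dx :: "S \<Rightarrow> S" where "dx = map_poly (map_poly pderiv)"
definition dy :: "S \<Rightarrow> S" where "dy = map_poly pderiv"
definition dz :: "S \<Rightarrow> S" where "dz = pderiv"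

definition homogeneous :: "nat \<Rightarrow> S \<Rightarrow> bool" where
  "homogeneous n G \<longleftrightarrow>
     (\<forall>i j k. coeff (coeff (coeff G k) j) i \<noteq> 0 \<longrightarrow> i + j + k = n)"

text \<open>Evaluation of G at (u, v, w) in a commutative C-algebra with structure map \<open>\<iota>\<close>.\<close>

definition eval3 :: "(complex \<Rightarrow> 'r::comm_ring_1) \<Rightarrow> S \<Rightarrow> 'r \<times> 'r \<times> 'r \<Rightarrow> 'r" where
  "eval3 \<iota> G = (\<lambda>(u, v, w).
     \<Sum>k\<le>degree G. \<Sum>j\<le>degree (coeff G k). \<Sum>i\<le>degree (coeff (coeff G k) j).
       \<iota> (coeff (coeff (coeff G k) j) i) * u ^ i * v ^ j * w ^ k)"

abbreviation ev :: "S \<Rightarrow> complex \<times> complex \<times> complex \<Rightarrow> complex" where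
  "ev \<equiv> eval3 (\<lambda>c. c)"


section \<open>Plane curves\<close>

text \<open>
  A point of the projective plane is the set of all its homogeneous coordinate vectors.
  Everything below that is defined through \<open>coords P\<close> is independent of the vector chosen.
\<close>

type_synonym point = "(complex \<times> complex \<times> complex) set"

definition hpoint :: "complex \<Rightarrow> complex \<Rightarrow> complex \<Rightarrow> point" where
  "hpoint a b c = {(l * a, l * b, l * c) | l. l \<noteq> 0}"

definition P2 :: "point set" where
  "P2 = {hpoint a b c | a b c. (a, b, c) \<noteq> (0, 0, 0)}"

definition coords :: "point \<Rightarrow> complex \<times> complex \<times> complex" where
  "coords P = (SOME v. v \<in> P)"

definition zero_locus :: "S \<Rightarrow> point set" where
  "zero_locus G = {P \<in> P2. \<forall>v\<in>P. ev G v = 0}"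

definition reduced_plane_curve :: "nat \<Rightarrow> S \<Rightarrow> bool" where
  "reduced_plane_curve n G \<longleftrightarrow> n > 0 \<and> homogeneous n G \<and> squarefree G"

definition singular_points :: "S \<Rightarrow> point set" where
  "singular_points G =
     zero_locus G \<inter> zero_locus (dx G) \<inter> zero_locus (dy G) \<inter> zero_locus (dz G)"

text \<open>The tangent line to G = 0 at a nonsingular point P of the curve.\<close>

definition tangent_line :: "S \<Rightarrow> point \<Rightarrow> point set" where
  "tangent_line G P =
     (let v = coords P
      in zero_locus (cst (ev (dx G) v) * vx + cst (ev (dy G) v) * vy + cst (ev (dz G) v) * vz))"


section \<open>The module of Jacobian derivations and free curves\<close>

text \<open>A triple (a, b, c) stands for the derivation a dx + b dy + c dz.\<close>

type_synonym derivation = "S \<times> S \<times> S"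

definition smult3 :: "S \<Rightarrow> derivation \<Rightarrow> derivation" where
  "smult3 p = (\<lambda>(a, b, c). (p * a, p * b, p * c))"

interpretation Der: module smult3
  by unfold_locales (auto simp: smult3_def algebra_simps)

definition D0 :: "S \<Rightarrow> derivation set" where
  "D0 G = {(a, b, c). a * dx G + b * dy G + c * dz G = 0}"

definition has_degree :: "derivation \<Rightarrow> nat \<Rightarrow> bool" where
  "has_degree \<theta> r \<longleftrightarrow> (case \<theta> of (a, b, c) \<Rightarrow> homogeneous r a \<and> homogeneous r b \<and> homogeneous r c)"

definition homogeneous_basis :: "S \<Rightarrow> derivation set \<Rightarrow> bool" where
  "homogeneous_basis G B \<longleftrightarrow>
     Der.independent B \<and> Der.span B = D0 G \<and> (\<forall>\<theta>\<in>B. \<exists>r. has_degree \<theta> r)"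

definition free_curve :: "S \<Rightarrow> bool" where
  "free_curve G \<longleftrightarrow> (\<exists>n. reduced_plane_curve n G) \<and> (\<exists>B. homogeneous_basis G B)"

definition has_exponents :: "S \<Rightarrow> nat \<times> nat \<Rightarrow> bool" where
  "has_exponents G = (\<lambda>(d1, d2). \<exists>\<theta>1 \<theta>2. \<theta>1 \<noteq> \<theta>2 \<and> homogeneous_basis G {\<theta>1, \<theta>2} \<and>
     has_degree \<theta>1 d1 \<and> has_degree \<theta>2 d2)"


section \<open>Local equations\<close>

text \<open>
  The equation of G = 0 in an affine chart around the point with coordinate vector (a, b, c),
  in the affine coordinates s, t centred at that point. With \<open>\<iota>\<close> the identity this is
  the value of the local equation at (s, t); with s, t the variables of C[[s,t]] it is
  the power series expansion of the local equation.
\<close>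

definition chart :: "(complex \<Rightarrow> 'r::comm_ring_1) \<Rightarrow> complex \<times> complex \<times> complex \<Rightarrow>
    'r \<Rightarrow> 'r \<Rightarrow> 'r \<times> 'r \<times> 'r" where
  "chart \<iota> = (\<lambda>(a, b, c) s t.
     if a \<noteq> 0 then (1, \<iota> (b / a) + s, \<iota> (c / a) + t)
     else if b \<noteq> 0 then (s, 1, \<iota> (c / b) + t)
     else (s, t, 1))"

definition local_fun :: "S \<Rightarrow> point \<Rightarrow> complex \<times> complex \<Rightarrow> complex" where
  "local_fun G P = (\<lambda>(s, t). ev G (chart (\<lambda>c. c) (coords P) s t))"

type_synonym series2 = "complex fps fps"

text \<open>C[[s,t]] is C[[s]][[t]]: the coefficient of s^i t^j in f is \<open>f $ j $ i\<close>.\<close>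

definition cst2 :: "complex \<Rightarrow> series2" where "cst2 c = fps_const (fps_const c)"
definition var_s :: series2 where "var_s = fps_const fps_X"
definition var_t :: series2 where "var_t = fps_X"

definition local_series :: "S \<Rightarrow> point \<Rightarrow> series2" where
  "local_series G P = eval3 cst2 G (chart cst2 (coords P) var_s var_t)"


section \<open>Tjurina numbers\<close>

definition convergent_series :: "series2 set" where
  "convergent_series = {f. \<exists>M r. \<forall>i j. norm (f $ j $ i) \<le> M * r ^ (i + j)}"

definition deriv_s :: "series2 \<Rightarrow> series2" where "deriv_s f = Abs_fps (\<lambda>j. fps_deriv (f $ j))"
definition deriv_t :: "series2 \<Rightarrow> series2" where "deriv_t f = fps_deriv f"

definition tjurina_ideal :: "series2 \<Rightarrow> series2 set" where
  "tjurina_ideal f = {a * f + b * deriv_s f + c * deriv_t f | a b c.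
     a \<in> convergent_series \<and> b \<in> convergent_series \<and> c \<in> convergent_series}"

text \<open>
  B represents a basis of the complex vector space V / W: every element of V is, modulo W,
  a unique linear combination of B (coefficient functions are normalised to vanish outside B).
\<close>

definition quotient_basis :: "series2 set \<Rightarrow> series2 set \<Rightarrow> series2 set \<Rightarrow> bool" where
  "quotient_basis V W B \<longleftrightarrow> finite B \<and> B \<subseteq> V \<and>
     (\<forall>h\<in>V. \<exists>!l. (\<forall>b. b \<notin> B \<longrightarrow> l b = 0) \<and> h - (\<Sum>b\<in>B. cst2 (l b) * b) \<in> W)"

text \<open>As for the library's \<open>dim\<close>, the dimension is 0 if there is no finite basis.\<close>

definition quotient_dim :: "series2 set \<Rightarrow> series2 set \<Rightarrow> nat" where
  "quotient_dim V W =
     (if \<exists>B. quotient_basis V W B then card (SOME B. quotient_basis V W B) else 0)"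

definition tjurina_number :: "S \<Rightarrow> point \<Rightarrow> nat" where
  "tjurina_number G P = quotient_dim convergent_series (tjurina_ideal (local_series G P))"

text \<open>A reduced curve has finitely many singular points.\<close>

definition total_tjurina_number :: "S \<Rightarrow> nat" where
  "total_tjurina_number G = (\<Sum>P\<in>singular_points G. tjurina_number G P)"


section \<open>Simple singularities\<close>

definition holomorphic2_on :: "(complex \<times> complex \<Rightarrow> complex) \<Rightarrow> (complex \<times> complex) set \<Rightarrow> bool" where
  "holomorphic2_on f U \<longleftrightarrow>
     (\<forall>p\<in>U. \<exists>a b. (f has_derivative (\<lambda>(h, k). a * h + b * k)) (at p))"

definition biholomorphic2 :: "(complex \<times> complex \<Rightarrow> complex \<times> complex) \<Rightarrow>
    (complex \<times> complex) set \<Rightarrow> (complex \<times> complex) set \<Rightarrow> bool" where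
  "biholomorphic2 \<phi> U V \<longleftrightarrow> open U \<and> open V \<and> bij_betw \<phi> U V \<and>
     holomorphic2_on (fst \<circ> \<phi>) U \<and> holomorphic2_on (snd \<circ> \<phi>) U \<and>
     (\<exists>\<psi>. (\<forall>p\<in>U. \<psi> (\<phi> p) = p) \<and> holomorphic2_on (fst \<circ> \<psi>) V \<and> holomorphic2_on (snd \<circ> \<psi>) V)"

inductive ADE_normal_form :: "(complex \<times> complex \<Rightarrow> complex) \<Rightarrow> bool" where
  A: "k \<ge> 1 \<Longrightarrow> ADE_normal_form (\<lambda>(x, y). x ^ 2 + y ^ (k + 1))"
| D: "k \<ge> 4 \<Longrightarrow> ADE_normal_form (\<lambda>(x, y). x ^ 2 * y + y ^ (k - 1))"
| E6: "ADE_normal_form (\<lambda>(x, y). x ^ 3 + y ^ 4)"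
| E7: "ADE_normal_form (\<lambda>(x, y). x ^ 3 + x * y ^ 3)"
| E8: "ADE_normal_form (\<lambda>(x, y). x ^ 3 + y ^ 5)"

text \<open>
  The curve germ f = 0 at the origin is analytically isomorphic to the germ of a normal form N:
  in suitable local analytic coordinates, f and N agree up to a nowhere vanishing factor.
\<close>

definition ADE_germ :: "(complex \<times> complex \<Rightarrow> complex) \<Rightarrow> bool" where
  "ADE_germ f \<longleftrightarrow> (\<exists>N U V \<phi> u. ADE_normal_form N \<and>
     biholomorphic2 \<phi> U V \<and> (0, 0) \<in> U \<and> \<phi> (0, 0) = (0, 0) \<and>
     holomorphic2_on u U \<and> (\<forall>p\<in>U. u p \<noteq> 0 \<and> f p = u p * N (\<phi> p)))"

definition maximizing :: "nat \<Rightarrow> S \<Rightarrow> bool" where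
  "maximizing e G \<longleftrightarrow> reduced_plane_curve e G \<and>
     (\<forall>P\<in>singular_points G. ADE_germ (local_fun G P)) \<and>
     ((\<exists>m. e = 2 * m \<and> total_tjurina_number G = 3 * m * (m - 1) + 1) \<or>
      (\<exists>m. e = 2 * m + 1 \<and> total_tjurina_number G = 3 * m ^ 2 + 1))"

end

theory Submission
  imports
    Defs
    "HOL-Computational_Algebra.Field_as_Ring"
    "HOL-Complex_Analysis.Conformal_Mappings"
begin

text \<open>
  Put \<open>u = x\<^sup>d + y\<^sup>d\<close> and \<open>w = z\<^sup>d\<close>. Both \<open>G = u (u + w)\<close> and \<open>G = z u (u + w)\<close> satisfy
  \<open>G\<^sub>x = x\<^bsup>d-1\<^esup> A\<close>, \<open>G\<^sub>y = y\<^bsup>d-1\<^esup> A\<close>, \<open>G\<^sub>z = u B\<close> with \<open>A\<close> and \<open>u B\<close> coprime, so the module of Jacobian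
  derivations is generated by \<open>y\<^bsup>d-1\<^esup> \<partial>\<^sub>x - x\<^bsup>d-1\<^esup> \<partial>\<^sub>y\<close> and \<open>B (x \<partial>\<^sub>x + y \<partial>\<^sub>y) - A \<partial>\<^sub>z\<close>.
  For \<open>d = 3\<close> the singularities are an ordinary triple point (\<open>D\<^sub>4\<close>) at \<open>(0:0:1)\<close> and, at each \<open>p\<^sub>\<epsilon>\<close>, a
  cubic with its inflectional tangent, \<open>U (U + t\<^sup>3) = (U + t\<^sup>3/2)\<^sup>2 - t\<^sup>6/4\<close> in the local coordinate
  \<open>U = (\<epsilon> + s)\<^sup>3 + 1\<close> (\<open>A\<^sub>5\<close>), which the line \<open>t = 0\<close> turns into a \<open>D\<^sub>8\<close>. Each Tjurina ideal is described
  as the common kernel of explicit linear functionals, whose number is the Tjurina number: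
  \<open>4 + 3 \<cdot> 5 = 19\<close> and \<open>4 + 3 \<cdot> 8 = 28\<close>.
\<close>

text \<open>Freeness rests on \<open>x^d + y^d\<close> being itself
  \<open>x * x^(d-1) + y * y^(d-1)\<close>: once \<open>A\<close> divides the third component of a
  derivation, a multiple of the second generator removes it, and only a syzygy of the coprime powers
  \<open>x^(d-1)\<close>, \<open>y^(d-1)\<close> is left. For the Tjurina numbers the obstacle is
  convergence: membership in the ideal demands convergent cofactors. Therefore each unit to be
  inverted gets an explicit inverse. At the triple point, and for the derivative of
  \<open>U\<close>, a polynomial identity supplies an inverse modulo the ideal; the cofactor of
  \<open>s\<close> in \<open>U\<close> is a quadratic that splits into linear factors, inverted by
  geometric series. Otherwise infinite sums occur only where a given convergent series is divided by
  a monomial, which merely shifts its coefficients. The kernel of the functionals is at the same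
  time the least ideal containing a short list of polynomials, so each equality of ideals becomes
  two lists of polynomial identities. The Tjurina numbers are computed from the local equations
  themselves; the ADE types come from separate coordinate changes.\<close>

section \<open>Evaluation\<close>

text \<open>\<open>eval3\<close> is used with values in the complex numbers and in
  \<open>series2\<close>. Treating it as a composite of three one-variable evaluations along an
  arbitrary homomorphism handles both at once.\<close>

definition unital_hom :: "('a::comm_ring_1 \<Rightarrow> 'b::comm_ring_1) \<Rightarrow> bool" where
  "unital_hom \<phi> \<longleftrightarrow> \<phi> 1 = 1 \<and> (\<forall>a b. \<phi> (a + b) = \<phi> a + \<phi> b) \<and> (\<forall>a b. \<phi> (a * b) = \<phi> a * \<phi> b)"

lemma unital_hom_simps:
  assumes "unital_hom \<phi>"
  shows "\<phi> 1 = 1" "\<phi> (a + b) = \<phi> a + \<phi> b" "\<phi> (a * b) = \<phi> a * \<phi> b" "\<phi> 0 = 0"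
    "\<phi> (- a) = - \<phi> a" "\<phi> (a - b) = \<phi> a - \<phi> b" "\<phi> (a ^ n) = \<phi> a ^ n" "\<phi> (of_nat n) = of_nat n"
proof -
  show h: "\<phi> 1 = 1" and add: "\<phi> (a + b) = \<phi> a + \<phi> b" and mult: "\<phi> (a * b) = \<phi> a * \<phi> b" for a b
    using assms by (auto simp: unital_hom_def)
  show zero: "\<phi> 0 = 0" using add[of 0 0] by simp
  show min: "\<phi> (- a) = - \<phi> a" for a
    using add[of a "- a"] zero by (simp add: eq_neg_iff_add_eq_0 add.commute)
  show "\<phi> (a - b) = \<phi> a - \<phi> b" using add[of a "- b"] min by simp
  show "\<phi> (a ^ n) = \<phi> a ^ n" by (induction n) (auto simp: h mult)
  show "\<phi> (of_nat n) = of_nat n" by (induction n) (auto simp: h add zero)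
qed

definition hom_eval :: "('a::comm_ring_1 \<Rightarrow> 'r::comm_ring_1) \<Rightarrow> 'r \<Rightarrow> 'a poly \<Rightarrow> 'r" where
  "hom_eval \<phi> x p = (\<Sum>i\<le>degree p. \<phi> (coeff p i) * x ^ i)"

lemma hom_eval_eq_poly:
  assumes "\<phi> 0 = 0"
  shows "hom_eval \<phi> x p = poly (map_poly \<phi> p) x"
proof -
  have "poly (map_poly \<phi> p) x = (\<Sum>i\<le>degree p. coeff (map_poly \<phi> p) i * x ^ i)"
    unfolding poly_altdef
    \<comment> \<open>\<open>\<phi>\<close> may kill leading coefficients, so the right-hand sum can
      run over extra indices, where all terms are zero.\<close>
    by (rule sum.mono_neutral_left)
       (auto simp: coeff_eq_0 not_le coeff_map_poly assms map_poly_degree_leq)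
  thus ?thesis by (simp add: hom_eval_def coeff_map_poly assms)
qed

lemma map_poly_mult_hom:
  assumes "unital_hom \<phi>"
  shows "map_poly \<phi> (p * q) = map_poly \<phi> p * map_poly \<phi> q"
proof (rule poly_eqI)
  note h = unital_hom_simps[OF assms]
  have s: "\<phi> (sum f A) = (\<Sum>i\<in>A. \<phi> (f i))" for f and A :: "nat set"
    by (induction A rule: infinite_finite_induct) (auto simp: h)
  fix n
  show "coeff (map_poly \<phi> (p * q)) n = coeff (map_poly \<phi> p * map_poly \<phi> q) n"
    by (simp add: coeff_map_poly h coeff_mult s)
qed

lemma unital_hom_hom_eval:
  assumes "unital_hom \<phi>"
  shows "unital_hom (hom_eval \<phi> x)"
proof -
  note h = unital_hom_simps[OF assms]
  have "map_poly \<phi> (p + q) = map_poly \<phi> p + map_poly \<phi> q" for p q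
    by (rule poly_eqI) (simp add: coeff_map_poly h)
  thus ?thesis
    by (auto simp: unital_hom_def hom_eval_eq_poly h map_poly_1' map_poly_mult_hom[OF assms])
qed

lemma hom_eval_const [simp]: "hom_eval \<phi> x [:a:] = \<phi> a"
  by (simp add: hom_eval_def)

lemma hom_eval_var:
  assumes "unital_hom \<phi>"
  shows "hom_eval \<phi> x [:0, 1:] = x"
  by (simp add: hom_eval_def unital_hom_simps[OF assms])

lemma eval3_eq_hom_eval:
  "eval3 \<iota> G (u, v, w) = hom_eval (hom_eval (hom_eval \<iota> u) v) w G"
  by (simp add: eval3_def hom_eval_def sum_distrib_right)

lemma unital_hom_eval3:
  assumes "unital_hom \<iota>"
  shows "unital_hom (\<lambda>G. eval3 \<iota> G q)"
proof -
  obtain u v w where q: "q = (u, v, w)" by (cases q)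
  show ?thesis unfolding q eval3_eq_hom_eval
    using unital_hom_hom_eval[OF unital_hom_hom_eval[OF unital_hom_hom_eval[OF assms]]] .
qed

lemma eval3_vars:
  assumes "unital_hom \<iota>"
  shows "eval3 \<iota> vx (u, v, w) = u" "eval3 \<iota> vy (u, v, w) = v" "eval3 \<iota> vz (u, v, w) = w"
    "eval3 \<iota> (cst c) (u, v, w) = \<iota> c"
  using assms
  by (simp_all add: eval3_eq_hom_eval vx_def vy_def vz_def cst_def hom_eval_var unital_hom_hom_eval)

lemma unital_hom_id: "unital_hom (\<lambda>c::complex. c)"
  by (simp add: unital_hom_def)

lemmas eval3_simps = unital_hom_simps[OF unital_hom_eval3] eval3_vars

lemmas ev_simps = eval3_simps[OF unital_hom_id]

section \<open>Partial derivatives\<close>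

definition derivation_map :: "('a::comm_ring_1 \<Rightarrow> 'a) \<Rightarrow> bool" where
  "derivation_map D \<longleftrightarrow> (\<forall>a b. D (a + b) = D a + D b) \<and> (\<forall>a b. D (a * b) = D a * b + a * D b)"

lemma derivation_map_simps:
  assumes "derivation_map D"
  shows "D (a + b) = D a + D b" "D (a * b) = D a * b + a * D b" "D 0 = 0" "D 1 = 0"
    "D (a ^ n) = of_nat n * a ^ (n - 1) * D a"
proof -
  show add: "D (a + b) = D a + D b" and mult: "D (a * b) = D a * b + a * D b" for a b
    using assms by (auto simp: derivation_map_def)
  show "D 0 = 0" using add[of 0 0] by simp
  show one: "D 1 = 0" using mult[of 1 1] by simp
  show "D (a ^ n) = of_nat n * a ^ (n - 1) * D a"
  proof (induction n)
    case (Suc n)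
    have "a * (of_nat n * a ^ (n - 1)) = of_nat n * a ^ n" by (cases n) (auto simp: ac_simps)
    hence "a * D (a ^ n) = of_nat n * a ^ n * D a" by (simp add: Suc flip: mult.assoc)
    thus ?case by (simp add: mult algebra_simps)
  qed (simp add: one)
qed

text \<open>By the Leibniz rule every term of \<open>D (q * (q * r))\<close> keeps a factor
  \<open>q\<close>. This is what turns coprime partials into squarefreeness.\<close>

lemma derivation_map_square_dvd:
  assumes "derivation_map D" "q ^ 2 dvd G"
  shows "q dvd D G"
proof -
  obtain r where r: "G = q * (q * r)" using assms(2) by (auto simp: dvd_def power2_eq_square ac_simps)
  show ?thesis unfolding r by (simp add: derivation_map_simps[OF assms(1)] dvd_add)
qed

lemma derivation_map_pderiv: "derivation_map (pderiv :: 'a::idom poly \<Rightarrow> _)"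
  by (auto simp: derivation_map_def pderiv_add pderiv_mult algebra_simps)

text \<open>Coefficients of a product are sums of products, so the Leibniz rule passes from
  coefficients to polynomials. Lifting \<open>pderiv\<close> once gives \<open>dy\<close>, lifting
  it twice gives \<open>dx\<close>.\<close>

lemma derivation_map_map_poly:
  assumes "derivation_map D"
  shows "derivation_map (map_poly D)"
proof -
  note h = derivation_map_simps[OF assms]
  have s: "D (sum f A) = (\<Sum>i\<in>A. D (f i))" for f and A :: "nat set"
    by (induction A rule: infinite_finite_induct) (auto simp: h)
  have "map_poly D (a + b) = map_poly D a + map_poly D b" for a b
    by (rule poly_eqI) (simp add: coeff_map_poly h)
  moreover have "map_poly D (a * b) = map_poly D a * b + a * map_poly D b" for a b
    by (rule poly_eqI) (simp add: coeff_map_poly h coeff_mult s sum.distrib)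
  ultimately show ?thesis by (simp add: derivation_map_def)
qed

lemma derivation_map_dx: "derivation_map dx"
  and derivation_map_dy: "derivation_map dy"
  and derivation_map_dz: "derivation_map dz"
  unfolding dx_def dy_def dz_def by (intro derivation_map_map_poly derivation_map_pderiv)+

lemma partial_vars [simp]:
  "dx vx = 1" "dx vy = 0" "dx vz = 0"
  "dy vx = 0" "dy vy = 1" "dy vz = 0"
  "dz vx = 0" "dz vy = 0" "dz vz = 1"
  by (simp_all add: dx_def dy_def dz_def vx_def vy_def vz_def map_poly_pCons pderiv_pCons
      map_poly_1 flip: one_pCons)

lemmas partial_simps =
  derivation_map_simps[OF derivation_map_dx] derivation_map_simps[OF derivation_map_dy]
  derivation_map_simps[OF derivation_map_dz]

section \<open>Homogeneous polynomials\<close>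

lemma homogeneous_0 [simp]: "homogeneous n 0"
  by (simp add: homogeneous_def)

lemma homogeneous_add: "homogeneous n G \<Longrightarrow> homogeneous n H \<Longrightarrow> homogeneous n (G + H)"
  unfolding homogeneous_def coeff_add by (metis add.right_neutral)

lemma homogeneous_uminus: "homogeneous n G \<Longrightarrow> homogeneous n (- G)"
  by (simp add: homogeneous_def)

lemma homogeneous_mult:
  assumes "homogeneous m G" "homogeneous n H"
  shows "homogeneous (m + n) (G * H)"
  unfolding homogeneous_def
proof (intro allI impI)
  fix i j k assume "coeff (coeff (coeff (G * H) k) j) i \<noteq> 0"
  hence "(\<Sum>k'\<le>k. \<Sum>j'\<le>j. \<Sum>i'\<le>i. coeff (coeff (coeff G k') j') i' *
      coeff (coeff (coeff H (k - k')) (j - j')) (i - i')) \<noteq> 0"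
    by (simp add: coeff_mult coeff_sum)
  then obtain k' j' i' where k: "k' \<le> k" and j: "j' \<le> j" and i: "i' \<le> i" and
    *: "coeff (coeff (coeff G k') j') i' \<noteq> 0" "coeff (coeff (coeff H (k - k')) (j - j')) (i - i') \<noteq> 0"
    by (elim sum.not_neutral_contains_not_neutral) auto
  from * have "i' + j' + k' = m" "(i - i') + (j - j') + (k - k') = n"
    using assms by (auto simp: homogeneous_def)
  thus "i + j + k = m + n" using i j k by linarith
qed

lemma homogeneous_vars: "homogeneous 1 vx" "homogeneous 1 vy" "homogeneous 1 vz"
  by (auto simp: homogeneous_def vx_def vy_def vz_def coeff_pCons coeff_1 split: nat.splits if_splits)

lemma homogeneous_cst: "homogeneous 0 (cst c)"
  by (auto simp: homogeneous_def cst_def coeff_pCons split: nat.splits)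

lemma homogeneous_power: "homogeneous m G \<Longrightarrow> homogeneous (n * m) (G ^ n)"
proof (induction n)
  case 0
  show ?case using homogeneous_cst[of 1] by (simp add: cst_def flip: one_pCons)
next
  case (Suc n)
  thus ?case using homogeneous_mult[of m G "n * m" "G ^ n"] by simp
qed

lemma homogeneous_of_nat: "homogeneous 0 (of_nat n)"
  by (induction n) (use homogeneous_cst[of 1] in \<open>auto simp: cst_def intro: homogeneous_add simp flip: one_pCons\<close>)

lemma homogeneous_var_powers:
  "homogeneous n (vx ^ n)" "homogeneous n (vy ^ n)" "homogeneous n (vz ^ n)"
  using homogeneous_power[OF homogeneous_vars(1)] homogeneous_power[OF homogeneous_vars(2)]
    homogeneous_power[OF homogeneous_vars(3)] by simp_all

lemma ev_homogeneous:
  assumes "homogeneous n G"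
  shows "ev G (l * a, l * b, l * c) = l ^ n * ev G (a, b, c)"
proof -
  have "C * (l * a) ^ i * (l * b) ^ j * (l * c) ^ k = l ^ n * (C * a ^ i * b ^ j * c ^ k)"
    if "C = coeff (coeff (coeff G k) j) i" for C i j k
  proof (cases "C = 0")
    case False
    hence "n = i + j + k" using assms that by (auto simp: homogeneous_def)
    thus ?thesis by (simp add: power_add power_mult_distrib)
  qed simp
  thus ?thesis unfolding eval3_def by (simp only: prod.case sum_distrib_left)
qed

section \<open>Coprimality and squarefreeness\<close>

text \<open>A divisor of a nonzero constant has degree 0, and a constant that divides the variable
  divides its leading coefficient 1.\<close>

lemma coprime_const_poly_var:
  fixes q :: "'a::idom_divide"
  assumes "q \<noteq> 0"
  shows "coprime [:q:] [:0, 1:]"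
proof (rule coprimeI)
  fix c assume c: "c dvd [:q:]" "c dvd [:0, 1:]"
  have "degree c = 0" using c(1) assms dvd_imp_degree_le[of c "[:q:]"] by simp
  then obtain a where a: "c = [:a:]" by (meson degree_eq_zeroE)
  obtain e where "[:0, 1:] = [:a:] * e" using c(2) a by (auto simp: dvd_def)
  from arg_cong[OF this, of "\<lambda>p. coeff p 1"] have "1 = a * coeff e 1" by simp
  hence "a dvd 1" by (auto simp: dvd_def)
  thus "is_unit c" by (simp add: a is_unit_const_poly_iff)
qed

lemma coprime_const_poly:
  fixes a b :: "'a::{algebraic_semidom,idom_divide}"
  assumes "coprime a b" "a \<noteq> 0"
  shows "coprime [:a:] [:b:]"
proof (rule coprimeI)
  fix c assume c: "c dvd [:a:]" "c dvd [:b:]"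
  have "degree c = 0" using c(1) assms dvd_imp_degree_le[of c "[:a:]"] by simp
  then obtain e where e: "c = [:e:]" by (meson degree_eq_zeroE)
  have "e dvd a" "e dvd b" using c by (simp_all add: e)
  thus "is_unit c" using assms(1) by (simp add: e is_unit_const_poly_iff coprime_common_divisor)
qed

lemma coprime_vx_vy: "coprime (vx ^ m) (vy ^ n)"
  unfolding vx_def vy_def
  by (intro coprime_power_left_iff[THEN iffD2] coprime_power_right_iff[THEN iffD2] disjI1
      coprime_const_poly coprime_const_poly_var) auto

abbreviation (input) fermat2 :: "nat \<Rightarrow> S" where
  "fermat2 d \<equiv> vx ^ d + vy ^ d"

lemma coprime_fermat2_vz: "coprime (fermat2 d) (vz ^ n)"
proof -
  have p: "[:q:] ^ n = [:q ^ n:]" for q :: "'a::comm_ring_1" and n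
    by (induction n) (auto simp: mult.commute)
  \<comment> \<open>\<open>fermat2 d\<close> is constant in \<open>z\<close>, so only its
    nonvanishing is at stake. Setting \<open>y = 0\<close> and then \<open>x = 1\<close> leaves
    \<open>1 + 0 ^ d\<close>, which is 1 or 2.\<close>
  have "poly ([:[:0, 1:]:] ^ d + [:0, 1:] ^ d :: complex poly poly) 0 = [:0, 1:] ^ d + 0 ^ d"
    by simp
  moreover have "poly ([:0, 1:] ^ d + 0 ^ d :: complex poly) 1 = 1 + 0 ^ d"
    by simp
  moreover have "(1 + 0 ^ d :: complex) \<noteq> 0" by (cases d) auto
  ultimately have "[:[:0, 1:]:] ^ d + [:0, 1:] ^ d \<noteq> (0 :: complex poly poly)" by force
  thus ?thesis
    unfolding vx_def vy_def vz_def p by (simp add: coprime_const_poly_var)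
qed

lemma is_unit_of_nat: "n > 0 \<Longrightarrow> is_unit (of_nat n :: S)"
  by (simp add: of_nat_poly is_unit_const_poly_iff dvd_field_iff)

lemma is_unit_numeral: "is_unit (numeral n :: S)"
  using is_unit_of_nat[of "numeral n"] by simp

text \<open>These are the factors of \<open>A\<close> and \<open>u B\<close> for the two curves.
  Each pair consists of different linear forms in \<open>u\<close> and \<open>w\<close> (or involves
  \<open>z\<close>, which divides \<open>w\<close>), so a common divisor divides both
  \<open>u\<close> and \<open>w\<close>, or \<open>u\<close> and \<open>z\<close>, up to integer
  factors that are units of \<open>S\<close>.\<close>

lemma coprime_partials:
  fixes u w z :: S
  assumes "coprime u z" and "w = z ^ Suc n"
  shows "coprime (2 * u + w) u" "coprime (2 * u + w) z" "coprime (2 * u + w) (u + (of_nat k + 1) * w)"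
    "coprime z (u + (of_nat k + 1) * w)"
proof -
  have uw: "coprime u w" using assms by simp
  have zw: "z dvd w" using assms by simp
  show "coprime (2 * u + w) u"
  proof (rule coprimeI)
    fix c assume "c dvd 2 * u + w" "c dvd u"
    thus "is_unit c" using uw by (metis coprime_common_divisor dvd_add_right_iff dvd_mult)
  qed
  show "coprime (2 * u + w) z"
  proof (rule coprimeI)
    fix c assume c: "c dvd 2 * u + w" "c dvd z"
    hence "c dvd 2 * u" using zw by (metis dvd_add_left_iff dvd_trans)
    hence "c dvd u" using is_unit_numeral by (metis dvd_mult_unit_iff')
    thus "is_unit c" using c assms(1) by (metis coprime_common_divisor)
  qed
  show "coprime (2 * u + w) (u + (of_nat k + 1) * w)"
  proof (rule coprimeI)
    fix c assume c: "c dvd 2 * u + w" "c dvd u + (of_nat k + 1) * w"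
    \<comment> \<open>Eliminating \<open>u\<close> leaves an odd integer as the multiplier of
      \<open>w\<close>, hence a nonzero one.\<close>
    have "2 * (u + (of_nat k + 1) * w) - (2 * u + w) = of_nat (2 * k + 1) * w"
      by (simp add: algebra_simps)
    hence "c dvd of_nat (2 * k + 1) * w" using c by (metis dvd_diff dvd_mult)
    hence w: "c dvd w" using is_unit_of_nat[of "2 * k + 1"] by (metis dvd_mult_unit_iff' add_gr_0 zero_less_one)
    hence "c dvd 2 * u" using c(1) by (metis dvd_add_left_iff)
    hence "c dvd u" using is_unit_numeral by (metis dvd_mult_unit_iff')
    thus "is_unit c" using w uw by (metis coprime_common_divisor)
  qed
  show "coprime z (u + (of_nat k + 1) * w)"
  proof (rule coprimeI)
    fix c assume c: "c dvd z" "c dvd u + (of_nat k + 1) * w"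
    hence "c dvd u" using zw by (metis dvd_add_left_iff dvd_mult dvd_trans)
    thus "is_unit c" using c assms(1) by (metis coprime_common_divisor)
  qed
qed

text \<open>A Bezout combination of \<open>x^m\<close> and \<open>y^m\<close> does not exist in
  \<open>S\<close> for positive \<open>m\<close>; the gcd of the two multiples is used
  instead.\<close>

lemma dvd_of_coprime_multiples:
  fixes a b c q :: "'a::{semiring_gcd}"
  assumes "coprime a b" "q dvd a * c" "q dvd b * c"
  shows "q dvd c"
proof -
  have "q dvd gcd (c * a) (c * b)" using assms by (simp add: mult.commute)
  thus ?thesis using assms(1) by (simp add: gcd_mult_left)
qed

text \<open>A square factor \<open>q^2\<close> makes \<open>q\<close> divide all partials. Since
  \<open>x^m\<close> and \<open>y^m\<close> are coprime, \<open>q\<close> divides \<open>A\<close>,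
  and it also divides \<open>dz G\<close>.\<close>

lemma squarefree_of_coprime_partials:
  assumes "dx G = vx ^ m * A" "dy G = vy ^ m * A" "coprime A (dz G)"
  shows "squarefree G"
proof (rule squarefreeI)
  fix q assume q: "q ^ 2 dvd G"
  have "q dvd vx ^ m * A" "q dvd vy ^ m * A" "q dvd dz G"
    using derivation_map_square_dvd[OF _ q] derivation_map_dx derivation_map_dy derivation_map_dz
    by (metis assms)+
  thus "q dvd 1" using assms(3) dvd_of_coprime_multiples[OF coprime_vx_vy] coprime_common_divisor by blast
qed

section \<open>Free curves\<close>

lemma homogeneous_basis_pair:
  assumes G: "dx G = vx ^ m * A" "dy G = vy ^ m * A" "dz G = fermat2 (Suc m) * B"
    and cop: "coprime A (fermat2 (Suc m) * B)" and A: "A \<noteq> 0"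
    and hom: "homogeneous r A" "homogeneous s B" "r = s + 1"
    and \<theta>: "\<theta>1 = (vy ^ m, - (vx ^ m), 0)" "\<theta>2 = (vx * B, vy * B, - A)"
  shows "\<theta>1 \<noteq> \<theta>2" "homogeneous_basis G {\<theta>1, \<theta>2}" "has_degree \<theta>1 m" "has_degree \<theta>2 r"
proof -
  show ne: "\<theta>1 \<noteq> \<theta>2" using A by (auto simp: \<theta>)
  show d1: "has_degree \<theta>1 m"
    by (simp add: has_degree_def \<theta> homogeneous_var_powers homogeneous_uminus)
  show d2: "has_degree \<theta>2 r"
    using homogeneous_mult[OF homogeneous_vars(1) hom(2)] homogeneous_mult[OF homogeneous_vars(2) hom(2)]
    by (simp add: has_degree_def \<theta> hom(1)[unfolded hom(3), simplified] hom(3) homogeneous_uminus add.commute)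
  have ny: "vy ^ m \<noteq> 0" by (simp add: vy_def)
  \<comment> \<open>The third component gives \<open>q * A = 0\<close>; the first one then gives
    \<open>p * y^m = 0\<close>.\<close>
  have ind: "p = 0 \<and> q = 0" if "smult3 p \<theta>1 + smult3 q \<theta>2 = 0" for p q
    using that A ny by (auto simp: smult3_def \<theta> zero_prod_def)
  have "Der.independent {\<theta>1, \<theta>2}"
    unfolding Der.dependent_finite[of "{\<theta>1, \<theta>2}", simplified] using ne ind by auto
  moreover have "Der.span {\<theta>1, \<theta>2} = D0 G"
  proof (intro subset_antisym subsetI)
    fix \<delta> assume "\<delta> \<in> Der.span {\<theta>1, \<theta>2}"
    then obtain p q where "\<delta> - smult3 p \<theta>1 = smult3 q \<theta>2"
      by (auto simp: Der.span_insert Der.span_singleton)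
    hence "\<delta> = smult3 p \<theta>1 + smult3 q \<theta>2" by (simp add: algebra_simps)
    thus "\<delta> \<in> D0 G" by (simp add: D0_def smult3_def \<theta> G algebra_simps)
  next
    fix \<delta> assume "\<delta> \<in> D0 G"
    then obtain a b c where \<delta>: "\<delta> = (a, b, c)"
      and rel: "a * (vx ^ m * A) + b * (vy ^ m * A) + c * (fermat2 (Suc m) * B) = 0"
      by (auto simp: D0_def G)
    have "c * (fermat2 (Suc m) * B) = A * - (a * vx ^ m + b * vy ^ m)"
      using rel by (simp add: algebra_simps eq_neg_iff_add_eq_0)
    hence "A dvd c * (fermat2 (Suc m) * B)" by (metis dvd_triv_left)
    hence "A dvd c" using cop coprime_dvd_mult_left_iff by blast
    then obtain e' where "c = A * e'" by (auto simp: dvd_def)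
    \<comment> \<open>The sign makes \<open>e\<close> the coefficient of \<open>\<theta>2\<close>,
      whose last component is \<open>- A\<close>.\<close>
    then obtain e where c: "c = - (e * A)" by (metis mult.commute mult_minus_left minus_minus)
    have "A * (a * vx ^ m + b * vy ^ m) = A * (fermat2 (Suc m) * B * e)"
      using rel by (simp add: c algebra_simps)
    hence "a * vx ^ m + b * vy ^ m = fermat2 (Suc m) * B * e" using A by simp
    \<comment> \<open>\<open>fermat2 (Suc m)\<close> is split as \<open>x * x^m + y * y^m\<close>
      and its halves are moved to the terms with \<open>x^m\<close> and \<open>y^m\<close>. The
      resulting syzygy of two coprime powers yields the coefficient \<open>f\<close> of
      \<open>\<theta>1\<close>.\<close>
    hence eq: "(a - e * (vx * B)) * vx ^ m = (e * (vy * B) - b) * vy ^ m"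
      by (simp add: algebra_simps)
    hence "vy ^ m dvd (a - e * (vx * B)) * vx ^ m" by simp
    hence "vy ^ m dvd a - e * (vx * B)"
      using coprime_vx_vy[of m m] by (simp add: coprime_dvd_mult_left_iff coprime_commute)
    then obtain f where f: "a - e * (vx * B) = vy ^ m * f" by (auto simp: dvd_def)
    hence "vy ^ m * (f * vx ^ m) = vy ^ m * (e * (vy * B) - b)" using eq by (simp add: ac_simps)
    hence "f * vx ^ m = e * (vy * B) - b" using ny mult_left_cancel by blast
    hence "\<delta> - smult3 f \<theta>1 = smult3 e \<theta>2"
      using f by (auto simp: \<delta> \<theta> smult3_def c algebra_simps)
    thus "\<delta> \<in> Der.span {\<theta>1, \<theta>2}"
      by (auto simp: Der.span_insert Der.span_singleton)
  qed
  ultimately show "homogeneous_basis G {\<theta>1, \<theta>2}"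
    using d1 d2 by (auto simp: homogeneous_basis_def)
qed

text \<open>All three polynomials depend on \<open>x\<close> and \<open>y\<close> only through
  \<open>u\<close>, so the chain rule gives \<open>d x^m\<close> and \<open>d y^m\<close> times one
  common cofactor, the derivative with respect to \<open>u\<close>.\<close>

lemma fermat_partials:
  fixes m :: nat
  defines "d \<equiv> Suc m"
  defines "u \<equiv> fermat2 d" and "w \<equiv> vz ^ d"
  shows "dx (u + w) = vx ^ m * of_nat d" "dy (u + w) = vy ^ m * of_nat d" "dz (u + w) = vz ^ m * of_nat d"
    "dx (u * (u + w)) = vx ^ m * (of_nat d * (2 * u + w))"
    "dy (u * (u + w)) = vy ^ m * (of_nat d * (2 * u + w))"
    "dz (u * (u + w)) = u * (of_nat d * vz ^ m)"
    "dx (vz * (u * (u + w))) = vx ^ m * (of_nat d * (vz * (2 * u + w)))"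
    "dy (vz * (u * (u + w))) = vy ^ m * (of_nat d * (vz * (2 * u + w)))"
    "dz (vz * (u * (u + w))) = u * (u + (of_nat d + 1) * w)"
proof -
  have w: "vz * vz ^ m = w" by (simp add: w_def d_def)
  have du: "dx u = of_nat d * vx ^ m" "dy u = of_nat d * vy ^ m" "dz u = 0"
    "dx w = 0" "dy w = 0" "dz w = of_nat d * vz ^ m"
    by (simp_all add: u_def w_def d_def partial_simps del: power_Suc of_nat_Suc)
  show "dx (u + w) = vx ^ m * of_nat d" "dy (u + w) = vy ^ m * of_nat d" "dz (u + w) = vz ^ m * of_nat d"
    "dx (u * (u + w)) = vx ^ m * (of_nat d * (2 * u + w))"
    "dy (u * (u + w)) = vy ^ m * (of_nat d * (2 * u + w))"
    "dz (u * (u + w)) = u * (of_nat d * vz ^ m)"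
    "dx (vz * (u * (u + w))) = vx ^ m * (of_nat d * (vz * (2 * u + w)))"
    "dy (vz * (u * (u + w))) = vy ^ m * (of_nat d * (vz * (2 * u + w)))"
    by (simp_all add: partial_simps du algebra_simps)
  have "dz (vz * (u * (u + w))) = u * (u + w) + u * (of_nat d * (vz * vz ^ m))"
    by (simp add: partial_simps du algebra_simps)
  thus "dz (vz * (u * (u + w))) = u * (u + (of_nat d + 1) * w)"
    unfolding w by (simp add: algebra_simps)
qed

section \<open>The Fermat curve and its tangent lines\<close>

lemma zero_locus_subset_P2: "zero_locus G \<subseteq> P2"
  by (auto simp: zero_locus_def)

lemma P2_E:
  assumes "P \<in> P2"
  obtains a b c where "P = hpoint a b c" "(a, b, c) \<noteq> (0, 0, 0)"
  using assms unfolding P2_def by blast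

lemma hpoint_self: "(a, b, c) \<in> hpoint a b c"
  unfolding hpoint_def by (rule CollectI, rule exI[of _ 1]) simp

lemma zero_locus_hpoint:
  assumes "homogeneous n G"
  shows "hpoint a b c \<in> zero_locus G \<longleftrightarrow> (a, b, c) \<noteq> (0, 0, 0) \<and> ev G (a, b, c) = 0"
proof (intro iffI conjI notI)
  assume h: "hpoint a b c \<in> zero_locus G"
  show "ev G (a, b, c) = 0" using h hpoint_self[of a b c] by (auto simp: zero_locus_def)
  assume 0: "(a, b, c) = (0, 0, 0)"
  have "hpoint a b c \<in> P2" using h unfolding zero_locus_def by simp
  then obtain a' b' c' where *: "hpoint a b c = hpoint a' b' c'" "(a', b', c') \<noteq> (0, 0, 0)"
    by (rule P2_E)
  have "(a', b', c') \<in> hpoint a b c" unfolding *(1) by (rule hpoint_self)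
  thus False using *(2) 0 by (auto simp: hpoint_def)
next
  assume "(a, b, c) \<noteq> (0, 0, 0) \<and> ev G (a, b, c) = 0"
  thus "hpoint a b c \<in> zero_locus G"
    unfolding zero_locus_def P2_def
    by (auto simp: hpoint_def ev_homogeneous[OF assms])
qed

lemma zero_locus_hpoint':
  assumes "homogeneous n G" "(a, b, c) \<noteq> (0, 0, 0)"
  shows "hpoint a b c \<in> zero_locus G \<longleftrightarrow> ev G (a, b, c) = 0"
  using zero_locus_hpoint[OF assms(1)] assms(2) by simp

text \<open>The representative is picked by \<open>SOME\<close>, so it is known only up to a nonzero
  scale, which every later computation has to carry along.\<close>

lemma coords_hpoint:
  obtains l where "l \<noteq> 0" "coords (hpoint a b c) = (l * a, l * b, l * c)"
proof -
  have "coords (hpoint a b c) \<in> hpoint a b c"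
    unfolding coords_def using hpoint_self by (rule someI)
  thus ?thesis using that by (auto simp: hpoint_def)
qed

lemma hpoint_scale:
  assumes "l \<noteq> 0"
  shows "hpoint (l * a) (l * b) (l * c) = hpoint a b c"
proof (intro subset_antisym subsetI)
  fix v assume "v \<in> hpoint a b c"
  then obtain k where "k \<noteq> 0" "v = (k * a, k * b, k * c)" by (auto simp: hpoint_def)
  thus "v \<in> hpoint (l * a) (l * b) (l * c)"
    unfolding hpoint_def using assms by (intro CollectI exI[of _ "k / l"]) auto
next
  fix v assume "v \<in> hpoint (l * a) (l * b) (l * c)"
  then obtain k where "k \<noteq> 0" "v = (k * (l * a), k * (l * b), k * (l * c))" by (auto simp: hpoint_def)
  thus "v \<in> hpoint a b c"
    unfolding hpoint_def using assms by (intro CollectI exI[of _ "k * l"]) auto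
qed

lemma hpoint_first: "a \<noteq> 0 \<Longrightarrow> hpoint a b c = hpoint 1 (b / a) (c / a)"
  using hpoint_scale[of a 1 "b / a" "c / a"] by simp

lemma hpoint_third: "c \<noteq> 0 \<Longrightarrow> hpoint 0 0 c = hpoint 0 0 1"
  using hpoint_scale[of c 0 0 1] by simp

lemma hpoint_eq_1: "hpoint 1 b c = hpoint 1 b' c' \<longleftrightarrow> b = b' \<and> c = c'"
proof safe
  assume "hpoint 1 b c = hpoint 1 b' c'"
  hence "(1, b, c) \<in> hpoint 1 b' c'" using hpoint_self by metis
  thus "b = b'" "c = c'" by (auto simp: hpoint_def)
qed

lemma hpoint_third_neq: "hpoint 0 0 1 \<noteq> hpoint 1 b c"
proof
  assume "hpoint 0 0 1 = hpoint 1 b c"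
  hence "(1, b, c) \<in> hpoint 0 0 1" using hpoint_self by metis
  thus False by (auto simp: hpoint_def)
qed

lemma homogeneous_fermat2: "homogeneous d (fermat2 d)"
  by (intro homogeneous_add homogeneous_var_powers)

lemma homogeneous_fermat:
  "homogeneous d (fermat2 d + vz ^ d)"
  "homogeneous (2 * d) (fermat2 d * (fermat2 d + vz ^ d))"
  "homogeneous (2 * d + 1) (vz * (fermat2 d * (fermat2 d + vz ^ d)))"
proof -
  show 1: "homogeneous d (fermat2 d + vz ^ d)"
    by (intro homogeneous_add homogeneous_fermat2 homogeneous_var_powers)
  show 2: "homogeneous (2 * d) (fermat2 d * (fermat2 d + vz ^ d))"
    using homogeneous_mult[OF homogeneous_fermat2 1] by (simp add: mult_2)
  show "homogeneous (2 * d + 1) (vz * (fermat2 d * (fermat2 d + vz ^ d)))"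
    using homogeneous_mult[OF homogeneous_vars(3) 2] by simp
qed

lemma homogeneous_of_nat_mult: "homogeneous n G \<Longrightarrow> homogeneous n (of_nat k * G)"
  using homogeneous_mult[OF homogeneous_of_nat[of k], of n G] by simp

lemma homogeneous_fermat_factors:
  "homogeneous d (2 * fermat2 d + vz ^ d)"
  "homogeneous d (fermat2 d + (of_nat k + 1) * vz ^ d)"
proof -
  show "homogeneous d (2 * fermat2 d + vz ^ d)"
    using homogeneous_of_nat_mult[OF homogeneous_fermat2, of d 2]
    by (intro homogeneous_add[of _ "2 * fermat2 d"] homogeneous_var_powers) simp
  have "homogeneous d (of_nat (Suc k) * vz ^ d)"
    by (intro homogeneous_of_nat_mult homogeneous_var_powers)
  thus "homogeneous d (fermat2 d + (of_nat k + 1) * vz ^ d)"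
    by (intro homogeneous_add[of _ "fermat2 d"] homogeneous_fermat2) (simp add: add.commute)
qed

text \<open>Homogeneity lets a single representative decide whether a point lies on the zero loci of
  the partials. The degrees are left as the sums that \<open>homogeneous_mult\<close>
  produces.\<close>

lemma homogeneous_partials_fermat:
  fixes m :: nat
  defines "d \<equiv> Suc m"
  defines "u \<equiv> fermat2 d" and "w \<equiv> vz ^ d"
  shows "homogeneous m (dx (u + w))" "homogeneous m (dy (u + w))" "homogeneous m (dz (u + w))"
    "homogeneous (m + d) (dx (u * (u + w)))" "homogeneous (m + d) (dy (u * (u + w)))"
    "homogeneous (d + m) (dz (u * (u + w)))"
    "homogeneous (m + (1 + d)) (dx (vz * (u * (u + w))))"
    "homogeneous (m + (1 + d)) (dy (vz * (u * (u + w))))"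
    "homogeneous (d + d) (dz (vz * (u * (u + w))))"
proof -
  have u: "homogeneous d u" and w: "homogeneous d w"
    by (simp_all add: u_def w_def homogeneous_fermat2 homogeneous_var_powers)
  have n: "homogeneous n G \<Longrightarrow> homogeneous n (G * of_nat k)" for n G k
    by (subst mult.commute) (rule homogeneous_of_nat_mult)
  have A: "homogeneous d (of_nat d * (2 * u + w))" "homogeneous (1 + d) (of_nat d * (vz * (2 * u + w)))"
    "homogeneous d (u + (of_nat d + 1) * w)"
    unfolding u_def w_def
    by (rule homogeneous_of_nat_mult homogeneous_mult[OF homogeneous_vars(3)] homogeneous_fermat_factors)+
  note p = fermat_partials[of m, folded d_def, folded u_def w_def]
  note v = homogeneous_var_powers
  show "homogeneous m (dx (u + w))" "homogeneous m (dy (u + w))" "homogeneous m (dz (u + w))"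
    unfolding p by (intro n v)+
  show "homogeneous (m + d) (dx (u * (u + w)))" "homogeneous (m + d) (dy (u * (u + w)))"
    "homogeneous (m + (1 + d)) (dx (vz * (u * (u + w))))"
    "homogeneous (m + (1 + d)) (dy (vz * (u * (u + w))))"
    unfolding p using homogeneous_mult[OF v(1) A(1)] homogeneous_mult[OF v(2) A(1)]
      homogeneous_mult[OF v(1) A(2)] homogeneous_mult[OF v(2) A(2)] by simp_all
  show "homogeneous (d + m) (dz (u * (u + w)))" "homogeneous (d + d) (dz (vz * (u * (u + w))))"
    unfolding p using homogeneous_mult[OF u homogeneous_of_nat_mult[OF v(3)]]
      homogeneous_mult[OF u A(3)] by simp_all
qed

lemma ev_fermat_vars:
  "ev (fermat2 d) (a, b, c) = a ^ d + b ^ d" "ev (vz ^ d) (a, b, c) = c ^ d"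
  by (simp_all add: ev_simps)

lemma ev_numeral: "ev (numeral n) q = numeral n"
  using ev_simps(8)[of "numeral n" q] by simp

section \<open>Singular points of the Fermat curve and of the two unions\<close>

lemma singular_points_subset_P2: "singular_points G \<subseteq> P2"
  using zero_locus_subset_P2 by (auto simp: singular_points_def)

lemma singular_points_hpoint:
  assumes "homogeneous n G" "homogeneous n1 (dx G)" "homogeneous n2 (dy G)" "homogeneous n3 (dz G)"
    and "(a, b, c) \<noteq> (0, 0, 0)"
  shows "hpoint a b c \<in> singular_points G \<longleftrightarrow> ev G (a, b, c) = 0 \<and> ev (dx G) (a, b, c) = 0 \<and>
     ev (dy G) (a, b, c) = 0 \<and> ev (dz G) (a, b, c) = 0"
  unfolding singular_points_def Int_iff zero_locus_hpoint'[OF assms(1,5)]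
    zero_locus_hpoint'[OF assms(2,5)] zero_locus_hpoint'[OF assms(3,5)] zero_locus_hpoint'[OF assms(4,5)]
  by simp

lemma singular_points_fermat: "singular_points (fermat2 (Suc m) + vz ^ Suc m) = {}"
proof -
  have "P \<notin> singular_points (fermat2 (Suc m) + vz ^ Suc m)" for P
  proof
    assume P: "P \<in> singular_points (fermat2 (Suc m) + vz ^ Suc m)"
    hence "P \<in> P2" using singular_points_subset_P2 by blast
    then obtain a b c where abc: "P = hpoint a b c" "(a, b, c) \<noteq> (0, 0, 0)"
      by (rule P2_E)
    have "a ^ Suc m + b ^ Suc m + c ^ Suc m = 0" "a ^ m = 0 \<and> b ^ m = 0 \<and> c ^ m = 0"
      using P unfolding abc(1) singular_points_hpoint[OF homogeneous_fermat(1)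
          homogeneous_partials_fermat(1-3) abc(2)] fermat_partials
      by (auto simp: ev_simps simp del: of_nat_Suc)
    thus False using abc(2) by auto
  qed
  thus ?thesis by blast
qed

text \<open>Away from \<open>x = y = 0\<close>, the first two partials vanish only if the cofactor
  \<open>A\<close> does. Together with the third partial this forces \<open>u\<close> and
  \<open>w\<close> to be 0, because the linear forms in \<open>u\<close> and \<open>w\<close> that
  occur are pairwise independent. At \<open>x = y = 0\<close> the factors \<open>x^m\<close>,
  \<open>y^m\<close> and \<open>u\<close> vanish, which uses \<open>m \<ge> 1\<close>.\<close>

lemma singular_points_fermat_tangents:
  fixes m :: nat
  defines "d \<equiv> Suc m"
  defines "u \<equiv> fermat2 d" and "w \<equiv> vz ^ d"
  defines "Sing \<equiv> insert (hpoint 0 0 1) ((\<lambda>\<epsilon>. hpoint 1 \<epsilon> 0) ` {\<epsilon>. \<epsilon> ^ d + 1 = 0})"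
  assumes m: "m \<ge> 1"
  shows "singular_points (u * (u + w)) = Sing" "singular_points (vz * (u * (u + w))) = Sing"
proof -
  have on_line: "hpoint a b 0 \<in> Sing" if "a ^ d + b ^ d = 0" "(a, b) \<noteq> (0, 0)" for a b
  proof -
    have a: "a \<noteq> 0" using that by (auto simp: d_def)
    have "b ^ d = - (a ^ d)" using that(1) by (simp add: eq_neg_iff_add_eq_0 add.commute)
    hence "(b / a) ^ d + 1 = 0" using a by (simp add: power_divide)
    thus ?thesis using a by (simp add: Sing_def hpoint_first[OF a] image_iff) blast
  qed
  have cases: "hpoint a b c \<in> Sing"
    if "(a, b, c) \<noteq> (0, 0, 0)" "(a = 0 \<and> b = 0) \<or> (a ^ d + b ^ d = 0 \<and> c = 0)" for a b c
  proof (cases "a = 0 \<and> b = 0")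
    case True
    thus ?thesis using that(1) hpoint_third[of c] by (auto simp: Sing_def)
  qed (use that on_line[of a b] in auto)
  have Sing_cases: "\<exists>a b c. P = hpoint a b c \<and> (a, b, c) \<noteq> (0, 0, 0) \<and>
      (a = 0 \<and> b = 0 \<or> a ^ d + b ^ d = 0 \<and> c = 0)" if "P \<in> Sing" for P
    using that unfolding Sing_def
  proof safe
    show "\<exists>a b c. hpoint 0 0 1 = hpoint a b c \<and> (a, b, c) \<noteq> (0, 0, 0) \<and>
      (a = 0 \<and> b = 0 \<or> a ^ d + b ^ d = 0 \<and> c = 0)"
      by (intro exI[of _ 0] exI[of _ 1]) auto
    fix \<epsilon> :: complex assume "\<epsilon> ^ d + 1 = 0"
    thus "\<exists>a b c. hpoint 1 \<epsilon> 0 = hpoint a b c \<and> (a, b, c) \<noteq> (0, 0, 0) \<and>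
      (a = 0 \<and> b = 0 \<or> a ^ d + b ^ d = 0 \<and> c = 0)"
      by (intro exI[of _ 1] exI[of _ \<epsilon>] exI[of _ 0]) (auto simp: add.commute)
  qed
  have dn: "(of_nat d :: complex) \<noteq> 0" by (simp add: d_def del: of_nat_Suc)
  have uw: "ev u (a, b, c) = a ^ d + b ^ d" "ev w (a, b, c) = c ^ d" for a b c
    by (simp_all add: u_def w_def ev_fermat_vars)
  note p = fermat_partials(4-9)[of m, folded d_def, folded u_def w_def]
  note hp = homogeneous_partials_fermat(4-9)[of m, folded d_def, folded u_def w_def]
  note h = homogeneous_fermat(2-3)[of d, folded u_def w_def]
  have 1: "hpoint a b c \<in> singular_points (u * (u + w)) \<longleftrightarrow> a = 0 \<and> b = 0 \<or> a ^ d + b ^ d = 0 \<and> c = 0"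
    if nz: "(a, b, c) \<noteq> (0, 0, 0)" for a b c
  proof -
    \<comment> \<open>With the values of \<open>u\<close> and \<open>w\<close> named, the conditions
      are equations between linear forms in \<open>\<alpha>\<close> and \<open>\<gamma>\<close>, and
      the powers stay opaque.\<close>
    define \<alpha> \<gamma> where "\<alpha> = a ^ d + b ^ d" and "\<gamma> = c ^ d"
    have *: "\<gamma> = 0 \<longleftrightarrow> c = 0" "a = 0 \<and> b = 0 \<Longrightarrow> \<alpha> = 0"
      by (auto simp: \<gamma>_def \<alpha>_def d_def)
    show ?thesis
      unfolding singular_points_hpoint[OF h(1) hp(1-3) nz] p
      using * dn m by (auto simp: uw ev_simps ev_numeral simp flip: \<alpha>_def \<gamma>_def)
  qed
  have 2: "hpoint a b c \<in> singular_points (vz * (u * (u + w))) \<longleftrightarrow> a = 0 \<and> b = 0 \<or> a ^ d + b ^ d = 0 \<and> c = 0"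
    if nz: "(a, b, c) \<noteq> (0, 0, 0)" for a b c
  proof -
    define \<alpha> \<gamma> where "\<alpha> = a ^ d + b ^ d" and "\<gamma> = c ^ d"
    have *: "\<gamma> = 0 \<longleftrightarrow> c = 0" "a = 0 \<and> b = 0 \<Longrightarrow> \<alpha> = 0"
      by (auto simp: \<gamma>_def \<alpha>_def d_def)
    \<comment> \<open>The same elimination as in \<open>coprime_partials\<close>, now on
      values.\<close>
    have c: "c = 0" if "2 * \<alpha> + \<gamma> = 0" "\<alpha> + (of_nat d + 1) * \<gamma> = 0"
    proof -
      have "2 * (\<alpha> + (of_nat d + 1) * \<gamma>) - (2 * \<alpha> + \<gamma>) = of_nat (2 * d + 1) * \<gamma>"
        by (simp add: algebra_simps)
      hence "of_nat (2 * d + 1) * \<gamma> = 0" using that by simp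
      thus ?thesis using *(1) by (metis mult_eq_0_iff of_nat_eq_0_iff add_is_0 one_neq_zero)
    qed
    show ?thesis
      unfolding singular_points_hpoint[OF h(2) hp(4-6) nz] p
      using * dn m c by (auto simp: uw ev_simps ev_numeral simp flip: \<alpha>_def \<gamma>_def)
  qed
  have "singular_points G = Sing"
    if *: "\<And>a b c. (a, b, c) \<noteq> (0, 0, 0) \<Longrightarrow>
      hpoint a b c \<in> singular_points G \<longleftrightarrow> a = 0 \<and> b = 0 \<or> a ^ d + b ^ d = 0 \<and> c = 0" for G
  proof (intro subset_antisym subsetI)
    fix P assume P: "P \<in> singular_points G"
    hence "P \<in> P2" using singular_points_subset_P2 by blast
    then obtain a b c where "P = hpoint a b c" "(a, b, c) \<noteq> (0, 0, 0)" by (rule P2_E)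
    thus "P \<in> Sing" using P * cases by simp
  next
    fix P assume "P \<in> Sing"
    from Sing_cases[OF this] obtain a b c where "P = hpoint a b c" "(a, b, c) \<noteq> (0, 0, 0)"
      "a = 0 \<and> b = 0 \<or> a ^ d + b ^ d = 0 \<and> c = 0" by (elim exE conjE)
    thus "P \<in> singular_points G" using * by simp
  qed
  thus "singular_points (u * (u + w)) = Sing" "singular_points (vz * (u * (u + w))) = Sing"
    using 1 2 by blast+
qed

section \<open>Reducedness and exponents in arbitrary degree\<close>

lemma reduced_fermat:
  fixes m :: nat
  defines "d \<equiv> Suc m"
  defines "u \<equiv> fermat2 d" and "w \<equiv> vz ^ d"
  shows "reduced_plane_curve d (u + w)" "reduced_plane_curve (2 * d) (u * (u + w))"
    "reduced_plane_curve (2 * d + 1) (vz * (u * (u + w)))"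
    "has_exponents (u * (u + w)) (m, d)" "has_exponents (vz * (u * (u + w))) (m, d + 1)"
proof -
  note p = fermat_partials[of m, folded d_def, folded u_def w_def]
  note h = homogeneous_fermat[of d, folded u_def w_def]
  have dn: "d > 0" by (simp add: d_def)
  note du = is_unit_of_nat[OF dn]
  have uz: "coprime u (vz ^ n)" for n unfolding u_def by (rule coprime_fermat2_vz)
  note c = coprime_partials[OF uz[of 1, simplified], of w m, unfolded w_def d_def, OF refl,
      folded d_def, folded w_def]
  have c1: "coprime (of_nat d * (2 * u + w)) (u * (of_nat d * vz ^ m))"
    using c(1,2) du is_unit_left_imp_coprime is_unit_right_imp_coprime by auto
  have c2: "coprime (of_nat d * (vz * (2 * u + w))) (u * (u + (of_nat d + 1) * w))"
    using c(1,3,4) uz[of 1] du is_unit_left_imp_coprime by (auto simp: coprime_commute[of vz u])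
  have "squarefree (u + w)"
    by (rule squarefree_of_coprime_partials[OF p(1,2)]) (use du is_unit_left_imp_coprime in auto)
  thus "reduced_plane_curve d (u + w)" using h dn by (simp add: reduced_plane_curve_def)
  have "squarefree (u * (u + w))"
    by (rule squarefree_of_coprime_partials[OF p(4,5)]) (use c1 p in auto)
  thus "reduced_plane_curve (2 * d) (u * (u + w))" using h dn by (simp add: reduced_plane_curve_def)
  have "squarefree (vz * (u * (u + w)))"
    by (rule squarefree_of_coprime_partials[OF p(7,8)]) (use c2 p in auto)
  thus "reduced_plane_curve (2 * d + 1) (vz * (u * (u + w)))" using h by (simp add: reduced_plane_curve_def)
  have dS: "of_nat d \<noteq> (0::S)" using dn by simp
  have nz: "2 * u + w \<noteq> 0"
  proof
    assume "2 * u + w = 0"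
    hence "ev (2 * u + w) (0, 0, 1) = 0" by (simp add: ev_simps)
    thus False by (simp add: ev_simps ev_numeral u_def w_def d_def)
  qed
  have vz: "vz \<noteq> 0" by (simp add: vz_def)
  have hf: "homogeneous d (2 * u + w)" "homogeneous d (u + (of_nat d + 1) * w)"
    unfolding u_def w_def by (rule homogeneous_fermat_factors)+
  have hz: "homogeneous (d + 1) (vz * (2 * u + w))"
    using homogeneous_mult[OF homogeneous_vars(3) hf(1)] by simp
  note A = homogeneous_of_nat_mult[OF hf(1)] homogeneous_of_nat_mult[OF hz] hf(2)
    homogeneous_of_nat_mult[OF homogeneous_var_powers(3)]
  have dm: "d = m + 1" by (simp add: d_def)
  have "has_exponents G (m, r)"
    if "dx G = vx ^ m * A" "dy G = vy ^ m * A" "dz G = u * B" "coprime A (u * B)" "A \<noteq> 0"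
      "homogeneous r A" "homogeneous s B" "r = s + 1" for G A B r s
  proof -
    note * = homogeneous_basis_pair[of G m A B r s, folded d_def, folded u_def, OF that refl refl]
    show ?thesis unfolding has_exponents_def prod.case
      by (intro exI conjI, rule *(1), rule *(2), rule *(3), rule *(4))
  qed
  \<comment> \<open>The degrees of \<open>A\<close> and \<open>B\<close> are \<open>d\<close> and
    \<open>m\<close> for the first curve, \<open>d + 1\<close> and \<open>d\<close> for the second;
    the open premise is that \<open>A\<close> is nonzero.\<close>
  note E = this[OF p(4-6) c1 _ A(1,4) dm] this[OF p(7-9) c2 _ A(2,3) refl]
  show "has_exponents (u * (u + w)) (m, d)" by (rule E) (use dS nz in \<open>simp add: mult_eq_0_iff del: of_nat_eq_0_iff\<close>)
  show "has_exponents (vz * (u * (u + w))) (m, d + 1)" by (rule E) (use dS nz vz in \<open>simp add: mult_eq_0_iff del: of_nat_eq_0_iff\<close>)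
qed

lemma free_curve_of_exponents:
  assumes "reduced_plane_curve n G" "has_exponents G e"
  shows "free_curve G"
  using assms by (auto simp: free_curve_def has_exponents_def)

section \<open>The tangent lines and their union\<close>

abbreviation (input) line :: "complex \<Rightarrow> S" where
  "line \<epsilon> \<equiv> vy - cst \<epsilon> * vx"

lemma homogeneous_line: "homogeneous 1 (line \<epsilon>)"
proof -
  have "homogeneous 1 (cst \<epsilon> * vx)"
    using homogeneous_mult[OF homogeneous_cst homogeneous_vars(1)] by simp
  thus ?thesis using homogeneous_add[OF homogeneous_vars(2) homogeneous_uminus] by fastforce
qed

lemma hpoint_in_line:
  assumes "(a, b, c) \<noteq> (0, 0, 0)"
  shows "hpoint a b c \<in> zero_locus (line \<epsilon>) \<longleftrightarrow> b = \<epsilon> * a"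
  unfolding zero_locus_hpoint'[OF homogeneous_line assms] by (simp add: ev_simps)

lemma zero_locus_eqI:
  assumes "A \<subseteq> P2" "B \<subseteq> P2"
    and "\<And>a b c. (a, b, c) \<noteq> (0, 0, 0) \<Longrightarrow> hpoint a b c \<in> A \<longleftrightarrow> hpoint a b c \<in> B"
  shows "A = B"
proof -
  have "P \<in> A \<longleftrightarrow> P \<in> B" if "P \<in> P2" for P
    using that by (rule P2_E) (use assms(3) in simp)
  thus ?thesis using assms(1,2) by blast
qed

lemma zero_locus_mult:
  assumes "homogeneous m G" "homogeneous n H"
  shows "zero_locus (G * H) = zero_locus G \<union> zero_locus H"
proof (rule zero_locus_eqI)
  fix a b c :: complex assume nz: "(a, b, c) \<noteq> (0, 0, 0)"
  show "hpoint a b c \<in> zero_locus (G * H) \<longleftrightarrow> hpoint a b c \<in> zero_locus G \<union> zero_locus H"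
    unfolding Un_iff zero_locus_hpoint'[OF homogeneous_mult[OF assms] nz]
      zero_locus_hpoint'[OF assms(1) nz] zero_locus_hpoint'[OF assms(2) nz] by (simp add: ev_simps)
qed (auto simp: zero_locus_def)

text \<open>The gradient at \<open>(l, l * \<epsilon>, 0)\<close> is a multiple of
  \<open>(1, \<epsilon>^m, 0)\<close>; its last entry is 0 because \<open>m \<ge> 1\<close>.
  Multiplying \<open>a + \<epsilon>^m * b\<close> by \<open>\<epsilon>\<close> turns it into
  \<open>\<epsilon> * a - b\<close>, as \<open>\<epsilon>^(m+1) = -1\<close>.\<close>

lemma tangent_line_fermat:
  assumes "\<epsilon> ^ Suc m + 1 = 0" "m \<ge> 1"
  shows "tangent_line (fermat2 (Suc m) + vz ^ Suc m) (hpoint 1 \<epsilon> 0) = zero_locus (line \<epsilon>)"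
proof -
  let ?F = "fermat2 (Suc m) + vz ^ Suc m"
  obtain l where l: "l \<noteq> 0" "coords (hpoint 1 \<epsilon> 0) = (l * 1, l * \<epsilon>, l * 0)"
    by (rule coords_hpoint)
  define n where "n = (of_nat (Suc m) :: complex)"
  have n: "n \<noteq> 0" by (simp add: n_def del: of_nat_Suc)
  have dF: "ev (dx ?F) (l, l * \<epsilon>, 0) = l ^ m * n" "ev (dy ?F) (l, l * \<epsilon>, 0) = (l * \<epsilon>) ^ m * n"
    "ev (dz ?F) (l, l * \<epsilon>, 0) = 0"
    unfolding fermat_partials using assms(2) by (auto simp: ev_simps n_def)
  define T where "T = cst (l ^ m * n) * vx + cst ((l * \<epsilon>) ^ m * n) * vy + cst 0 * vz"
  have T: "tangent_line ?F (hpoint 1 \<epsilon> 0) = zero_locus T"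
    unfolding tangent_line_def l(2) Let_def mult_1_right mult_zero_right dF T_def ..
  have cv: "homogeneous 1 (cst k * vx)" "homogeneous 1 (cst k * vy)" "homogeneous 1 (cst k * vz)" for k
    using homogeneous_mult[OF homogeneous_cst homogeneous_vars(1)]
      homogeneous_mult[OF homogeneous_cst homogeneous_vars(2)]
      homogeneous_mult[OF homogeneous_cst homogeneous_vars(3)] by simp_all
  have hT: "homogeneous 1 T" unfolding T_def by (intro homogeneous_add cv)
  have \<epsilon>: "\<epsilon> * \<epsilon> ^ m = - 1" using assms(1) by (simp add: eq_neg_iff_add_eq_0)
  hence "\<epsilon> \<noteq> 0" by auto
  show ?thesis unfolding T
  proof (rule zero_locus_eqI)
    fix a b c :: complex assume nz: "(a, b, c) \<noteq> (0, 0, 0)"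
    have "ev T (a, b, c) = l ^ m * n * (a + \<epsilon> ^ m * b)"
      by (simp add: T_def ev_simps algebra_simps)
    hence "ev T (a, b, c) = 0 \<longleftrightarrow> a + \<epsilon> ^ m * b = 0" using l n by simp
    also have "\<dots> \<longleftrightarrow> \<epsilon> * (a + \<epsilon> ^ m * b) = 0" using \<open>\<epsilon> \<noteq> 0\<close> by simp
    also have "\<epsilon> * (a + \<epsilon> ^ m * b) = \<epsilon> * a + (\<epsilon> * \<epsilon> ^ m) * b" by (simp only: algebra_simps)
    also have "\<dots> = \<epsilon> * a - b" by (simp add: \<epsilon>)
    finally show "hpoint a b c \<in> zero_locus T \<longleftrightarrow> hpoint a b c \<in> zero_locus (line \<epsilon>)"
      unfolding zero_locus_hpoint'[OF hT nz] hpoint_in_line[OF nz] by auto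
  qed (auto simp: zero_locus_def)
qed

lemma fermat_roots:
  assumes "d \<ge> 1"
  shows "finite {\<epsilon>::complex. \<epsilon> ^ d + 1 = 0}" "card {\<epsilon>::complex. \<epsilon> ^ d + 1 = 0} = d"
proof -
  have *: "{\<epsilon>::complex. \<epsilon> ^ d + 1 = 0} = {\<epsilon>. \<epsilon> ^ d = - 1}" by (simp add: eq_neg_iff_add_eq_0)
  show "card {\<epsilon>::complex. \<epsilon> ^ d + 1 = 0} = d" unfolding * by (rule card_nth_roots) (use assms in auto)
  thus "finite {\<epsilon>::complex. \<epsilon> ^ d + 1 = 0}" using assms card.infinite by force
qed

lemma unital_hom_prod:
  assumes "unital_hom \<phi>"
  shows "\<phi> (prod f A) = (\<Prod>i\<in>A. \<phi> (f i))"
  by (induction A rule: infinite_finite_induct) (auto simp: unital_hom_simps[OF assms])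

text \<open>Over the coefficient ring \<open>C[x]\<close>, both sides are polynomials in
  \<open>y\<close> of degree at most \<open>d\<close> with the same coefficient of
  \<open>y^d\<close>, and both vanish at the \<open>d\<close> different points
  \<open>\<epsilon> x\<close>.\<close>

lemma prod_lines:
  assumes "d \<ge> 1"
  defines "R \<equiv> {\<epsilon>. \<epsilon> ^ d + 1 = 0}"
  shows "(\<Prod>\<epsilon>\<in>R. line \<epsilon>) = fermat2 d"
proof -
  note R = fermat_roots[OF assms(1), folded R_def]
  define p :: "complex poly poly" where "p = (\<Prod>\<epsilon>\<in>R. [:- [:0, \<epsilon>:], 1:])"
  define q :: "complex poly poly" where "q = [:[:0, 1:]:] ^ d + [:0, 1:] ^ d"
  have const: "unital_hom (\<lambda>q::complex poly poly. [:q:])"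
    by (simp add: unital_hom_def one_pCons)
  have dp: "degree p = d" unfolding p_def by (subst degree_prod_eq_sum_degree) (auto simp: R)
  have cp: "coeff p d = 1"
    using dp lead_coeff_prod[of "\<lambda>\<epsilon>. [:- [:0, \<epsilon>:], 1:]" R] by (simp add: p_def)
  have cq: "[:[:0, 1:]:] ^ d = [:[:0, 1:] ^ d :: complex poly:]"
    by (induction d) (auto simp: mult.commute one_pCons)
  have mq: "[:0, 1:] ^ d = monom (1 :: complex poly) d" by (simp add: monom_altdef)
  have "p = q"
  proof (rule poly_eqI_degree_lead_coeff)
    show "coeff p d = coeff q d"
      using assms(1) by (simp add: cp q_def cq mq coeff_pCons split: nat.split)
    show "degree p \<le> d" using dp by simp
    show "degree q \<le> d" unfolding q_def cq mq
      by (intro degree_add_le) (auto simp: degree_monom_le)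
    have "inj_on (\<lambda>\<epsilon>. [:0, \<epsilon>:]) R" by (auto simp: inj_on_def)
    thus "d \<le> card ((\<lambda>\<epsilon>. [:0, \<epsilon>:]) ` R)" using R by (simp add: card_image)
    fix z :: "complex poly" assume "z \<in> (\<lambda>\<epsilon>. [:0, \<epsilon>:]) ` R"
    then obtain \<epsilon> where z: "z = [:0, \<epsilon>:]" "\<epsilon> \<in> R" by blast
    have "poly p z = 0" using z R by (auto simp: p_def poly_prod)
    moreover have "z = smult \<epsilon> [:0, 1:]" by (simp add: z)
    hence "z ^ d = smult (\<epsilon> ^ d) ([:0, 1:] ^ d)" by (simp only: smult_power)
    hence "poly q z = smult (1 + \<epsilon> ^ d) ([:0, 1:] ^ d)"
      by (simp add: q_def smult_add_left)
    hence "poly q z = 0" using z(2) by (simp add: R_def add.commute)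
    ultimately show "poly p z = poly q z" by simp
  qed
  have "(\<Prod>\<epsilon>\<in>R. line \<epsilon>) = (\<Prod>\<epsilon>\<in>R. [:[:- [:0, \<epsilon>:], 1:]:])"
    by (simp add: vy_def cst_def vx_def)
  also have "\<dots> = [:p:]" unfolding p_def by (rule unital_hom_prod[OF const, symmetric])
  also have "\<dots> = fermat2 d"
    unfolding \<open>p = q\<close> q_def by (simp only: unital_hom_simps(2,7)[OF const] vx_def vy_def)
  finally show ?thesis .
qed

lemma fermat_geometry:
  assumes "d \<ge> 2"
  defines "R \<equiv> {\<epsilon>. \<epsilon> ^ d + 1 = 0}"
  shows "\<forall>\<epsilon>\<in>R. hpoint 1 \<epsilon> 0 \<in> zero_locus (fermat2 d + vz ^ d)"
    "\<forall>\<epsilon>\<in>R. zero_locus (line \<epsilon>) = tangent_line (fermat2 d + vz ^ d) (hpoint 1 \<epsilon> 0)"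
    "card ((\<lambda>\<epsilon>. zero_locus (line \<epsilon>)) ` R) = d"
    "(\<Inter>\<epsilon>\<in>R. zero_locus (line \<epsilon>)) = {hpoint 0 0 1}"
    "(\<Union>\<epsilon>\<in>R. zero_locus (line \<epsilon>)) = zero_locus (fermat2 d)"
    "\<forall>\<epsilon>\<in>R. hpoint 1 \<epsilon> 0 \<in> zero_locus vz"
proof -
  have R: "finite R" "card R = d" using fermat_roots[of d] assms by auto
  show "\<forall>\<epsilon>\<in>R. hpoint 1 \<epsilon> 0 \<in> zero_locus (fermat2 d + vz ^ d)"
    using assms by (auto simp: zero_locus_hpoint[OF homogeneous_fermat(1)] ev_simps R_def add.commute[of 1])
  show "\<forall>\<epsilon>\<in>R. hpoint 1 \<epsilon> 0 \<in> zero_locus vz"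
    by (auto simp: zero_locus_hpoint[OF homogeneous_vars(3)] ev_simps)
  show "\<forall>\<epsilon>\<in>R. zero_locus (line \<epsilon>) = tangent_line (fermat2 d + vz ^ d) (hpoint 1 \<epsilon> 0)"
    using tangent_line_fermat[of _ "d - 1"] assms by (auto simp: R_def)
  have "inj_on (\<lambda>\<epsilon>. zero_locus (line \<epsilon>)) R"
  proof (rule inj_onI)
    fix e e' assume "zero_locus (line e) = zero_locus (line e')"
    moreover have "hpoint 1 e 0 \<in> zero_locus (line e)" by (subst hpoint_in_line) auto
    ultimately have "hpoint 1 e 0 \<in> zero_locus (line e')" by simp
    thus "e = e'" by (subst (asm) hpoint_in_line) auto
  qed
  thus "card ((\<lambda>\<epsilon>. zero_locus (line \<epsilon>)) ` R) = d" using R by (simp add: card_image)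
  \<comment> \<open>\<open>d \<ge> 2\<close> supplies two different roots; the two corresponding
    lines through \<open>(0:0:1)\<close> meet nowhere else.\<close>
  have "\<not> card R \<le> Suc 0" using R(2) assms(1) by simp
  then obtain e e' where e: "e \<in> R" "e' \<in> R" "e \<noteq> e'"
    unfolding card_le_Suc0_iff_eq[OF R(1)] by blast
  show "(\<Inter>\<epsilon>\<in>R. zero_locus (line \<epsilon>)) = {hpoint 0 0 1}"
  proof (rule zero_locus_eqI)
    show "(\<Inter>\<epsilon>\<in>R. zero_locus (line \<epsilon>)) \<subseteq> P2" using e(1) by (auto simp: zero_locus_def)
    have "hpoint 0 0 1 \<in> P2" unfolding P2_def by (rule CollectI, intro exI conjI, rule refl) simp
    thus "{hpoint 0 0 1} \<subseteq> P2" by simp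
    fix a b c :: complex assume nz: "(a, b, c) \<noteq> (0, 0, 0)"
    have "a = 0 \<and> b = 0" if "\<forall>\<epsilon>\<in>R. b = \<epsilon> * a"
    proof -
      have "b = e * a" "b = e' * a" using that e by blast+
      thus ?thesis using e(3) by auto
    qed
    hence "(\<forall>\<epsilon>\<in>R. b = \<epsilon> * a) \<longleftrightarrow> a = 0 \<and> b = 0" by auto
    also have "\<dots> \<longleftrightarrow> hpoint a b c = hpoint 0 0 1"
    proof
      assume "a = 0 \<and> b = 0"
      thus "hpoint a b c = hpoint 0 0 1" using nz hpoint_third[of c] by auto
    next
      assume "hpoint a b c = hpoint 0 0 1"
      hence "(a, b, c) \<in> hpoint 0 0 1" using hpoint_self by metis
      thus "a = 0 \<and> b = 0" by (auto simp: hpoint_def)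
    qed
    finally show "hpoint a b c \<in> (\<Inter>\<epsilon>\<in>R. zero_locus (line \<epsilon>)) \<longleftrightarrow> hpoint a b c \<in> {hpoint 0 0 1}"
      by (simp add: hpoint_in_line[OF nz])
  qed
  show "(\<Union>\<epsilon>\<in>R. zero_locus (line \<epsilon>)) = zero_locus (fermat2 d)"
  proof (rule zero_locus_eqI)
    fix a b c :: complex assume nz: "(a, b, c) \<noteq> (0, 0, 0)"
    have "(\<Prod>\<epsilon>\<in>R. line \<epsilon>) = fermat2 d" using prod_lines[of d] assms(1) by (simp add: R_def)
    moreover have "ev (\<Prod>\<epsilon>\<in>R. line \<epsilon>) (a, b, c) = (\<Prod>\<epsilon>\<in>R. b - \<epsilon> * a)"
      by (simp add: unital_hom_prod[OF unital_hom_eval3[OF unital_hom_id]] ev_simps)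
    ultimately have "ev (fermat2 d) (a, b, c) = (\<Prod>\<epsilon>\<in>R. b - \<epsilon> * a)" by simp
    thus "hpoint a b c \<in> (\<Union>\<epsilon>\<in>R. zero_locus (line \<epsilon>)) \<longleftrightarrow> hpoint a b c \<in> zero_locus (fermat2 d)"
      using R by (simp add: zero_locus_hpoint'[OF homogeneous_fermat2 nz] hpoint_in_line[OF nz])
  qed (auto simp: zero_locus_def)
qed

section \<open>Convergent power series\<close>

lemma convergent_seriesI:
  "(\<And>i j. norm (f $ j $ i) \<le> M * r ^ (i + j)) \<Longrightarrow> f \<in> convergent_series"
  unfolding convergent_series_def by blast

text \<open>The definition leaves the signs of \<open>M\<close> and \<open>r\<close> open. In this
  normal form a bound may be weakened by enlarging \<open>r\<close>, so that two series can share
  one radius.\<close>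

lemma convergent_seriesE:
  assumes "f \<in> convergent_series"
  obtains M r where "M \<ge> 0" "r \<ge> 1" "\<forall>i j. norm (f $ j $ i) \<le> M * r ^ (i + j)"
proof -
  obtain M r where *: "\<And>i j. norm (f $ j $ i) \<le> M * r ^ (i + j)"
    using assms unfolding convergent_series_def by blast
  have "norm (f $ j $ i) \<le> \<bar>M\<bar> * max 1 \<bar>r\<bar> ^ (i + j)" for i j
  proof -
    have "norm (f $ j $ i) \<le> \<bar>M * r ^ (i + j)\<bar>" using *[where i=i and j=j] by linarith
    also have "\<dots> = \<bar>M\<bar> * \<bar>r\<bar> ^ (i + j)" by (simp add: abs_mult power_abs)
    also have "\<dots> \<le> \<bar>M\<bar> * max 1 \<bar>r\<bar> ^ (i + j)" by (intro mult_left_mono power_mono) auto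
    finally show ?thesis .
  qed
  thus ?thesis using that[of "\<bar>M\<bar>" "max 1 \<bar>r\<bar>"] by auto
qed

lemma convergent_series_add:
  assumes "f \<in> convergent_series" "g \<in> convergent_series"
  shows "f + g \<in> convergent_series"
proof -
  obtain M r where f: "M \<ge> 0" "r \<ge> 1" "\<forall>i j. norm (f $ j $ i) \<le> M * r ^ (i + j)"
    using assms(1) by (rule convergent_seriesE)
  obtain N q where g: "N \<ge> 0" "q \<ge> 1" "\<forall>i j. norm (g $ j $ i) \<le> N * q ^ (i + j)"
    using assms(2) by (rule convergent_seriesE)
  show ?thesis
  proof (rule convergent_seriesI)
    fix i j
    have "norm ((f + g) $ j $ i) \<le> M * r ^ (i + j) + N * q ^ (i + j)"
      using norm_triangle_mono[OF f(3)[rule_format] g(3)[rule_format]] by simp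
    also have "\<dots> \<le> M * (max r q) ^ (i + j) + N * (max r q) ^ (i + j)"
      using f g by (intro add_mono mult_left_mono power_mono) auto
    finally show "norm ((f + g) $ j $ i) \<le> (M + N) * (max r q) ^ (i + j)"
      by (simp add: distrib_right)
  qed
qed

text \<open>The coefficient at \<open>(i, j)\<close> is a sum of \<open>(i+1) (j+1)\<close> terms of
  size at most \<open>M N p^(i+j)\<close>. The number of terms is at most \<open>2^(i+j)\<close>,
  which doubles the base.\<close>

lemma convergent_series_mult:
  assumes "f \<in> convergent_series" "g \<in> convergent_series"
  shows "f * g \<in> convergent_series"
proof -
  obtain M r where f: "M \<ge> 0" "r \<ge> 1" "\<forall>i j. norm (f $ j $ i) \<le> M * r ^ (i + j)"
    using assms(1) by (rule convergent_seriesE)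
  obtain N q where g: "N \<ge> 0" "q \<ge> 1" "\<forall>i j. norm (g $ j $ i) \<le> N * q ^ (i + j)"
    using assms(2) by (rule convergent_seriesE)
  define p where "p = max r q"
  show ?thesis
  proof (rule convergent_seriesI)
    fix i j
    have term_le: "norm (f $ j' $ i' * g $ (j - j') $ (i - i')) \<le> M * N * p ^ (i + j)"
      if "i' \<le> i" "j' \<le> j" for i' j'
    proof -
      have "norm (f $ j' $ i' * g $ (j - j') $ (i - i')) \<le> (M * r ^ (i' + j')) * (N * q ^ ((i - i') + (j - j')))"
        unfolding norm_mult using f g by (intro mult_mono) auto
      also have "\<dots> \<le> (M * p ^ (i' + j')) * (N * p ^ ((i - i') + (j - j')))"
        using f g by (intro mult_mono mult_left_mono power_mono) (auto simp: p_def)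
      also have "\<dots> = M * N * p ^ ((i' + j') + ((i - i') + (j - j')))"
        by (simp add: power_add)
      also have "(i' + j') + ((i - i') + (j - j')) = i + j" using that by simp
      finally show ?thesis .
    qed
    have "(f * g) $ j $ i = (\<Sum>j'=0..j. \<Sum>i'=0..i. f $ j' $ i' * g $ (j - j') $ (i - i'))"
      by (simp add: fps_mult_nth fps_sum_nth)
    also have "norm \<dots> \<le> (\<Sum>j'=0..j. \<Sum>i'=0..i. M * N * p ^ (i + j))"
      by (intro sum_norm_le term_le) auto
    also have "\<dots> = M * N * p ^ (i + j) * (real (Suc i) * real (Suc j))" by (simp add: ac_simps)
    also have "\<dots> \<le> M * N * p ^ (i + j) * (2 ^ i * 2 ^ j)"
    proof (rule mult_left_mono)
      have "real (Suc n) \<le> 2 ^ n" for n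
      proof -
        have "Suc n \<le> 2 ^ n" by (simp add: Suc_leI)
        hence "real (Suc n) \<le> real (2 ^ n)" by (rule of_nat_mono)
        thus ?thesis by simp
      qed
      thus "real (Suc i) * real (Suc j) \<le> 2 ^ i * 2 ^ j" by (intro mult_mono) auto
      show "0 \<le> M * N * p ^ (i + j)" using f g by (auto simp: p_def)
    qed
    also have "\<dots> = M * N * (2 * p) ^ (i + j)" by (simp add: power_add power_mult_distrib)
    finally show "norm ((f * g) $ j $ i) \<le> M * N * (2 * p) ^ (i + j)" .
  qed
qed

lemma cst2_nth: "cst2 c $ j $ i = (if i = 0 \<and> j = 0 then c else 0)"
  by (auto simp: cst2_def)

lemma convergent_series_cst2: "cst2 c \<in> convergent_series"
  by (rule convergent_seriesI[of _ "norm c" 1]) (auto simp: cst2_nth)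

lemma convergent_series_vars: "var_s \<in> convergent_series" "var_t \<in> convergent_series"
  by (rule convergent_seriesI[of _ 1 1], auto simp: var_s_def var_t_def fps_X_def)+

lemma unital_hom_cst2: "unital_hom cst2"
  by (auto simp: unital_hom_def cst2_def)

lemmas cst2_simps = unital_hom_simps[OF unital_hom_cst2]

lemma cst2_numeral: "cst2 (numeral n) = numeral n"
  using cst2_simps(8)[of "numeral n"] by simp

lemma convergent_series_numeral: "numeral n \<in> convergent_series" "1 \<in> convergent_series" "0 \<in> convergent_series"
  using convergent_series_cst2[of "numeral n"] convergent_series_cst2[of 1] convergent_series_cst2[of 0]
  by (simp_all add: cst2_numeral cst2_simps)

lemma convergent_series_uminus: "f \<in> convergent_series \<Longrightarrow> - f \<in> convergent_series"
  using convergent_series_mult[OF convergent_series_cst2[of "- 1"], of f] by (simp add: cst2_simps)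

lemma convergent_series_diff:
  "f \<in> convergent_series \<Longrightarrow> g \<in> convergent_series \<Longrightarrow> f - g \<in> convergent_series"
  using convergent_series_add[OF _ convergent_series_uminus] by fastforce

lemma convergent_series_power: "f \<in> convergent_series \<Longrightarrow> f ^ n \<in> convergent_series"
  by (induction n) (auto intro: convergent_series_mult convergent_series_numeral)

lemmas convergent_series_intros = convergent_series_add convergent_series_mult convergent_series_diff
  convergent_series_uminus convergent_series_power convergent_series_cst2 convergent_series_vars
  convergent_series_numeral

text \<open>The inverse is minus the sum of \<open>s^i / a^(i+1)\<close>.\<close>

lemma convergent_series_geometric:
  assumes "a \<noteq> 0"
  obtains W where "W \<in> convergent_series" "(var_s - cst2 a) * W = 1"
proof
  define w where "w = Abs_fps (\<lambda>i. - ((1 / a) ^ (i + 1)))"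
  have "norm (fps_const w $ j $ i) \<le> norm (1 / a) * norm (1 / a) ^ (i + j)" for i j
    by (auto simp: w_def norm_mult norm_power simp flip: power_Suc)
  thus "fps_const w \<in> convergent_series" by (rule convergent_seriesI)
  have "(fps_X - fps_const a) * w = 1"
  proof (rule fps_ext)
    fix n show "((fps_X - fps_const a) * w) $ n = 1 $ n"
      using assms by (cases n) (auto simp: w_def left_diff_distrib)
  qed
  thus "(var_s - cst2 a) * fps_const w = 1"
    by (simp add: var_s_def cst2_def)
qed

lemma derivation_map_deriv_t: "derivation_map deriv_t"
  by (simp add: derivation_map_def deriv_t_def algebra_simps)

lemma derivation_map_deriv_s: "derivation_map deriv_s"
  unfolding derivation_map_def deriv_s_def
proof (intro conjI allI)
  fix a b :: series2
  show "Abs_fps (\<lambda>j. fps_deriv ((a + b) $ j)) = Abs_fps (\<lambda>j. fps_deriv (a $ j)) + Abs_fps (\<lambda>j. fps_deriv (b $ j))"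
    by (rule fps_ext) simp
  show "Abs_fps (\<lambda>j. fps_deriv ((a * b) $ j)) =
      Abs_fps (\<lambda>j. fps_deriv (a $ j)) * b + a * Abs_fps (\<lambda>j. fps_deriv (b $ j))"
  proof (rule fps_ext)
    fix n
    show "Abs_fps (\<lambda>j. fps_deriv ((a * b) $ j)) $ n =
      (Abs_fps (\<lambda>j. fps_deriv (a $ j)) * b + a * Abs_fps (\<lambda>j. fps_deriv (b $ j))) $ n"
      by (simp add: fps_mult_nth fps_deriv_sum sum.distrib add.commute)
  qed
qed

lemma deriv_vars [simp]:
  "deriv_s var_s = 1" "deriv_s var_t = 0" "deriv_s (cst2 c) = 0"
  "deriv_t var_s = 0" "deriv_t var_t = 1" "deriv_t (cst2 c) = 0"
proof -
  show "deriv_s var_s = 1" "deriv_s var_t = 0" "deriv_s (cst2 c) = 0"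
    by (auto simp: fps_eq_iff deriv_s_def var_s_def var_t_def cst2_def fps_X_def)
  show "deriv_t var_s = 0" "deriv_t var_t = 1" "deriv_t (cst2 c) = 0"
    by (simp_all add: deriv_t_def var_s_def var_t_def cst2_def)
qed

lemmas deriv_simps = derivation_map_simps[OF derivation_map_deriv_s] derivation_map_simps[OF derivation_map_deriv_t]

section \<open>Ideals of convergent power series\<close>

text \<open>The convergent series are a subring of \<open>series2\<close> and not a type, so ideals
  of this subring are described relative to it.\<close>

definition conv_ideal :: "series2 set \<Rightarrow> bool" where
  "conv_ideal I \<longleftrightarrow> I \<subseteq> convergent_series \<and> 0 \<in> I \<and> (\<forall>f\<in>I. \<forall>g\<in>I. f + g \<in> I) \<and>
     (\<forall>a\<in>convergent_series. \<forall>f\<in>I. a * f \<in> I)"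

lemma conv_idealD:
  assumes "conv_ideal I"
  shows "f \<in> I \<Longrightarrow> g \<in> I \<Longrightarrow> f + g \<in> I" "a \<in> convergent_series \<Longrightarrow> f \<in> I \<Longrightarrow> a * f \<in> I"
    "f \<in> I \<Longrightarrow> g \<in> I \<Longrightarrow> f - g \<in> I"
proof -
  show add: "f \<in> I \<Longrightarrow> g \<in> I \<Longrightarrow> f + g \<in> I" and mult: "a \<in> convergent_series \<Longrightarrow> f \<in> I \<Longrightarrow> a * f \<in> I"
    for a f g using assms by (auto simp: conv_ideal_def)
  show "f - g \<in> I" if "f \<in> I" "g \<in> I"
    using add[OF that(1) mult[of "- 1" g]] that(2)
    by (simp add: convergent_series_numeral convergent_series_uminus)
qed

lemma tjurina_ideal:
  assumes "f \<in> convergent_series" "deriv_s f \<in> convergent_series" "deriv_t f \<in> convergent_series"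
  shows "conv_ideal (tjurina_ideal f)"
    "f \<in> tjurina_ideal f" "deriv_s f \<in> tjurina_ideal f" "deriv_t f \<in> tjurina_ideal f"
proof -
  note c = convergent_series_intros
  have I: "h \<in> tjurina_ideal f" if "h = a * f + b * deriv_s f + c * deriv_t f"
    "a \<in> convergent_series" "b \<in> convergent_series" "c \<in> convergent_series" for h a b c
    using that unfolding tjurina_ideal_def by blast
  show "f \<in> tjurina_ideal f" by (rule I[of _ 1 0 0]) (auto intro: c)
  show "deriv_s f \<in> tjurina_ideal f" by (rule I[of _ 0 1 0]) (auto intro: c)
  show "deriv_t f \<in> tjurina_ideal f" by (rule I[of _ 0 0 1]) (auto intro: c)
  show "conv_ideal (tjurina_ideal f)"
    unfolding conv_ideal_def
  proof (intro conjI ballI subsetI)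
    show "h \<in> convergent_series" if "h \<in> tjurina_ideal f" for h
      using that assms by (auto simp: tjurina_ideal_def intro: c)
    show "0 \<in> tjurina_ideal f" by (rule I[of _ 0 0 0]) (auto intro: c)
    show "g + h \<in> tjurina_ideal f" if gh: "g \<in> tjurina_ideal f" "h \<in> tjurina_ideal f" for g h
    proof -
      obtain a1 b1 c1 where g: "g = a1 * f + b1 * deriv_s f + c1 * deriv_t f"
        "a1 \<in> convergent_series" "b1 \<in> convergent_series" "c1 \<in> convergent_series"
        using gh(1) unfolding tjurina_ideal_def by blast
      obtain a2 b2 c2 where h: "h = a2 * f + b2 * deriv_s f + c2 * deriv_t f"
        "a2 \<in> convergent_series" "b2 \<in> convergent_series" "c2 \<in> convergent_series"
        using gh(2) unfolding tjurina_ideal_def by blast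
      show ?thesis
        by (rule I[of _ "a1 + a2" "b1 + b2" "c1 + c2"]) (use g h in \<open>auto intro: c simp: algebra_simps\<close>)
    qed
    show "a * h \<in> tjurina_ideal f" if a: "a \<in> convergent_series" and hT: "h \<in> tjurina_ideal f" for a h
    proof -
      obtain a2 b2 c2 where h: "h = a2 * f + b2 * deriv_s f + c2 * deriv_t f"
        "a2 \<in> convergent_series" "b2 \<in> convergent_series" "c2 \<in> convergent_series"
        using hT unfolding tjurina_ideal_def by blast
      show ?thesis
        by (rule I[of _ "a * a2" "a * b2" "a * c2"]) (use a h in \<open>auto intro: c simp: algebra_simps\<close>)
    qed
  qed
qed

lemma tjurina_ideal_subset:
  assumes "conv_ideal I" "f \<in> I" "deriv_s f \<in> I" "deriv_t f \<in> I"
  shows "tjurina_ideal f \<subseteq> I"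
  using assms conv_idealD(1,2)[OF assms(1)] by (auto simp: tjurina_ideal_def)

section \<open>Monomial pieces of a power series\<close>

definition mon :: "nat \<Rightarrow> nat \<Rightarrow> series2" where
  "mon p q = var_s ^ p * var_t ^ q"

lemma mult_mon_nth:
  "(a * mon p q) $ j $ i = (if i < p \<or> j < q then 0 else a $ (j - q) $ (i - p))"
proof -
  have s: "var_s ^ p = fps_const (fps_X ^ p)" by (simp add: var_s_def fps_const_power)
  have "a * mon p q = (a * fps_const (fps_X ^ p)) * fps_X ^ q"
    by (simp only: mon_def s var_t_def mult.assoc)
  thus ?thesis by (simp only: fps_X_power_mult_right_nth fps_mult_right_const_nth)
      (simp add: fps_X_power_mult_right_nth)
qed

lemma cst2_mult_mon_nth: "(cst2 c * mon p q) $ j $ i = (if i = p \<and> j = q then c else 0)"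
  by (auto simp: mult_mon_nth cst2_nth)

lemma cst2_mult_nth: "(cst2 c * h) $ j $ i = c * h $ j $ i"
  by (simp add: cst2_def)

text \<open>Serves to cut a series, by regions of exponents, into pieces that are each divisible by
  one monomial.\<close>

definition restrict_series :: "(nat \<Rightarrow> nat \<Rightarrow> bool) \<Rightarrow> series2 \<Rightarrow> series2" where
  "restrict_series A h = Abs_fps (\<lambda>j. Abs_fps (\<lambda>i. if A i j then h $ j $ i else 0))"

lemma restrict_series_nth: "restrict_series A h $ j $ i = (if A i j then h $ j $ i else 0)"
  by (simp add: restrict_series_def)

text \<open>The quotient by \<open>s^p t^q\<close> has shifted coefficients; its bound grows only by
  the constant \<open>r^(p+q)\<close>, so it is again convergent.\<close>

lemma restrict_series_in_ideal:
  assumes I: "conv_ideal I" "mon p q \<in> I" and h: "h \<in> convergent_series"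
    and A: "\<And>i j. A i j \<Longrightarrow> p \<le> i \<and> q \<le> j"
  shows "restrict_series A h \<in> I"
proof -
  define a where "a = Abs_fps (\<lambda>j. Abs_fps (\<lambda>i. if A (i + p) (j + q) then h $ (j + q) $ (i + p) else 0))"
  obtain M r where Mr: "M \<ge> 0" "r \<ge> 1" "\<forall>i j. norm (h $ j $ i) \<le> M * r ^ (i + j)"
    using h by (rule convergent_seriesE)
  have "norm (a $ j $ i) \<le> (M * r ^ (p + q)) * r ^ (i + j)" for i j
    using Mr(3)[rule_format, of "j + q" "i + p"] Mr(1,2) by (auto simp: a_def power_add ac_simps)
  hence "a \<in> convergent_series" by (rule convergent_seriesI)
  moreover have "restrict_series A h = a * mon p q"
    by (auto simp: fps_eq_iff restrict_series_nth mult_mon_nth a_def dest: A)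
  ultimately show ?thesis using conv_idealD(2)[OF I(1)] I(2) by simp
qed

section \<open>Dimensions of quotients\<close>

text \<open>The functionals form a map \<open>\<Phi>\<close> onto \<open>complex ^ 'n\<close> with
  kernel \<open>W\<close>, and \<open>b\<close> supplies preimages of the unit vectors. As
  \<open>quotient_dim\<close> measures an arbitrarily chosen basis, exhibiting one is not enough:
  every quotient basis is shown to map injectively onto a basis of \<open>complex ^ 'n\<close>. The
  type \<open>'n\<close> gives access to the dimension theory of coordinate vectors.\<close>

lemma quotient_dim_eqI:
  fixes \<phi> :: "nat \<Rightarrow> series2 \<Rightarrow> complex" and b :: "nat \<Rightarrow> series2"
  assumes n: "CARD('n::finite) = n"
    and lin: "\<And>k f g. k < n \<Longrightarrow> \<phi> k (f + g) = \<phi> k f + \<phi> k g"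
      "\<And>k c f. k < n \<Longrightarrow> \<phi> k (cst2 c * f) = c * \<phi> k f"
    and W: "W = {h \<in> convergent_series. \<forall>k<n. \<phi> k h = 0}"
    and b: "\<And>k. k < n \<Longrightarrow> b k \<in> convergent_series"
      "\<And>j k. j < n \<Longrightarrow> k < n \<Longrightarrow> \<phi> j (b k) = (if j = k then 1 else 0)"
  shows "quotient_dim convergent_series W = n"
proof -
  obtain e where e: "bij_betw e (UNIV :: 'n set) {0..<n}"
    using ex_bij_betw_finite_nat[of "UNIV :: 'n set"] n by auto
  have e_less: "e i < n" for i using e by (auto simp: bij_betw_def)
  have e_eq: "e i = e j \<longleftrightarrow> i = j" for i j using e by (auto simp: bij_betw_def inj_eq)
  have e_ex: "\<exists>i. k = e i" if "k < n" for k using e that by (auto simp: bij_betw_def)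
  define \<Phi> :: "series2 \<Rightarrow> complex ^ 'n" where "\<Phi> h = (\<chi> i. \<phi> (e i) h)" for h
  have \<Phi>_add: "\<Phi> (f + g) = \<Phi> f + \<Phi> g" for f g by (simp add: \<Phi>_def vec_eq_iff lin e_less)
  have \<Phi>_cst: "\<Phi> (cst2 c * f) = c *s \<Phi> f" for c f by (simp add: \<Phi>_def vec_eq_iff lin e_less)
  have \<Phi>_0: "\<Phi> 0 = 0" using \<Phi>_cst[of 0 0] by (simp add: cst2_simps)
  have \<Phi>_minus: "\<Phi> (f - g) = \<Phi> f - \<Phi> g" for f g
    using \<Phi>_add[of "f - g" g] by simp
  have \<Phi>_sum: "\<Phi> (\<Sum>x\<in>B. cst2 (l x) * g x) = (\<Sum>x\<in>B. l x *s \<Phi> (g x))" for l B and g :: "'z \<Rightarrow> series2"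
    by (induction B rule: infinite_finite_induct) (auto simp: \<Phi>_0 \<Phi>_add \<Phi>_cst)
  have conv_sum: "(\<Sum>x\<in>B. cst2 (l x) * g x) \<in> convergent_series" if "g ` B \<subseteq> convergent_series"
    for l B and g :: "'z \<Rightarrow> series2"
    using that by (induction B rule: infinite_finite_induct) (auto intro: convergent_series_intros)
  have W_iff: "h \<in> W \<longleftrightarrow> \<Phi> h = 0" if "h \<in> convergent_series" for h
    using that e_less e_ex unfolding W \<Phi>_def vec_eq_iff by auto
  have \<Phi>_b: "\<Phi> (b (e i)) = axis i 1" for i
    by (simp add: \<Phi>_def vec_eq_iff axis_def b e_less e_eq)
  have sum_axis: "(\<Sum>i\<in>UNIV. (v $ i) *s axis i 1) = v" for v :: "complex ^ 'n"
    by (simp add: vec_eq_iff axis_def if_distrib cong: if_cong)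
  have qb: "quotient_basis convergent_series W B \<longleftrightarrow> finite B \<and> B \<subseteq> convergent_series \<and>
     (\<forall>h\<in>convergent_series. \<exists>!l. (\<forall>x. x \<notin> B \<longrightarrow> l x = 0) \<and> \<Phi> h = (\<Sum>x\<in>B. l x *s \<Phi> x))" for B
  proof -
    have "h - (\<Sum>x\<in>B. cst2 (l x) * x) \<in> W \<longleftrightarrow> \<Phi> h = (\<Sum>x\<in>B. l x *s \<Phi> x)"
      if "B \<subseteq> convergent_series" "h \<in> convergent_series" for h l
      using W_iff[of "h - (\<Sum>x\<in>B. cst2 (l x) * x)"] \<Phi>_sum[of l "\<lambda>x. x" B]
        conv_sum[of "\<lambda>x. x" B l] that convergent_series_diff
      by (simp add: \<Phi>_minus)
    thus ?thesis unfolding quotient_basis_def by (auto cong: conj_cong)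
  qed
  have "quotient_basis convergent_series W (range (b \<circ> e))"
    unfolding qb
  proof (intro conjI ballI)
    show "finite (range (b \<circ> e))" by simp
    show "range (b \<circ> e) \<subseteq> convergent_series" using b(1) e_less by auto
    have inj: "inj (b \<circ> e)"
      by (rule injI) (metis \<Phi>_b axis_eq_axis comp_apply zero_neq_one)
    have sum: "(\<Sum>x\<in>range (b \<circ> e). l x *s \<Phi> x) = (\<chi> i. l (b (e i)))" for l
      using sum_axis[of "\<chi> i. l (b (e i))"]
      by (subst sum.reindex[OF inj]) (simp add: \<Phi>_b)
    fix h assume "h \<in> convergent_series"
    show "\<exists>!l. (\<forall>x. x \<notin> range (b \<circ> e) \<longrightarrow> l x = 0) \<and> \<Phi> h = (\<Sum>x\<in>range (b \<circ> e). l x *s \<Phi> x)"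
      unfolding sum
    \<comment> \<open>The coefficient of \<open>b (e i)\<close> is the coordinate \<open>i\<close>
      of \<open>\<Phi> h\<close>.\<close>
    proof (rule ex1I[of _ "\<lambda>x. if x \<in> range (b \<circ> e) then \<Phi> h $ inv (b \<circ> e) x else 0"], goal_cases)
      case 1
      have "inv (b \<circ> e) (b (e i)) = i" for i using inv_f_f[OF inj, of i] by simp
      thus ?case by (auto simp: vec_eq_iff)
    next
      case (2 l)
      show ?case
      proof
        fix x show "l x = (if x \<in> range (b \<circ> e) then \<Phi> h $ inv (b \<circ> e) x else 0)"
        proof (cases "x \<in> range (b \<circ> e)")
          case True
          then obtain i where i: "x = (b \<circ> e) i" by blast
          thus ?thesis using 2 inv_f_f[OF inj, of i] by simp
        qed (use 2 in simp)
      qed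
    qed
  qed
  moreover have "card B = n" if "quotient_basis convergent_series W B" for B
  proof -
    have B: "finite B" "B \<subseteq> convergent_series"
      and ex1: "\<And>h. h \<in> convergent_series \<Longrightarrow>
        \<exists>!l. (\<forall>x. x \<notin> B \<longrightarrow> l x = 0) \<and> \<Phi> h = (\<Sum>x\<in>B. l x *s \<Phi> x)"
      using that unfolding qb by auto
    have uniq: "l = l'" if "\<And>x. x \<notin> B \<Longrightarrow> l x = 0" "\<And>x. x \<notin> B \<Longrightarrow> l' x = 0"
      "h \<in> convergent_series" "\<Phi> h = (\<Sum>x\<in>B. l x *s \<Phi> x)" "\<Phi> h = (\<Sum>x\<in>B. l' x *s \<Phi> x)" for h l l'
      using ex1[OF that(3)] that by blast
    have inj: "inj_on \<Phi> B"
    proof (rule inj_onI)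
      fix x y assume xy: "x \<in> B" "y \<in> B" "\<Phi> x = \<Phi> y"
      \<comment> \<open>If \<open>x\<close> and \<open>y\<close> had the same image, the indicators
        of \<open>x\<close> and \<open>y\<close> would be two expansions of it.\<close>
      have "(\<lambda>z. if z = x then 1 else 0) = (\<lambda>z. if z = y then 1 else 0 :: complex)"
        by (rule uniq[of _ _ x]) (use xy B in \<open>auto simp: if_distrib[of "\<lambda>c. c *s _"] cong: if_cong\<close>)
      thus "x = y" by (metis zero_neq_one)
    qed
    have "vec.independent (\<Phi> ` B)"
    proof
      assume "vec.dependent (\<Phi> ` B)"
      then obtain u v where u: "(\<Sum>v\<in>\<Phi> ` B. u v *s v) = 0" "v \<in> \<Phi> ` B" "u v \<noteq> 0"
        using vec.dependent_finite[of "\<Phi> ` B"] B(1) by auto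
      \<comment> \<open>A linear relation would be a second expansion of \<open>\<Phi> 0\<close>,
        beside the trivial one.\<close>
      have "(\<lambda>x. if x \<in> B then u (\<Phi> x) else 0) = (\<lambda>x. 0)"
        by (rule uniq[of _ _ 0])
          (use u(1) in \<open>auto simp: \<Phi>_0 sum.reindex[OF inj] convergent_series_numeral cong: sum.cong\<close>)
      moreover obtain x where "x \<in> B" "v = \<Phi> x" using u(2) by blast
      ultimately show False using u(3) by metis
    qed
    moreover have "v \<in> vec.span (\<Phi> ` B)" for v
    proof -
      define h where "h = (\<Sum>i\<in>UNIV. cst2 (v $ i) * b (e i))"
      have h: "h \<in> convergent_series" "\<Phi> h = v"
        using conv_sum[of "\<lambda>i. b (e i)" UNIV] b(1) e_less sum_axis[of v]
        by (auto simp: h_def \<Phi>_sum \<Phi>_b)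
      then obtain l where "v = (\<Sum>x\<in>B. l x *s \<Phi> x)" using ex1[OF h(1)] by metis
      thus ?thesis
        by (simp only:) (rule vec.span_sum, rule vec.span_scale, rule vec.span_base, rule imageI)
    qed
    hence "vec.span (\<Phi> ` B) = UNIV" by blast
    ultimately have "card (\<Phi> ` B) = vec.dim (UNIV :: (complex ^ 'n) set)"
      using vec.dim_eq_card[of "\<Phi> ` B" UNIV] by simp
    thus ?thesis using inj n by (simp add: card_image vec.dim_UNIV card_cart_basis)
  qed
  ultimately show ?thesis
    unfolding quotient_dim_def by (metis someI_ex)
qed

text \<open>Reduces every membership below to one identity for \<open>algebra\<close> and the
  convergence of the displayed cofactors.\<close>

lemma conv_ideal_linear:
  assumes "conv_ideal I"
  shows "y \<in> I \<Longrightarrow> x = a * y \<Longrightarrow> a \<in> convergent_series \<Longrightarrow> x \<in> I"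
    "y \<in> I \<Longrightarrow> z \<in> I \<Longrightarrow> x = a * y + b * z \<Longrightarrow> a \<in> convergent_series \<Longrightarrow>
      b \<in> convergent_series \<Longrightarrow> x \<in> I"
    "y \<in> I \<Longrightarrow> z \<in> I \<Longrightarrow> w \<in> I \<Longrightarrow> x = a * y + b * z + c * w \<Longrightarrow> a \<in> convergent_series \<Longrightarrow>
      b \<in> convergent_series \<Longrightarrow> c \<in> convergent_series \<Longrightarrow> x \<in> I"
  using conv_idealD[OF assms] by simp_all

text \<open>The kernel of a single coefficient functional is in general not stable under
  multiplication; the third hypothesis therefore concerns the whole family.\<close>

lemma conv_ideal_coefficients:
  assumes "\<And>k f g. k < n \<Longrightarrow> \<phi> k (f + g) = \<phi> k f + \<phi> k g"
    and "\<And>k c f. k < n \<Longrightarrow> \<phi> k (cst2 c * f) = c * \<phi> k f"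
    and "\<And>a h. (\<forall>k<n. \<phi> k h = 0) \<Longrightarrow> (\<forall>k<n. \<phi> k (a * h) = 0)"
  shows "conv_ideal {h \<in> convergent_series. \<forall>k<n. (\<phi> k h :: complex) = 0}"
proof -
  have "\<phi> k 0 = 0" if "k < n" for k using assms(2)[OF that, of 0 0] by (simp add: cst2_simps)
  thus ?thesis using assms unfolding conv_ideal_def by (auto intro: convergent_series_intros)
qed

lemma less_Suc_forall: "(\<forall>k<Suc n. P k) \<longleftrightarrow> P 0 \<and> (\<forall>k<n. P (Suc k))"
  using less_Suc_eq_0_disj by auto

abbreviation (input) cf :: "series2 \<Rightarrow> nat \<Rightarrow> nat \<Rightarrow> complex" where
  "cf h i j \<equiv> h $ j $ i"

lemma mon_nth: "mon p q $ j $ i = (if i = p \<and> j = q then 1 else 0)"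
  using cst2_mult_mon_nth[of 1 p q j i] by (simp add: cst2_simps)

lemma convergent_series_mon: "mon p q \<in> convergent_series"
  unfolding mon_def by (intro convergent_series_intros)

section \<open>The ordinary triple point\<close>

text \<open>Dual to the basis \<open>1, s, t, s t\<close> of the quotient by
  \<open>(s^2, t^2)\<close>, the ideal of the partials of \<open>s^3 + t^3\<close>.\<close>

definition D4_functional :: "nat \<Rightarrow> series2 \<Rightarrow> complex" where
  "D4_functional k h = [cf h 0 0, cf h 1 0, cf h 0 1, cf h 1 1] ! k"

definition D4_ideal :: "series2 set" where
  "D4_ideal = {h \<in> convergent_series. \<forall>k<4. D4_functional k h = 0}"

lemma D4_functional_linear:
  "k < 4 \<Longrightarrow> D4_functional k (f + g) = D4_functional k f + D4_functional k g"
  "k < 4 \<Longrightarrow> D4_functional k (cst2 c * f) = c * D4_functional k f"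
  unfolding D4_functional_def cst2_mult_nth by (auto simp: numeral_eq_Suc less_Suc_eq)

lemma conv_ideal_D4: "conv_ideal D4_ideal"
  unfolding D4_ideal_def
proof (rule conv_ideal_coefficients)
  show "\<forall>k<4. D4_functional k (a * h) = 0" if "\<forall>k<4. D4_functional k h = 0" for a h
    using that by (simp add: D4_functional_def numeral_eq_Suc less_Suc_forall fps_mult_nth fps_sum_nth)
qed (rule D4_functional_linear; assumption)+

lemma quotient_dim_D4: "quotient_dim convergent_series D4_ideal = 4"
proof (rule quotient_dim_eqI[where 'n = 4 and \<phi> = D4_functional and
      b = "\<lambda>k. [mon 0 0, mon 1 0, mon 0 1, mon 1 1] ! k"])
  show "D4_ideal = {h \<in> convergent_series. \<forall>k<4. D4_functional k h = 0}" by (simp add: D4_ideal_def)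
  show "[mon 0 0, mon 1 0, mon 0 1, mon 1 1] ! k \<in> convergent_series" if "k < 4" for k
    using that by (auto simp: numeral_eq_Suc less_Suc_eq convergent_series_mon)
  show "D4_functional j ([mon 0 0, mon 1 0, mon 0 1, mon 1 1] ! k) = (if j = k then 1 else 0)"
    if "j < 4" "k < 4" for j k
    using that by (auto simp: D4_functional_def numeral_eq_Suc less_Suc_eq mon_nth)
qed (simp_all add: D4_functional_linear)

lemma D4_ideal_generators: "var_s ^ 2 \<in> D4_ideal" "var_t ^ 2 \<in> D4_ideal"
proof -
  have "mon 2 0 \<in> D4_ideal" "mon 0 2 \<in> D4_ideal"
    by (simp_all add: D4_ideal_def D4_functional_def convergent_series_mon numeral_eq_Suc
        less_Suc_forall mon_nth)
  thus "var_s ^ 2 \<in> D4_ideal" "var_t ^ 2 \<in> D4_ideal" by (simp_all add: mon_def)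
qed

text \<open>Without the four monomials, \<open>h\<close> is a part divisible by \<open>s^2\<close>
  plus a part divisible by \<open>t^2\<close>. With \<open>D4_ideal_generators\<close> this
  identifies the kernel as the ideal generated by the two squares.\<close>

lemma D4_ideal_least:
  assumes I: "conv_ideal I" "var_s ^ 2 \<in> I" "var_t ^ 2 \<in> I"
  shows "D4_ideal \<subseteq> I"
proof
  fix h assume h: "h \<in> D4_ideal"
  hence c: "h \<in> convergent_series" by (simp add: D4_ideal_def)
  have z: "cf h 0 0 = 0" "cf h 1 0 = 0" "cf h 0 1 = 0" "cf h 1 1 = 0"
    using h by (simp_all add: D4_ideal_def D4_functional_def numeral_eq_Suc less_Suc_forall)
  have "h = restrict_series (\<lambda>i j. i \<ge> 2) h + restrict_series (\<lambda>i j. i < 2 \<and> j \<ge> 2) h"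
  proof (intro fps_ext)
    fix j i :: nat
    have "cf h i j = 0" if "i < 2" "j < 2"
      using that z by (auto simp: numeral_eq_Suc less_Suc_eq)
    thus "cf h i j = (restrict_series (\<lambda>i j. i \<ge> 2) h + restrict_series (\<lambda>i j. i < 2 \<and> j \<ge> 2) h) $ j $ i"
      by (auto simp: restrict_series_nth not_le)
  qed
  moreover have "restrict_series (\<lambda>i j. i \<ge> 2) h \<in> I"
    by (rule restrict_series_in_ideal[of _ 2 0]) (use I c in \<open>auto simp: mon_def\<close>)
  moreover have "restrict_series (\<lambda>i j. i < 2 \<and> j \<ge> 2) h \<in> I"
    by (rule restrict_series_in_ideal[of _ 0 2]) (use I c in \<open>auto simp: mon_def\<close>)
  ultimately show "h \<in> I" using conv_idealD(1)[OF I(1)] by metis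
qed

text \<open>With \<open>g = s^3 + t^3\<close> the equation is \<open>g (g + 1)\<close>, so the
  partials are \<open>s^2\<close> and \<open>t^2\<close> times \<open>3 (2 g + 1)\<close>, and
  \<open>f\<close> lies in \<open>(s^2, t^2)\<close> because \<open>g\<close> does.\<close>

lemma tjurina_triple_point:
  assumes f: "f = (var_s ^ 3 + var_t ^ 3) * (var_s ^ 3 + var_t ^ 3 + 1)"
  shows "quotient_dim convergent_series (tjurina_ideal f) = 4"
proof -
  note c = convergent_series_intros
  define g where "g = var_s ^ 3 + var_t ^ 3"
  have g: "g \<in> convergent_series" unfolding g_def by (intro c)
  have fs: "deriv_s f = 3 * var_s ^ 2 * (2 * g + 1)" and ft: "deriv_t f = 3 * var_t ^ 2 * (2 * g + 1)"
  proof -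
    have g': "deriv_s g = 3 * var_s ^ 2" "deriv_t g = 3 * var_t ^ 2" by (simp_all add: g_def deriv_simps)
    have "f = g * (g + 1)" by (simp add: f g_def)
    hence "deriv_s f = 3 * var_s ^ 2 * (g + 1) + g * (3 * var_s ^ 2)"
      "deriv_t f = 3 * var_t ^ 2 * (g + 1) + g * (3 * var_t ^ 2)" by (simp_all add: deriv_simps g')
    thus "deriv_s f = 3 * var_s ^ 2 * (2 * g + 1)" "deriv_t f = 3 * var_t ^ 2 * (2 * g + 1)"
      by (simp_all add: algebra_simps)
  qed
  have fg: "f = g ^ 2 + g" unfolding f g_def by algebra
  have T: "conv_ideal (tjurina_ideal f)"
    "f \<in> tjurina_ideal f" "deriv_s f \<in> tjurina_ideal f" "deriv_t f \<in> tjurina_ideal f"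
  proof -
    have "f \<in> convergent_series" unfolding fg by (intro c g)
    moreover have "deriv_s f \<in> convergent_series" unfolding fs by (intro c g)
    moreover have "deriv_t f \<in> convergent_series" unfolding ft by (intro c g)
    ultimately show "conv_ideal (tjurina_ideal f)"
      "f \<in> tjurina_ideal f" "deriv_s f \<in> tjurina_ideal f" "deriv_t f \<in> tjurina_ideal f"
      by (rule tjurina_ideal)+
  qed
  \<comment> \<open>One third as a series; \<open>algebra\<close> then works with the ring relation
    \<open>3 * q = 1\<close>.\<close>
  define q where "q = cst2 (1 / 3)"
  have "cst2 3 * q = 1" unfolding q_def by (simp flip: cst2_simps(3) add: cst2_simps(1))
  hence q: "3 * q = 1" "q \<in> convergent_series" by (simp_all add: cst2_numeral q_def c)
  note lin = conv_ideal_linear[OF T(1)] conv_ideal_linear[OF conv_ideal_D4]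
  have "tjurina_ideal f \<subseteq> D4_ideal"
  proof (rule tjurina_ideal_subset[OF conv_ideal_D4])
    have e: "f = (var_s * (g + 1)) * var_s ^ 2 + (var_t * (g + 1)) * var_t ^ 2"
      unfolding fg by (simp add: g_def algebra_simps power2_eq_square power3_eq_cube)
    show "f \<in> D4_ideal" by (rule lin(5)[OF D4_ideal_generators e]) (intro c g)+
    have e: "deriv_s f = (3 * (2 * g + 1)) * var_s ^ 2" unfolding fs by algebra
    show "deriv_s f \<in> D4_ideal" by (rule lin(4)[OF D4_ideal_generators(1) e]) (intro c g)+
    have e: "deriv_t f = (3 * (2 * g + 1)) * var_t ^ 2" unfolding ft by algebra
    show "deriv_t f \<in> D4_ideal" by (rule lin(4)[OF D4_ideal_generators(2) e]) (intro c g)+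
  qed
  moreover have "D4_ideal \<subseteq> tjurina_ideal f"
  proof (rule D4_ideal_least[OF T(1)])
    \<comment> \<open>\<open>2 * g + 1\<close> is invertible modulo \<open>f\<close> because \<open>(2 * g + 1)\<^sup>2 = 4 * f + 1\<close>.\<close>
    have e: "var_s ^ 2 = (q * (2 * g + 1)) * deriv_s f + (- 4 * var_s ^ 2) * f"
      unfolding fs unfolding fg using q(1) by algebra
    show "var_s ^ 2 \<in> tjurina_ideal f" by (rule lin(2)[OF T(3,2) e]) (intro c q g)+
    have e: "var_t ^ 2 = (q * (2 * g + 1)) * deriv_t f + (- 4 * var_t ^ 2) * f"
      unfolding ft unfolding fg using q(1) by algebra
    show "var_t ^ 2 \<in> tjurina_ideal f" by (rule lin(2)[OF T(4,2) e]) (intro c q g)+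
  qed
  ultimately have "tjurina_ideal f = D4_ideal" by blast
  thus ?thesis by (simp add: quotient_dim_D4)
qed

section \<open>The contact of the curve with an inflectional tangent\<close>

text \<open>\<open>V\<close> is a unit, having constant term \<open>3 \<epsilon>^2\<close>.
  Splitting it into linear factors in \<open>s\<close> makes its inverse a product of two geometric
  series.\<close>

lemma flex_coordinate:
  fixes \<epsilon> :: complex
  assumes "\<epsilon> ^ 3 + 1 = 0"
  defines "E \<equiv> cst2 \<epsilon>" and "K \<equiv> cst2 (\<epsilon> / 6)" and "V \<equiv> 3 * cst2 \<epsilon> ^ 2 + 3 * cst2 \<epsilon> * var_s + var_s ^ 2"
  shows "E = 6 * K" "E ^ 3 = - 1" "(E + var_s) ^ 3 + 1 = var_s * V"
    "\<exists>Y\<in>convergent_series. Y * V = 1"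
proof -
  have "cst2 (6 * (\<epsilon> / 6)) = 6 * K" unfolding K_def by (simp only: cst2_simps cst2_numeral)
  thus "E = 6 * K" by (simp add: E_def)
  have "cst2 (\<epsilon> ^ 3 + 1) = E ^ 3 + 1" by (simp only: cst2_simps E_def)
  thus E3: "E ^ 3 = - 1" using assms(1) by (simp add: cst2_simps eq_neg_iff_add_eq_0)
  show "(E + var_s) ^ 3 + 1 = var_s * V" unfolding V_def E_def[symmetric] using E3 by algebra
  \<comment> \<open>\<open>s^2 + 3 \<epsilon> s + 3 \<epsilon>^2\<close> has discriminant
    \<open>- 3 \<epsilon>^2\<close>; \<open>a\<close> and \<open>b\<close> below are its
    roots.\<close>
  define r where "r = \<i> * of_real (sqrt 3)"
  have r: "r ^ 2 = - 3" by (simp add: r_def power_mult_distrib flip: of_real_power)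
  define a where "a = \<epsilon> * ((- 3 + r) / 2)"
  define b where "b = \<epsilon> * ((- 3 - r) / 2)"
  have ab: "a + b = - 3 * \<epsilon>" "a * b = 3 * \<epsilon> ^ 2"
  proof -
    show "a + b = - 3 * \<epsilon>" by (simp add: a_def b_def field_simps)
    have "4 * (a * b) = \<epsilon> ^ 2 * (9 - r ^ 2)"
      by (simp add: a_def b_def power2_eq_square field_simps)
    thus "a * b = 3 * \<epsilon> ^ 2" by (simp add: r)
  qed
  have "\<epsilon> \<noteq> 0" using assms(1) by auto
  hence nz: "a \<noteq> 0" "b \<noteq> 0" using ab(2) by auto
  have "cst2 a + cst2 b = cst2 (- 3 * \<epsilon>)" "cst2 a * cst2 b = cst2 (3 * \<epsilon> ^ 2)"
    by (simp_all only: flip: cst2_simps ab)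
  hence ab': "cst2 a + cst2 b = - 3 * E" "cst2 a * cst2 b = 3 * E ^ 2"
    by (simp_all add: cst2_simps cst2_numeral E_def)
  hence V: "V = (var_s - cst2 a) * (var_s - cst2 b)"
    unfolding V_def E_def[symmetric] by algebra
  obtain A where A: "A \<in> convergent_series" "(var_s - cst2 a) * A = 1"
    using nz(1) by (rule convergent_series_geometric)
  obtain B where B: "B \<in> convergent_series" "(var_s - cst2 b) * B = 1"
    using nz(2) by (rule convergent_series_geometric)
  show "\<exists>Y\<in>convergent_series. Y * V = 1"
  proof
    show "A * B * V = 1" unfolding V using A(2) B(2) by algebra
    show "A * B \<in> convergent_series" using A B by (intro convergent_series_intros)
  qed
qed

text \<open>Packs what both Tjurina computations use about \<open>U\<close> into polynomial
  relations between opaque names, the form in which \<open>algebra\<close> can use them.\<close>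

lemma flex_chart:
  fixes \<epsilon> :: complex
  assumes \<epsilon>: "\<epsilon> ^ 3 + 1 = 0" and U: "U = (cst2 \<epsilon> + var_s) ^ 3 + 1"
  obtains E K V Y q where "K = cst2 (\<epsilon> / 6)" "E = 6 * K" "E ^ 3 = - 1"
    "V = 3 * E ^ 2 + 3 * E * var_s + var_s ^ 2" "U = var_s * V" "U = (E + var_s) ^ 3 + 1"
    "Y * V = 1" "3 * q = 1" "deriv_s U = 3 * (E + var_s) ^ 2" "deriv_t U = 0"
    "{E, K, V, Y, q, U} \<subseteq> convergent_series"
proof -
  note c = convergent_series_intros
  define E K V q where "E = cst2 \<epsilon>" and "K = cst2 (\<epsilon> / 6)"
    and "V = 3 * E ^ 2 + 3 * E * var_s + var_s ^ 2" and "q = cst2 (1 / 3)"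
  note f = flex_coordinate[OF \<epsilon>, folded E_def K_def, folded V_def]
  obtain Y where Y: "Y \<in> convergent_series" "Y * V = 1" using f(4) by blast
  have "cst2 3 * q = 1" unfolding q_def by (simp flip: cst2_simps(3) add: cst2_simps(1))
  hence q: "3 * q = 1" by (simp add: cst2_numeral)
  have U': "U = (E + var_s) ^ 3 + 1" by (simp add: U E_def)
  have cE: "E \<in> convergent_series" "K \<in> convergent_series" "q \<in> convergent_series"
    by (simp_all add: E_def K_def q_def c)
  have cV: "V \<in> convergent_series" "U \<in> convergent_series" unfolding V_def U' by (intro c cE)+
  have dU: "deriv_s U = 3 * (E + var_s) ^ 2" "deriv_t U = 0"
    by (simp_all add: U E_def deriv_simps)
  have UV: "U = var_s * V" using f(3) U' by simp
  have "{E, K, V, Y, q, U} \<subseteq> convergent_series" using cE cV Y by simp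
  with K_def f(1,2) V_def UV U' Y(2) q dU show ?thesis by (rule that)
qed

text \<open>
  Modulo the ideal, \<open>s = \<kappa> t\<^sup>3\<close> and \<open>t\<^sup>5 = 0\<close>; the functionals are the coefficients of \<open>1, t, \<dots>, t\<^sup>4\<close> after this
  substitution. The value of interest is \<open>\<kappa> = \<epsilon>/6\<close>, as \<open>2 U + t\<^sup>3 = 6 \<epsilon>\<^sup>2 s + t\<^sup>3 + \<dots>\<close> and \<open>\<epsilon>\<^sup>3 = -1\<close>.
\<close>

definition A5_functional :: "complex \<Rightarrow> nat \<Rightarrow> series2 \<Rightarrow> complex" where
  "A5_functional \<kappa> k h = [cf h 0 0, cf h 0 1, cf h 0 2, cf h 0 3 + \<kappa> * cf h 1 0,
     cf h 0 4 + \<kappa> * cf h 1 1] ! k"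

definition A5_ideal :: "complex \<Rightarrow> series2 set" where
  "A5_ideal \<kappa> = {h \<in> convergent_series. \<forall>k<5. A5_functional \<kappa> k h = 0}"

lemma A5_functional_linear:
  "k < 5 \<Longrightarrow> A5_functional \<kappa> k (f + g) = A5_functional \<kappa> k f + A5_functional \<kappa> k g"
  "k < 5 \<Longrightarrow> A5_functional \<kappa> k (cst2 c * f) = c * A5_functional \<kappa> k f"
  unfolding A5_functional_def cst2_mult_nth by (auto simp: numeral_eq_Suc less_Suc_eq algebra_simps)

text \<open>If the first three coefficients of \<open>h\<close> vanish, functional 3 of
  \<open>a * h\<close> is a multiple of functional 3 of \<open>h\<close>, and functional 4 is a
  combination of functionals 3 and 4, with multipliers from the coefficients of \<open>1\<close> and
  \<open>t\<close> in \<open>a\<close>.\<close>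

lemma conv_ideal_A5: "conv_ideal (A5_ideal \<kappa>)"
  unfolding A5_ideal_def
proof (rule conv_ideal_coefficients)
  show "\<forall>k<5. A5_functional \<kappa> k (a * h) = 0" if "\<forall>k<5. A5_functional \<kappa> k h = 0" for a h
  proof -
    have z: "cf h 0 0 = 0" "cf h 0 (Suc 0) = 0" "cf h 0 (Suc (Suc 0)) = 0"
      "cf h 0 (Suc (Suc (Suc 0))) = - \<kappa> * cf h (Suc 0) 0"
      "cf h 0 (Suc (Suc (Suc (Suc 0)))) = - \<kappa> * cf h (Suc 0) (Suc 0)"
      using that by (simp_all add: A5_functional_def numeral_eq_Suc less_Suc_forall eq_neg_iff_add_eq_0)
    show ?thesis
      by (simp add: A5_functional_def numeral_eq_Suc less_Suc_forall fps_mult_nth fps_sum_nth z algebra_simps)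
  qed
qed (rule A5_functional_linear; assumption)+

lemma quotient_dim_A5: "quotient_dim convergent_series (A5_ideal \<kappa>) = 5"
proof (rule quotient_dim_eqI[where 'n = 5 and \<phi> = "A5_functional \<kappa>" and b = "\<lambda>k. mon 0 k"])
  show "A5_ideal \<kappa> = {h \<in> convergent_series. \<forall>k<5. A5_functional \<kappa> k h = 0}" by (simp add: A5_ideal_def)
  show "A5_functional \<kappa> j (mon 0 k) = (if j = k then 1 else 0)"
    if "j < 5" "k < 5" for j k
    using that by (auto simp: A5_functional_def numeral_eq_Suc less_Suc_eq mon_nth)
qed (simp_all add: A5_functional_linear convergent_series_mon)

lemma A5_ideal_generators:
  "var_s ^ 2 \<in> A5_ideal \<kappa>" "var_s * var_t ^ 2 \<in> A5_ideal \<kappa>" "var_t ^ 5 \<in> A5_ideal \<kappa>"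
  "var_s - cst2 \<kappa> * var_t ^ 3 \<in> A5_ideal \<kappa>"
proof -
  have "mon 2 0 \<in> A5_ideal \<kappa>" "mon 1 2 \<in> A5_ideal \<kappa>" "mon 0 5 \<in> A5_ideal \<kappa>"
    "mon 1 0 - cst2 \<kappa> * mon 0 3 \<in> A5_ideal \<kappa>"
    by (simp_all add: A5_ideal_def A5_functional_def convergent_series_mon convergent_series_intros
        numeral_eq_Suc less_Suc_forall mon_nth cst2_mult_mon_nth)
  thus "var_s ^ 2 \<in> A5_ideal \<kappa>" "var_s * var_t ^ 2 \<in> A5_ideal \<kappa>" "var_t ^ 5 \<in> A5_ideal \<kappa>"
    "var_s - cst2 \<kappa> * var_t ^ 3 \<in> A5_ideal \<kappa>" by (simp_all add: mon_def)
qed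

text \<open>The monomial generators absorb all of \<open>h\<close> except the coefficients of
  \<open>1, t, ..., t^4, s, s t\<close>. The functionals say that this remainder is
  \<open>(x + y t) (s - \<kappa> t^3)\<close>.\<close>

lemma A5_ideal_least:
  assumes I: "conv_ideal I" "var_s ^ 2 \<in> I" "var_s * var_t ^ 2 \<in> I" "var_t ^ 5 \<in> I"
    "var_s - cst2 \<kappa> * var_t ^ 3 \<in> I"
  shows "A5_ideal \<kappa> \<subseteq> I"
proof
  note c = convergent_series_intros
  fix h assume h: "h \<in> A5_ideal \<kappa>"
  hence hc: "h \<in> convergent_series" by (simp add: A5_ideal_def)
  have z: "cf h 0 0 = 0" "cf h 0 1 = 0" "cf h 0 2 = 0" "cf h 0 3 = - \<kappa> * cf h 1 0"
    "cf h 0 4 = - \<kappa> * cf h 1 1"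
    using h by (simp_all add: A5_ideal_def A5_functional_def numeral_eq_Suc less_Suc_forall eq_neg_iff_add_eq_0)
  define x y where "x = cf h 1 0" and "y = cf h 1 1"
  define r where "r = restrict_series (\<lambda>i j. i \<ge> 2) h + restrict_series (\<lambda>i j. i = 1 \<and> j \<ge> 2) h +
    restrict_series (\<lambda>i j. i = 0 \<and> j \<ge> 5) h"
  have "restrict_series (\<lambda>i j. i \<ge> 2) h \<in> I"
    by (rule restrict_series_in_ideal[of _ 2 0]) (use I hc in \<open>auto simp: mon_def\<close>)
  moreover have "restrict_series (\<lambda>i j. i = 1 \<and> j \<ge> 2) h \<in> I"
    by (rule restrict_series_in_ideal[of _ 1 2]) (use I hc in \<open>auto simp: mon_def\<close>)
  moreover have "restrict_series (\<lambda>i j. i = 0 \<and> j \<ge> 5) h \<in> I"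
    by (rule restrict_series_in_ideal[of _ 0 5]) (use I hc in \<open>auto simp: mon_def\<close>)
  ultimately have r: "r \<in> I" unfolding r_def using conv_idealD(1)[OF I(1)] by simp
  have "h = r + (cst2 x * mon 1 0 + cst2 (- \<kappa> * x) * mon 0 3) + (cst2 y * mon 1 1 + cst2 (- \<kappa> * y) * mon 0 4)"
    (is "h = ?h")
  proof (intro fps_ext)
    fix j i :: nat
    consider "i \<ge> 2" | "i = 1" "j \<ge> 2" | "i = 0" "j \<ge> 5" | "i = 1" "j = 0" | "i = 1" "j = 1" |
      "i = 0" "j \<in> {0, 1, 2, 3, 4}" by fastforce
    thus "cf h i j = cf ?h i j"
      unfolding r_def fps_add_nth restrict_series_nth cst2_mult_mon_nth
      by cases (auto simp: z[simplified] x_def y_def)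
  qed
  also have "\<dots> = 1 * r + (cst2 x + cst2 y * var_t) * (var_s - cst2 \<kappa> * var_t ^ 3)"
    by (simp add: mon_def cst2_simps algebra_simps numeral_eq_Suc)
  finally show "h \<in> I" by (rule conv_ideal_linear(2)[OF I(1) r I(5)]) (intro c)+
qed

text \<open>In terms of \<open>U\<close> the ideal is generated by \<open>t^2 U\<close>,
  \<open>U^2\<close> and \<open>2 U + t^3\<close>; the unit \<open>V\<close> exchanges powers of
  \<open>U\<close> for powers of \<open>s\<close>.\<close>

lemma tjurina_flex_tangent:
  assumes \<epsilon>: "\<epsilon> ^ 3 + 1 = 0" and U: "U = (cst2 \<epsilon> + var_s) ^ 3 + 1" and f: "f = U * (U + var_t ^ 3)"
  shows "quotient_dim convergent_series (tjurina_ideal f) = 5"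
proof -
  note c = convergent_series_intros
  obtain E K V Y q where K: "K = cst2 (\<epsilon> / 6)" and EK: "E = 6 * K" and E3: "E ^ 3 = - 1"
    and Vs: "V = 3 * E ^ 2 + 3 * E * var_s + var_s ^ 2" and UV: "U = var_s * V"
    and Us: "U = (E + var_s) ^ 3 + 1" and Y: "Y * V = 1" and q: "3 * q = 1"
    and dU: "deriv_s U = 3 * (E + var_s) ^ 2" "deriv_t U = 0"
    and conv: "{E, K, V, Y, q, U} \<subseteq> convergent_series"
    using flex_chart[OF \<epsilon> U] .
  have conv': "E \<in> convergent_series" "K \<in> convergent_series" "V \<in> convergent_series"
    "Y \<in> convergent_series" "q \<in> convergent_series" "U \<in> convergent_series" using conv by auto
  note c = c conv'
  have f': "f = U * (U + var_t ^ 3)" by (rule f)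
  have fs: "deriv_s f = 3 * (E + var_s) ^ 2 * (2 * U + var_t ^ 3)"
    by (simp add: f deriv_simps dU algebra_simps)
  have ft: "deriv_t f = 3 * var_t ^ 2 * U"
    by (simp add: f deriv_simps dU algebra_simps)
  let ?T = "tjurina_ideal f"
  have T: "conv_ideal ?T" "f \<in> ?T" "deriv_s f \<in> ?T" "deriv_t f \<in> ?T"
  proof -
    have "f \<in> convergent_series" unfolding f' by (intro c)
    moreover have "deriv_s f \<in> convergent_series" unfolding fs by (intro c)
    moreover have "deriv_t f \<in> convergent_series" unfolding ft by (intro c)
    ultimately show "conv_ideal ?T" "f \<in> ?T" "deriv_s f \<in> ?T" "deriv_t f \<in> ?T"
      by (rule tjurina_ideal)+
  qed
  let ?A = "A5_ideal (\<epsilon> / 6)"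
  note lT = conv_ideal_linear[OF T(1)]
  note lA = conv_ideal_linear[OF conv_ideal_A5[of "\<epsilon> / 6"]]
  note A = A5_ideal_generators[of "\<epsilon> / 6", folded K]
  have "?T \<subseteq> ?A"
  proof (rule tjurina_ideal_subset[OF conv_ideal_A5])
    have e: "f = V ^ 2 * var_s ^ 2 + (V * var_t) * (var_s * var_t ^ 2)" unfolding f' UV by algebra
    show "f \<in> ?A" by (rule lA(2)[OF A(1,2) e]) (intro c)+
    \<comment> \<open>The coefficient of \<open>t^3\<close> matches because
      \<open>6 E^2 K = E^3 = -1\<close>.\<close>
    have "2 * U + var_t ^ 3 = (6 * E ^ 2) * (var_s - K * var_t ^ 3) + (6 * E + 2 * var_s) * var_s ^ 2"
      unfolding UV Vs using E3 EK by algebra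
    hence e: "deriv_s f = (3 * (E + var_s) ^ 2 * (6 * E ^ 2)) * (var_s - K * var_t ^ 3) +
        (3 * (E + var_s) ^ 2 * (6 * E + 2 * var_s)) * var_s ^ 2"
      unfolding fs by algebra
    show "deriv_s f \<in> ?A" by (rule lA(2)[OF A(4,1) e]) (intro c)+
    have e: "deriv_t f = (3 * V) * (var_s * var_t ^ 2)" unfolding ft UV by algebra
    show "deriv_t f \<in> ?A" by (rule lA(1)[OF A(2) e]) (intro c)+
  qed
  moreover have "?A \<subseteq> ?T"
  proof -
    have e: "var_t ^ 2 * U = q * deriv_t f" unfolding ft using q by algebra
    have m1: "var_t ^ 2 * U \<in> ?T" by (rule lT(1)[OF T(4) e]) (intro c)+
    have e: "U ^ 2 = 1 * f + (- var_t) * (var_t ^ 2 * U)" unfolding f' by algebra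
    have m2: "U ^ 2 \<in> ?T" by (rule lT(2)[OF T(2) m1 e]) (intro c)+
    \<comment> \<open>\<open>(E + s) * deriv_s U = 3 * (U - 1)\<close> makes \<open>deriv_s U\<close> a unit modulo \<open>U\<^sup>2\<close>.\<close>
    have e: "2 * U + var_t ^ 3 = ((1 + U) * (- q * (E + var_s))) * deriv_s f + (2 * U + var_t ^ 3) * U ^ 2"
    proof -
      have "(- q * (E + var_s)) * deriv_s f = (1 - U) * (2 * U + var_t ^ 3)"
        unfolding fs Us using q by algebra
      thus ?thesis by algebra
    qed
    have m3: "2 * U + var_t ^ 3 \<in> ?T" by (rule lT(2)[OF T(3) m2 e]) (intro c)+
    have e: "var_t ^ 5 = var_t ^ 2 * (2 * U + var_t ^ 3) + (- 2) * (var_t ^ 2 * U)" by algebra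
    have t5: "var_t ^ 5 \<in> ?T" by (rule lT(2)[OF m3 m1 e]) (intro c)+
    have e: "var_s ^ 2 = Y ^ 2 * U ^ 2" unfolding UV using Y by algebra
    have s2: "var_s ^ 2 \<in> ?T" by (rule lT(1)[OF m2 e]) (intro c)+
    have e: "var_s * var_t ^ 2 = Y * (var_t ^ 2 * U)" unfolding UV using Y by algebra
    have st2: "var_s * var_t ^ 2 \<in> ?T" by (rule lT(1)[OF m1 e]) (intro c)+
    have e: "var_s - K * var_t ^ 3 = (- K) * (2 * U + var_t ^ 3) + (K * (6 * E + 2 * var_s)) * var_s ^ 2"
      unfolding UV Vs using E3 EK by algebra
    have sK: "var_s - K * var_t ^ 3 \<in> ?T" by (rule lT(2)[OF m3 s2 e]) (intro c)+
    show ?thesis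
      by (rule A5_ideal_least[of ?T "\<epsilon> / 6", folded K, OF T(1) s2 st2 t5 sK])
  qed
  ultimately have "?T = ?A" by blast
  thus ?thesis by (simp add: quotient_dim_A5)
qed

text \<open>
  Modulo the ideal, \<open>s t = \<kappa> t\<^sup>4\<close>, \<open>s\<^sup>2 = 8 \<kappa>\<^sup>2 t\<^sup>6\<close> and \<open>t\<^sup>7 = 0\<close>; the functionals are the coefficients of
  \<open>1, t, \<dots>, t\<^sup>6, s\<close> after this reduction.
\<close>

definition D8_functional :: "complex \<Rightarrow> nat \<Rightarrow> series2 \<Rightarrow> complex" where
  "D8_functional \<kappa> k h = [cf h 0 0, cf h 0 1, cf h 0 2, cf h 0 3, cf h 0 4 + \<kappa> * cf h 1 1,
     cf h 0 5 + \<kappa> * cf h 1 2, cf h 0 6 + \<kappa> * cf h 1 3 + 8 * \<kappa> ^ 2 * cf h 2 0, cf h 1 0] ! k"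

definition D8_ideal :: "complex \<Rightarrow> series2 set" where
  "D8_ideal \<kappa> = {h \<in> convergent_series. \<forall>k<8. D8_functional \<kappa> k h = 0}"

lemma D8_functional_linear:
  "k < 8 \<Longrightarrow> D8_functional \<kappa> k (f + g) = D8_functional \<kappa> k f + D8_functional \<kappa> k g"
  "k < 8 \<Longrightarrow> D8_functional \<kappa> k (cst2 c * f) = c * D8_functional \<kappa> k f"
  unfolding D8_functional_def cst2_mult_nth by (auto simp: numeral_eq_Suc less_Suc_eq algebra_simps)

text \<open>Given the vanishing of functionals 0 to 3 and 7 of \<open>h\<close>, functionals 4, 5
  and 6 of \<open>a * h\<close> are combinations of the same three of \<open>h\<close>, with the
  coefficients of \<open>1, t, t^2\<close> in \<open>a\<close> as multipliers.\<close>

lemma conv_ideal_D8: "conv_ideal (D8_ideal \<kappa>)"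
  unfolding D8_ideal_def
proof (rule conv_ideal_coefficients)
  show "\<forall>k<8. D8_functional \<kappa> k (a * h) = 0" if h: "\<forall>k<8. D8_functional \<kappa> k h = 0" for a h
  proof -
    \<comment> \<open>Keeps the square opaque while \<open>numeral_eq_Suc\<close> unfolds the
      indices; everything is linear in \<open>\<mu>\<close>.\<close>
    define \<mu> where "\<mu> = 8 * \<kappa> ^ 2"
    have "\<forall>k<8. [cf h 0 0, cf h 0 1, cf h 0 2, cf h 0 3, cf h 0 4 + \<kappa> * cf h 1 1,
     cf h 0 5 + \<kappa> * cf h 1 2, cf h 0 6 + \<kappa> * cf h 1 3 + \<mu> * cf h 2 0, cf h 1 0] ! k = 0"
      using h by (simp only: D8_functional_def \<mu>_def)
    hence z: "cf h 0 0 = 0" "cf h 0 (Suc 0) = 0" "cf h 0 (Suc (Suc 0)) = 0" "cf h 0 (Suc (Suc (Suc 0))) = 0"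
      "cf h (Suc 0) 0 = 0"
      "cf h 0 (Suc (Suc (Suc (Suc 0)))) = - \<kappa> * cf h (Suc 0) (Suc 0)"
      "cf h 0 (Suc (Suc (Suc (Suc (Suc 0))))) = - \<kappa> * cf h (Suc 0) (Suc (Suc 0))"
      "cf h 0 (Suc (Suc (Suc (Suc (Suc (Suc 0)))))) =
        - \<mu> * cf h (Suc (Suc 0)) 0 - \<kappa> * cf h (Suc 0) (Suc (Suc (Suc 0)))"
      by (simp_all add: numeral_eq_Suc less_Suc_forall eq_neg_iff_add_eq_0 eq_diff_eq)
    have "\<forall>k<8. [cf (a * h) 0 0, cf (a * h) 0 1, cf (a * h) 0 2, cf (a * h) 0 3,
        cf (a * h) 0 4 + \<kappa> * cf (a * h) 1 1, cf (a * h) 0 5 + \<kappa> * cf (a * h) 1 2,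
        cf (a * h) 0 6 + \<kappa> * cf (a * h) 1 3 + \<mu> * cf (a * h) 2 0, cf (a * h) 1 0] ! k = 0"
      by (simp add: numeral_eq_Suc less_Suc_forall fps_mult_nth fps_sum_nth z algebra_simps)
    thus ?thesis by (simp only: D8_functional_def \<mu>_def)
  qed
qed (rule D8_functional_linear; assumption)+

lemma quotient_dim_D8: "quotient_dim convergent_series (D8_ideal \<kappa>) = 8"
proof (rule quotient_dim_eqI[where 'n = 8 and \<phi> = "D8_functional \<kappa>" and
      b = "\<lambda>k. if k < 7 then mon 0 k else mon 1 0"])
  show "D8_ideal \<kappa> = {h \<in> convergent_series. \<forall>k<8. D8_functional \<kappa> k h = 0}" by (simp add: D8_ideal_def)
  show "D8_functional \<kappa> j (if k < 7 then mon 0 k else mon 1 0) = (if j = k then 1 else 0)"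
    if "j < 8" "k < 8" for j k
  proof -
    have "j \<in> {0, 1, 2, 3, 4, 5, 6, 7}" "k = 7 \<or> k < 7" using that by auto
    thus ?thesis by (auto simp: D8_functional_def mon_nth)
  qed
qed (simp_all add: D8_functional_linear convergent_series_mon)

lemma D8_ideal_generators:
  "var_s ^ 3 \<in> D8_ideal \<kappa>" "var_s ^ 2 * var_t \<in> D8_ideal \<kappa>" "var_s * var_t ^ 4 \<in> D8_ideal \<kappa>"
  "var_t ^ 7 \<in> D8_ideal \<kappa>" "var_s * var_t - cst2 \<kappa> * var_t ^ 4 \<in> D8_ideal \<kappa>"
  "var_s ^ 2 - cst2 (8 * \<kappa> ^ 2) * var_t ^ 6 \<in> D8_ideal \<kappa>"
proof -
  have "mon 3 0 \<in> D8_ideal \<kappa>" "mon 2 1 \<in> D8_ideal \<kappa>" "mon 1 4 \<in> D8_ideal \<kappa>" "mon 0 7 \<in> D8_ideal \<kappa>"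
    "mon 1 1 - cst2 \<kappa> * mon 0 4 \<in> D8_ideal \<kappa>" "mon 2 0 - cst2 (8 * \<kappa> ^ 2) * mon 0 6 \<in> D8_ideal \<kappa>"
    unfolding D8_ideal_def mem_Collect_eq D8_functional_def fps_sub_nth mon_nth cst2_mult_mon_nth
    by (simp_all add: convergent_series_mon convergent_series_intros numeral_eq_Suc less_Suc_forall)
  thus "var_s ^ 3 \<in> D8_ideal \<kappa>" "var_s ^ 2 * var_t \<in> D8_ideal \<kappa>" "var_s * var_t ^ 4 \<in> D8_ideal \<kappa>"
    "var_t ^ 7 \<in> D8_ideal \<kappa>" "var_s * var_t - cst2 \<kappa> * var_t ^ 4 \<in> D8_ideal \<kappa>"
    "var_s ^ 2 - cst2 (8 * \<kappa> ^ 2) * var_t ^ 6 \<in> D8_ideal \<kappa>" by (simp_all add: mon_def)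
qed

text \<open>What the monomial generators do not absorb is \<open>(x1 + x2 t + x3 t^2) (s t -
  \<kappa> t^4) + y (s^2 - 8 \<kappa>^2 t^6)\<close>. Both relations meet in \<open>t^6\<close>,
  hence the three terms of functional 6.\<close>

lemma D8_ideal_least:
  assumes I: "conv_ideal I" "var_s ^ 3 \<in> I" "var_s ^ 2 * var_t \<in> I" "var_s * var_t ^ 4 \<in> I"
    "var_t ^ 7 \<in> I" "var_s * var_t - cst2 \<kappa> * var_t ^ 4 \<in> I"
    "var_s ^ 2 - cst2 (8 * \<kappa> ^ 2) * var_t ^ 6 \<in> I"
  shows "D8_ideal \<kappa> \<subseteq> I"
proof
  note c = convergent_series_intros
  fix h assume h: "h \<in> D8_ideal \<kappa>"
  hence hc: "h \<in> convergent_series" by (simp add: D8_ideal_def)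
  define \<mu> where "\<mu> = 8 * \<kappa> ^ 2"
  have "\<forall>k<8. [cf h 0 0, cf h 0 1, cf h 0 2, cf h 0 3, cf h 0 4 + \<kappa> * cf h 1 1,
     cf h 0 5 + \<kappa> * cf h 1 2, cf h 0 6 + \<kappa> * cf h 1 3 + \<mu> * cf h 2 0, cf h 1 0] ! k = 0"
    using h by (simp only: D8_functional_def D8_ideal_def \<mu>_def) blast
  hence z: "cf h 0 0 = 0" "cf h 0 1 = 0" "cf h 0 2 = 0" "cf h 0 3 = 0" "cf h 1 0 = 0"
    "cf h 0 4 = - \<kappa> * cf h 1 1" "cf h 0 5 = - \<kappa> * cf h 1 2"
    "cf h 0 6 = - \<mu> * cf h 2 0 - \<kappa> * cf h 1 3"
    by (simp_all add: numeral_eq_Suc less_Suc_forall eq_neg_iff_add_eq_0 eq_diff_eq)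
  define x1 x2 x3 y where "x1 = cf h 1 1" and "x2 = cf h 1 2" and "x3 = cf h 1 3" and "y = cf h 2 0"
  define r where "r = restrict_series (\<lambda>i j. i \<ge> 3) h + restrict_series (\<lambda>i j. i = 2 \<and> j \<ge> 1) h +
    restrict_series (\<lambda>i j. i = 1 \<and> j \<ge> 4) h + restrict_series (\<lambda>i j. i = 0 \<and> j \<ge> 7) h"
  have "restrict_series (\<lambda>i j. i \<ge> 3) h \<in> I"
    by (rule restrict_series_in_ideal[of _ 3 0]) (use I hc in \<open>auto simp: mon_def\<close>)
  moreover have "restrict_series (\<lambda>i j. i = 2 \<and> j \<ge> 1) h \<in> I"
    by (rule restrict_series_in_ideal[of _ 2 1]) (use I hc in \<open>auto simp: mon_def\<close>)
  moreover have "restrict_series (\<lambda>i j. i = 1 \<and> j \<ge> 4) h \<in> I"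
    by (rule restrict_series_in_ideal[of _ 1 4]) (use I hc in \<open>auto simp: mon_def\<close>)
  moreover have "restrict_series (\<lambda>i j. i = 0 \<and> j \<ge> 7) h \<in> I"
    by (rule restrict_series_in_ideal[of _ 0 7]) (use I hc in \<open>auto simp: mon_def\<close>)
  ultimately have r: "r \<in> I" unfolding r_def using conv_idealD(1)[OF I(1)] by simp
  have "h = r + (cst2 x1 * mon 1 1 + cst2 (- \<kappa> * x1) * mon 0 4) + (cst2 x2 * mon 1 2 + cst2 (- \<kappa> * x2) * mon 0 5)
      + (cst2 x3 * mon 1 3 + cst2 (- \<kappa> * x3) * mon 0 6) + (cst2 y * mon 2 0 + cst2 (- \<mu> * y) * mon 0 6)"
    (is "h = ?h")
  proof (intro fps_ext)
    fix j i :: nat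
    consider "i \<ge> 3" | "i = 2" "j \<ge> 1" | "i = 1" "j \<ge> 4" | "i = 0" "j \<ge> 7" | "i = 2" "j = 0" |
      "i = 1" "j < 4" | "i = 0" "j < 7" by linarith
    moreover have "j < 4 \<Longrightarrow> j = 0 \<or> j = 1 \<or> j = 2 \<or> j = 3"
      "j < 7 \<Longrightarrow> j = 0 \<or> j = 1 \<or> j = 2 \<or> j = 3 \<or> j = 4 \<or> j = 5 \<or> j = 6" by auto
    ultimately show "cf h i j = cf ?h i j"
      unfolding r_def fps_add_nth restrict_series_nth cst2_mult_mon_nth
      by cases (auto simp: z[simplified] x1_def x2_def x3_def y_def)
  qed
  also have "\<dots> = 1 * r + (cst2 x1 + cst2 x2 * var_t + cst2 x3 * var_t ^ 2) * (var_s * var_t - cst2 \<kappa> * var_t ^ 4) +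
      cst2 y * (var_s ^ 2 - cst2 \<mu> * var_t ^ 6)"
    by (simp add: mon_def cst2_simps algebra_simps numeral_eq_Suc)
  finally show "h \<in> I" by (rule conv_ideal_linear(3)[OF I(1) r I(6) I(7)[folded \<mu>_def]]) (intro c)+
qed

text \<open>The ideal contains \<open>t^4 U\<close>, \<open>t U^2\<close>,
  \<open>t (2 U + t^3)\<close> and \<open>U^3\<close>, found in this order. Dividing by powers of
  the unit \<open>V\<close> gives the monomials, and \<open>deriv_t f\<close> then supplies the
  relation for \<open>s^2\<close>.\<close>

lemma tjurina_flex_tangent_secant:
  assumes \<epsilon>: "\<epsilon> ^ 3 + 1 = 0" and U: "U = (cst2 \<epsilon> + var_s) ^ 3 + 1"
    and f: "f = var_t * (U * (U + var_t ^ 3))"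
  shows "quotient_dim convergent_series (tjurina_ideal f) = 8"
proof -
  note c = convergent_series_intros
  obtain E K V Y q where K: "K = cst2 (\<epsilon> / 6)" and EK: "E = 6 * K" and E3: "E ^ 3 = - 1"
    and Vs: "V = 3 * E ^ 2 + 3 * E * var_s + var_s ^ 2" and UV: "U = var_s * V"
    and Us: "U = (E + var_s) ^ 3 + 1" and Y: "Y * V = 1" and q: "3 * q = 1"
    and dU: "deriv_s U = 3 * (E + var_s) ^ 2" "deriv_t U = 0"
    and conv: "{E, K, V, Y, q, U} \<subseteq> convergent_series"
    using flex_chart[OF \<epsilon> U] .
  have conv': "E \<in> convergent_series" "K \<in> convergent_series" "V \<in> convergent_series"
    "Y \<in> convergent_series" "q \<in> convergent_series" "U \<in> convergent_series" using conv by auto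
  note c = c conv'
  have fs: "deriv_s f = 3 * (E + var_s) ^ 2 * (var_t * (2 * U + var_t ^ 3))"
    by (simp add: f deriv_simps dU algebra_simps)
  have ft: "deriv_t f = U ^ 2 + 4 * var_t ^ 3 * U"
    by (simp add: f deriv_simps dU algebra_simps power2_eq_square power3_eq_cube)
  let ?T = "tjurina_ideal f"
  have T: "conv_ideal ?T" "f \<in> ?T" "deriv_s f \<in> ?T" "deriv_t f \<in> ?T"
  proof -
    have "f \<in> convergent_series" unfolding f by (intro c)
    moreover have "deriv_s f \<in> convergent_series" unfolding fs by (intro c)
    moreover have "deriv_t f \<in> convergent_series" unfolding ft by (intro c)
    ultimately show "conv_ideal ?T" "f \<in> ?T" "deriv_s f \<in> ?T" "deriv_t f \<in> ?T"
      by (rule tjurina_ideal)+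
  qed
  let ?A = "D8_ideal (\<epsilon> / 6)"
  note lT = conv_ideal_linear[OF T(1)]
  note lA = conv_ideal_linear[OF conv_ideal_D8[of "\<epsilon> / 6"]]
  have K2: "cst2 (8 * (\<epsilon> / 6) ^ 2) = 8 * K ^ 2"
    by (simp only: K cst2_simps cst2_numeral)
  note A = D8_ideal_generators[of "\<epsilon> / 6", unfolded K2, folded K]
  have "?T \<subseteq> ?A"
  proof (rule tjurina_ideal_subset[OF conv_ideal_D8])
    have e: "f = V ^ 2 * (var_s ^ 2 * var_t) + V * (var_s * var_t ^ 4)" unfolding f UV by algebra
    show "f \<in> ?A" by (rule lA(2)[OF A(2,3) e]) (intro c)+
    have "var_t * (2 * U + var_t ^ 3) =
        (6 * E ^ 2) * (var_s * var_t - K * var_t ^ 4) + (6 * E + 2 * var_s) * (var_s ^ 2 * var_t)"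
      unfolding UV Vs using E3 EK by algebra
    hence e: "deriv_s f = (3 * (E + var_s) ^ 2 * (6 * E ^ 2)) * (var_s * var_t - K * var_t ^ 4) +
        (3 * (E + var_s) ^ 2 * (6 * E + 2 * var_s)) * (var_s ^ 2 * var_t)"
      unfolding fs by algebra
    show "deriv_s f \<in> ?A" by (rule lA(2)[OF A(5,2) e]) (intro c)+
    \<comment> \<open>Origin of the 8: up to multiples of \<open>s^3\<close> and
      \<open>s^2 t\<close>, \<open>deriv_t f\<close> is \<open>9 E^4 s^2 + 12 E^2 t^3 s\<close>.
      With \<open>s t = K t^4\<close>, \<open>1 / E^2 = - E\<close> and \<open>E = 6 K\<close> it
      vanishes exactly when \<open>s^2 = 8 K^2 t^6\<close>.\<close>
    define X where "X = var_s ^ 2 - 8 * K ^ 2 * var_t ^ 6"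
    have e: "9 * E ^ 4 * var_s ^ 2 + 12 * E ^ 2 * var_t ^ 3 * var_s =
        (9 * E ^ 4) * X + (12 * E ^ 2 * var_t ^ 2) * (var_s * var_t - K * var_t ^ 4)"
      unfolding X_def using E3 EK by algebra
    have m: "9 * E ^ 4 * var_s ^ 2 + 12 * E ^ 2 * var_t ^ 3 * var_s \<in> ?A"
      by (rule lA(2)[OF A(6)[folded X_def] A(5) e]) (intro c)+
    have e: "deriv_t f = 1 * (9 * E ^ 4 * var_s ^ 2 + 12 * E ^ 2 * var_t ^ 3 * var_s) +
      (18 * E ^ 3 + 15 * E ^ 2 * var_s + 6 * E * var_s ^ 2 + var_s ^ 3) * var_s ^ 3 +
      (4 * var_t ^ 2 * (3 * E + var_s)) * (var_s ^ 2 * var_t)"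
      unfolding ft UV Vs by algebra
    show "deriv_t f \<in> ?A" by (rule lA(3)[OF m A(1,2) e]) (intro c)+
  qed
  moreover have "?A \<subseteq> ?T"
  proof -
    \<comment> \<open>\<open>t * deriv_t f - f\<close> cancels \<open>t U^2\<close> and leaves
      \<open>3 t^4 U\<close>.\<close>
    have e: "var_t ^ 4 * U = (q * var_t) * deriv_t f + (- q) * f" unfolding ft unfolding f using q by algebra
    have n1: "var_t ^ 4 * U \<in> ?T" by (rule lT(2)[OF T(4,2) e]) (intro c)+
    have e: "var_t * U ^ 2 = 1 * f + (- 1) * (var_t ^ 4 * U)" unfolding f by algebra
    have n2: "var_t * U ^ 2 \<in> ?T" by (rule lT(2)[OF T(2) n1 e]) (intro c)+
    \<comment> \<open>By \<open>(E + s)^3 = U - 1\<close>, the first summand is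
      \<open>(1 - U) t (2 U + t^3)\<close>; the other two restore what the factor
      \<open>1 - U\<close> removed.\<close>
    have e: "var_t * (2 * U + var_t ^ 3) = (- q * (E + var_s)) * deriv_s f + 2 * (var_t * U ^ 2) + 1 * (var_t ^ 4 * U)"
      unfolding fs Us using q by algebra
    have n3: "var_t * (2 * U + var_t ^ 3) \<in> ?T" by (rule lT(3)[OF T(3) n2 n1 e]) (intro c)+
    have e: "var_t ^ 7 = var_t ^ 3 * (var_t * (2 * U + var_t ^ 3)) + (- 2) * (var_t ^ 4 * U)" by algebra
    have t7: "var_t ^ 7 \<in> ?T" by (rule lT(2)[OF n3 n1 e]) (intro c)+
    have e: "var_s ^ 2 * var_t = Y ^ 2 * (var_t * U ^ 2)" unfolding UV using Y by algebra
    have s2t: "var_s ^ 2 * var_t \<in> ?T" by (rule lT(1)[OF n2 e]) (intro c)+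
    have e: "var_s * var_t ^ 4 = Y * (var_t ^ 4 * U)" unfolding UV using Y by algebra
    have st4: "var_s * var_t ^ 4 \<in> ?T" by (rule lT(1)[OF n1 e]) (intro c)+
    have e: "var_s * var_t - K * var_t ^ 4 = (- K) * (var_t * (2 * U + var_t ^ 3)) +
        (K * (6 * E + 2 * var_s)) * (var_s ^ 2 * var_t)"
      unfolding UV Vs using E3 EK by algebra
    have stK: "var_s * var_t - K * var_t ^ 4 \<in> ?T" by (rule lT(2)[OF n3 s2t e]) (intro c)+
    have e: "U ^ 3 = U * deriv_t f + (- 4 * var_t ^ 2) * (var_t * U ^ 2)" unfolding ft by algebra
    have U3: "U ^ 3 \<in> ?T" by (rule lT(2)[OF T(4) n2 e]) (intro c)+
    have e: "var_s ^ 3 = Y ^ 3 * U ^ 3" unfolding UV using Y by algebra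
    have s3: "var_s ^ 3 \<in> ?T" by (rule lT(1)[OF U3 e]) (intro c)+
    have e: "9 * E ^ 4 * var_s ^ 2 + 12 * E ^ 2 * var_t ^ 3 * var_s = 1 * deriv_t f +
      (- (18 * E ^ 3 + 15 * E ^ 2 * var_s + 6 * E * var_s ^ 2 + var_s ^ 3)) * var_s ^ 3 +
      (- (4 * var_t ^ 2 * (3 * E + var_s))) * (var_s ^ 2 * var_t)"
      unfolding ft UV Vs by algebra
    have m: "9 * E ^ 4 * var_s ^ 2 + 12 * E ^ 2 * var_t ^ 3 * var_s \<in> ?T"
      by (rule lT(3)[OF T(4) s3 s2t e]) (intro c)+
    \<comment> \<open>\<open>q^2 E^2\<close> inverts the leading coefficient \<open>9 E^4\<close>,
      as \<open>E^6 = 1\<close>.\<close>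
    have e: "var_s ^ 2 - 8 * K ^ 2 * var_t ^ 6 =
        (q ^ 2 * E ^ 2) * (9 * E ^ 4 * var_s ^ 2 + 12 * E ^ 2 * var_t ^ 3 * var_s) +
        (- (q ^ 2 * E ^ 2) * (12 * E ^ 2 * var_t ^ 2)) * (var_s * var_t - K * var_t ^ 4)"
      using E3 EK q by algebra
    have s2K: "var_s ^ 2 - 8 * K ^ 2 * var_t ^ 6 \<in> ?T" by (rule lT(2)[OF m stK e]) (intro c)+
    show ?thesis
      by (rule D8_ideal_least[of ?T "\<epsilon> / 6", unfolded K2, folded K, OF T(1) s3 s2t st4 t7 stK s2K])
  qed
  ultimately have "?T = ?A" by blast
  thus ?thesis by (simp add: quotient_dim_D8)
qed

section \<open>Germs of simple singularities\<close>

lemma holomorphic2_onI: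
  assumes "\<And>p. p \<in> U \<Longrightarrow> \<exists>a b D. (f has_derivative D) (at p) \<and> (\<forall>q. D q = a * fst q + b * snd q)"
  shows "holomorphic2_on f U"
  unfolding holomorphic2_on_def
proof
  fix p assume "p \<in> U"
  then obtain a b D where D: "(f has_derivative D) (at p)" "\<forall>q. D q = a * fst q + b * snd q"
    using assms by blast
  have "D = (\<lambda>(h, k). a * h + b * k)" using D(2) by (auto simp: fun_eq_iff)
  thus "\<exists>a b. (f has_derivative (\<lambda>(h, k). a * h + b * k)) (at p)" using D(1) by blast
qed

lemma holomorphic2_onD:
  assumes "holomorphic2_on f U" "p \<in> U"
  obtains a b where "(f has_derivative (\<lambda>q. a * fst q + b * snd q)) (at p)"
  using assms unfolding holomorphic2_on_def case_prod_beta by blast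

lemma holomorphic2_on_const: "holomorphic2_on (\<lambda>p. c) U"
  by (rule holomorphic2_onI, rule exI[of _ 0], rule exI[of _ 0], rule exI[of _ "\<lambda>q. 0"]) simp

lemma holomorphic2_on_fst: "holomorphic2_on fst U"
  by (rule holomorphic2_onI, rule exI[of _ 1], rule exI[of _ 0], rule exI[of _ fst])
    (simp add: has_derivative_fst)

lemma holomorphic2_on_snd: "holomorphic2_on snd U"
  by (rule holomorphic2_onI, rule exI[of _ 0], rule exI[of _ 1], rule exI[of _ snd])
    (simp add: has_derivative_snd)

lemma holomorphic2_on_add:
  assumes "holomorphic2_on f U" "holomorphic2_on g U"
  shows "holomorphic2_on (\<lambda>p. f p + g p) U"
proof (rule holomorphic2_onI)
  fix p assume p: "p \<in> U"
  obtain a b where f: "(f has_derivative (\<lambda>q. a * fst q + b * snd q)) (at p)"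
    using assms(1) p by (rule holomorphic2_onD)
  obtain c d where g: "(g has_derivative (\<lambda>q. c * fst q + d * snd q)) (at p)"
    using assms(2) p by (rule holomorphic2_onD)
  show "\<exists>a b D. ((\<lambda>p. f p + g p) has_derivative D) (at p) \<and> (\<forall>q. D q = a * fst q + b * snd q)"
    by (rule exI[of _ "a + c"], rule exI[of _ "b + d"], rule exI, rule conjI, rule has_derivative_add[OF f g])
      (simp add: algebra_simps)
qed

lemma holomorphic2_on_mult:
  assumes "holomorphic2_on f U" "holomorphic2_on g U"
  shows "holomorphic2_on (\<lambda>p. f p * g p) U"
proof (rule holomorphic2_onI)
  fix p assume p: "p \<in> U"
  obtain a b where f: "(f has_derivative (\<lambda>q. a * fst q + b * snd q)) (at p)"
    using assms(1) p by (rule holomorphic2_onD)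
  obtain c d where g: "(g has_derivative (\<lambda>q. c * fst q + d * snd q)) (at p)"
    using assms(2) p by (rule holomorphic2_onD)
  show "\<exists>a b D. ((\<lambda>p. f p * g p) has_derivative D) (at p) \<and> (\<forall>q. D q = a * fst q + b * snd q)"
    by (rule exI[of _ "f p * c + a * g p"], rule exI[of _ "f p * d + b * g p"], rule exI, rule conjI,
        rule has_derivative_mult[OF f g]) (simp add: algebra_simps)
qed

lemma holomorphic2_on_compose:
  assumes "holomorphic2_on f U" "g holomorphic_on S" "open S" "\<And>p. p \<in> U \<Longrightarrow> f p \<in> S"
  shows "holomorphic2_on (\<lambda>p. g (f p)) U"
proof (rule holomorphic2_onI)
  fix p assume p: "p \<in> U"
  obtain a b where f: "(f has_derivative (\<lambda>q. a * fst q + b * snd q)) (at p)"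
    using assms(1) p by (rule holomorphic2_onD)
  have "g field_differentiable (at (f p))"
    using assms(2-4) p holomorphic_on_imp_differentiable_at by blast
  then obtain c where "(g has_field_derivative c) (at (f p))" by (auto simp: field_differentiable_def)
  hence g: "(g has_derivative (*) c) (at (f p))" by (simp add: has_field_derivative_def)
  show "\<exists>a b D. ((\<lambda>p. g (f p)) has_derivative D) (at p) \<and> (\<forall>q. D q = a * fst q + b * snd q)"
    by (rule exI[of _ "c * a"], rule exI[of _ "c * b"], rule exI, rule conjI,
        rule has_derivative_compose[OF f g]) (simp add: algebra_simps)
qed

lemma holomorphic2_on_power: "holomorphic2_on f U \<Longrightarrow> holomorphic2_on (\<lambda>p. f p ^ n) U"
  by (induction n) (auto intro: holomorphic2_on_const holomorphic2_on_mult)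

lemmas holomorphic2_intros = holomorphic2_on_const holomorphic2_on_fst holomorphic2_on_snd
  holomorphic2_on_add holomorphic2_on_mult holomorphic2_on_power

lemma biholomorphic2I:
  assumes "open U" "open V" "\<And>p. p \<in> U \<Longrightarrow> \<phi> p \<in> V" "\<And>q. q \<in> V \<Longrightarrow> \<psi> q \<in> U"
    "\<And>p. p \<in> U \<Longrightarrow> \<psi> (\<phi> p) = p" "\<And>q. q \<in> V \<Longrightarrow> \<phi> (\<psi> q) = q"
    "holomorphic2_on (\<lambda>p. fst (\<phi> p)) U" "holomorphic2_on (\<lambda>p. snd (\<phi> p)) U"
    "holomorphic2_on (\<lambda>q. fst (\<psi> q)) V" "holomorphic2_on (\<lambda>q. snd (\<psi> q)) V"
  shows "biholomorphic2 \<phi> U V"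
proof -
  have "bij_betw \<phi> U V" by (rule bij_betw_byWitness[of _ \<psi>]) (use assms in auto)
  thus ?thesis unfolding biholomorphic2_def comp_def using assms by blast
qed

lemma ADE_germI:
  assumes "ADE_normal_form N" "biholomorphic2 \<phi> U V" "(0, 0) \<in> U" "\<phi> (0, 0) = (0, 0)"
    "holomorphic2_on u U" "\<And>p. p \<in> U \<Longrightarrow> u p \<noteq> 0" "\<And>p. p \<in> U \<Longrightarrow> f p = u p * N (\<phi> p)"
  shows "ADE_germ f"
  unfolding ADE_germ_def
  by (rule exI[of _ N], rule exI[of _ U], rule exI[of _ V], rule exI[of _ \<phi>], rule exI[of _ u])
    (use assms in simp)

lemma ADE_germ_triple_point:
  "ADE_germ (\<lambda>(s, t). (s ^ 3 + t ^ 3) * (s ^ 3 + t ^ 3 + 1))"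
proof -
  \<comment> \<open>For \<open>x = \<beta> (s - t)\<close> and \<open>y = \<alpha> (s + t)\<close>
    the requirement \<open>x^2 y + y^3 = s^3 + t^3\<close> amounts to
    \<open>\<alpha>^3 = 1/4\<close> and \<open>\<beta>^2 \<alpha> = 3/4\<close>.\<close>
  obtain \<alpha> :: complex where \<alpha>: "1 / 4 = \<alpha> ^ 3" using exists_complex_root[of 3 "1 / 4"] by auto
  have \<alpha>0: "\<alpha> \<noteq> 0" using \<alpha> by auto
  obtain \<beta> :: complex where \<beta>: "3 / (4 * \<alpha>) = \<beta> ^ 2" using exists_complex_root[of 2 "3 / (4 * \<alpha>)"] by auto
  have \<beta>0: "\<beta> \<noteq> 0" using \<beta> \<alpha>0 by auto
  \<comment> \<open>\<open>s\<^sup>3 + t\<^sup>3 = (s + t) * ((s + t)\<^sup>2 + 3 * (s - t)\<^sup>2) / 4\<close>\<close>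
  define a b where "a = 1 / (2 * \<alpha>)" and "b = 1 / (2 * \<beta>)"
  have ab: "2 * \<alpha> * a = 1" "2 * \<beta> * b = 1" using \<alpha>0 \<beta>0 by (simp_all add: a_def b_def)
  define \<phi> where "\<phi> = (\<lambda>p :: complex \<times> complex. (\<beta> * (fst p + (- 1) * snd p), \<alpha> * (fst p + snd p)))"
  define \<psi> where "\<psi> = (\<lambda>q. (b * fst q + a * snd q, (- b) * fst q + a * snd q))"
  \<comment> \<open>The second cubic factor is the unit of the germ; \<open>U\<close> is the open
    set where it has no zero.\<close>
  define u where "u = (\<lambda>p :: complex \<times> complex. fst p ^ 3 + snd p ^ 3 + 1)"
  define U where "U = {p. u p \<noteq> 0}"
  have \<psi>\<phi>: "\<psi> (\<phi> p) = p" "\<phi> (\<psi> p) = p" for p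
  proof -
    obtain x y where p: "p = (x, y)" by (cases p)
    have "b * (\<beta> * (x + (- 1) * y)) + a * (\<alpha> * (x + y)) = x"
      "(- b) * (\<beta> * (x + (- 1) * y)) + a * (\<alpha> * (x + y)) = y"
      "\<beta> * ((b * x + a * y) + (- 1) * ((- b) * x + a * y)) = x"
      "\<alpha> * ((b * x + a * y) + ((- b) * x + a * y)) = y"
      using ab by algebra+
    thus "\<psi> (\<phi> p) = p" "\<phi> (\<psi> p) = p"
      unfolding p \<phi>_def \<psi>_def fst_conv snd_conv by (simp_all only:)
  qed
  have "open U" unfolding U_def u_def by (intro open_Collect_neq continuous_intros)
  have "continuous_on UNIV \<psi>" unfolding \<psi>_def by (intro continuous_intros)
  hence "open (\<psi> -` U)" using \<open>open U\<close> by (simp add: continuous_on_open_vimage)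
  have bi: "biholomorphic2 \<phi> U (\<psi> -` U)"
  proof (rule biholomorphic2I[of _ _ _ \<psi>])
    show "holomorphic2_on (\<lambda>p. fst (\<phi> p)) U" "holomorphic2_on (\<lambda>p. snd (\<phi> p)) U"
      unfolding \<phi>_def fst_conv snd_conv by (intro holomorphic2_intros)+
    show "holomorphic2_on (\<lambda>q. fst (\<psi> q)) (\<psi> -` U)" "holomorphic2_on (\<lambda>q. snd (\<psi> q)) (\<psi> -` U)"
      unfolding \<psi>_def fst_conv snd_conv by (intro holomorphic2_intros)+
  qed (use \<psi>\<phi> \<open>open U\<close> \<open>open (\<psi> -` U)\<close> in auto)
  show ?thesis
  proof (rule ADE_germI[OF ADE_normal_form.D[of 4] bi])
    show "holomorphic2_on u U" unfolding u_def by (intro holomorphic2_intros)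
    fix p assume "p \<in> U"
    obtain s t where p: "p = (s, t)" by (cases p)
    have "\<beta> ^ 2 * \<alpha> = 3 / 4" using \<alpha>0 by (simp flip: \<beta>)
    hence "(\<beta> * (s - t)) ^ 2 * (\<alpha> * (s + t)) + (\<alpha> * (s + t)) ^ 3 = s ^ 3 + t ^ 3"
      using \<alpha> by algebra
    thus "(case p of (s, t) \<Rightarrow> (s ^ 3 + t ^ 3) * (s ^ 3 + t ^ 3 + 1)) =
        u p * (case \<phi> p of (x, y) \<Rightarrow> x\<^sup>2 * y + y ^ (4 - 1))"
      by (simp add: p u_def \<phi>_def mult.commute)
  qed (auto simp: U_def u_def \<phi>_def)
qed

text \<open>The map is triangular: the second coordinate is a multiple of \<open>t\<close>, and the
  first differs from \<open>\<beta> v(s)\<close> by a function of \<open>t\<close>. Inverting it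
  reduces to inverting the one-variable function \<open>v\<close> near 0, where its derivative is
  \<open>3 \<epsilon>^2\<close>.\<close>

lemma biholomorphic2_flex:
  fixes \<epsilon> \<beta> \<gamma> :: complex
  assumes \<epsilon>: "\<epsilon> ^ 3 + 1 = 0" and nz: "\<beta> \<noteq> 0" "\<gamma> \<noteq> 0"
  defines "\<phi> \<equiv> (\<lambda>(s, t). (\<beta> * (((\<epsilon> + s) ^ 3 + 1) + t ^ 3 / 2), \<gamma> * t))"
  obtains U V where "biholomorphic2 \<phi> U V" "(0, 0) \<in> U" "\<phi> (0, 0) = (0, 0)"
proof -
  define v where "v = (\<lambda>s. (\<epsilon> + s) ^ 3 + 1)"
  have \<phi>: "\<phi> = (\<lambda>p. (\<beta> * (v (fst p) + 1 / 2 * snd p ^ 3), \<gamma> * snd p))"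
    by (auto simp: \<phi>_def v_def)
  have hv: "v holomorphic_on S" for S unfolding v_def by (intro holomorphic_intros)
  have "(v has_field_derivative 3 * \<epsilon> ^ 2) (at 0)" unfolding v_def
    by (auto intro!: derivative_eq_intros)
  hence "deriv v 0 \<noteq> 0" using \<epsilon> by (auto simp: DERIV_imp_deriv)
  then obtain r where r: "r > 0" "open (v ` ball 0 r)" "inj_on v (ball 0 r)"
    using has_complex_derivative_locally_invertible[OF hv[of UNIV], of 0] by auto
  obtain g where g: "g holomorphic_on v ` ball 0 r" "\<And>s. s \<in> ball 0 r \<Longrightarrow> g (v s) = s"
    using holomorphic_has_inverse[OF hv[of "ball 0 r"] open_ball r(3)] by metis
  \<comment> \<open>Recovers \<open>v(s)\<close> from the image point: divide by
    \<open>\<beta>\<close> and remove \<open>t^3 / 2\<close>, with \<open>t\<close> read off the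
    second coordinate.\<close>
  define x where "x = (\<lambda>q :: complex \<times> complex. 1 / \<beta> * fst q + (- 1 / 2) * (1 / \<gamma> * snd q) ^ 3)"
  define \<psi> where "\<psi> = (\<lambda>q. (g (x q), 1 / \<gamma> * snd q))"
  define U where "U = ball (0::complex) r \<times> (UNIV :: complex set)"
  define V where "V = x -` (v ` ball 0 r)"
  have x\<phi>: "x (\<phi> p) = v (fst p)" for p using nz by (simp add: x_def \<phi>)
  have "continuous_on UNIV x" unfolding x_def by (intro continuous_intros) (use nz in auto)
  hence "open V" unfolding V_def using r(2) by (simp add: continuous_on_open_vimage)
  have hx: "holomorphic2_on x V" unfolding x_def by (intro holomorphic2_intros)
  have "biholomorphic2 \<phi> U V"
  proof (rule biholomorphic2I[of _ _ _ \<psi>])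
    show "open U" by (simp add: U_def open_Times)
    show "open V" by fact
    show "\<phi> p \<in> V" if "p \<in> U" for p using that by (auto simp: V_def U_def x\<phi>)
    show "\<psi> q \<in> U" if "q \<in> V" for q using that g(2) by (auto simp: V_def U_def \<psi>_def)
    show "\<psi> (\<phi> p) = p" if "p \<in> U" for p
      using that g(2) nz by (auto simp: \<psi>_def x\<phi> U_def) (simp add: \<phi>)
    show "\<phi> (\<psi> q) = q" if "q \<in> V" for q
    proof -
      have "v (g (x q)) = x q" using that g(2) by (auto simp: V_def)
      thus ?thesis using nz by (simp add: \<psi>_def \<phi> x_def prod_eq_iff)
    qed
    have "holomorphic2_on (\<lambda>p. v (fst p)) U" unfolding v_def by (intro holomorphic2_intros)
    thus "holomorphic2_on (\<lambda>p. fst (\<phi> p)) U" "holomorphic2_on (\<lambda>p. snd (\<phi> p)) U"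
      unfolding \<phi> fst_conv snd_conv by (intro holomorphic2_intros; assumption)+
    show "holomorphic2_on (\<lambda>q. fst (\<psi> q)) V" unfolding \<psi>_def fst_conv
      by (rule holomorphic2_on_compose[OF hx g(1) r(2)]) (auto simp: V_def)
    show "holomorphic2_on (\<lambda>q. snd (\<psi> q)) V" unfolding \<psi>_def snd_conv by (intro holomorphic2_intros)
  qed
  moreover have "(0, 0) \<in> U" using r by (simp add: U_def)
  moreover have "\<phi> (0, 0) = (0, 0)" using \<epsilon> by (simp add: \<phi>_def)
  ultimately show ?thesis by (rule that)
qed

lemma ADE_germ_flex_tangent:
  fixes \<epsilon> :: complex
  assumes "\<epsilon> ^ 3 + 1 = 0"
  shows "ADE_germ (\<lambda>(s, t). ((\<epsilon> + s) ^ 3 + 1) * ((\<epsilon> + s) ^ 3 + 1 + t ^ 3))"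
proof -
  \<comment> \<open>\<open>(\<gamma> t)^6\<close> has to be the remainder \<open>- t^6 / 4\<close>
    of the completed square.\<close>
  obtain \<gamma> :: complex where \<gamma>: "- 1 / 4 = \<gamma> ^ 6" using exists_complex_root[of 6 "- 1 / 4"] by auto
  hence "\<gamma> \<noteq> 0" by auto
  then obtain U V where UV: "biholomorphic2 (\<lambda>(s, t). (1 * (((\<epsilon> + s) ^ 3 + 1) + t ^ 3 / 2), \<gamma> * t)) U V"
    "(0, 0) \<in> U" "(\<lambda>(s, t). (1 * (((\<epsilon> + s) ^ 3 + 1) + t ^ 3 / 2), \<gamma> * t)) (0, 0) = (0, 0)"
    using biholomorphic2_flex[OF assms, of 1 \<gamma>] by auto
  show ?thesis
  proof (rule ADE_germI[OF ADE_normal_form.A[of 5] UV holomorphic2_on_const[of 1]])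
    fix p assume "p \<in> U"
    obtain s t where p: "p = (s, t)" by (cases p)
    have *: "v * (v + t ^ 3) = (v + t ^ 3 / 2) ^ 2 + (\<gamma> * t) ^ 6" for v
    proof -
      define w where "w = t ^ 3 / 2"
      have "t ^ 3 = 2 * w" "4 * \<gamma> ^ 6 = - 1" by (simp add: w_def, simp flip: \<gamma>)
      thus ?thesis unfolding w_def[symmetric] by algebra
    qed
    show "(case p of (s, t) \<Rightarrow> ((\<epsilon> + s) ^ 3 + 1) * ((\<epsilon> + s) ^ 3 + 1 + t ^ 3)) =
      1 * (case case p of (s, t) \<Rightarrow> (1 * (((\<epsilon> + s) ^ 3 + 1) + t ^ 3 / 2), \<gamma> * t) of
        (x, y) \<Rightarrow> x\<^sup>2 + y ^ (5 + 1))"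
      unfolding p prod.case * by simp
  qed auto
qed

lemma ADE_germ_flex_tangent_secant:
  fixes \<epsilon> :: complex
  assumes "\<epsilon> ^ 3 + 1 = 0"
  shows "ADE_germ (\<lambda>(s, t). t * (((\<epsilon> + s) ^ 3 + 1) * ((\<epsilon> + s) ^ 3 + 1 + t ^ 3)))"
proof -
  \<comment> \<open>The completed square is multiplied by \<open>t\<close>: its remainder asks for
    \<open>\<gamma>^7 = - 1/4\<close>, and the square itself for
    \<open>\<beta>^2 \<gamma> = 1\<close>.\<close>
  obtain \<gamma> :: complex where \<gamma>: "- 1 / 4 = \<gamma> ^ 7" using exists_complex_root[of 7 "- 1 / 4"] by auto
  hence \<gamma>0: "\<gamma> \<noteq> 0" by auto
  obtain \<beta> :: complex where \<beta>: "1 / \<gamma> = \<beta> ^ 2" using exists_complex_root[of 2 "1 / \<gamma>"] by auto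
  have "\<beta> \<noteq> 0" using \<beta> \<gamma>0 by auto
  then obtain U V where UV: "biholomorphic2 (\<lambda>(s, t). (\<beta> * (((\<epsilon> + s) ^ 3 + 1) + t ^ 3 / 2), \<gamma> * t)) U V"
    "(0, 0) \<in> U" "(\<lambda>(s, t). (\<beta> * (((\<epsilon> + s) ^ 3 + 1) + t ^ 3 / 2), \<gamma> * t)) (0, 0) = (0, 0)"
    using biholomorphic2_flex[OF assms _ \<gamma>0, of \<beta>] by auto
  show ?thesis
  proof (rule ADE_germI[OF ADE_normal_form.D[of 8] UV holomorphic2_on_const[of 1]])
    fix p assume "p \<in> U"
    obtain s t where p: "p = (s, t)" by (cases p)
    have *: "t * (v * (v + t ^ 3)) = (\<beta> * (v + t ^ 3 / 2)) ^ 2 * (\<gamma> * t) + (\<gamma> * t) ^ 7" for v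
    proof -
      define w where "w = t ^ 3 / 2"
      have "t ^ 3 = 2 * w" "4 * \<gamma> ^ 7 = - 1" "\<beta> ^ 2 * \<gamma> = 1"
        using \<gamma>0 by (simp add: w_def, simp flip: \<gamma>, simp flip: \<beta>)
      thus ?thesis unfolding w_def[symmetric] by algebra
    qed
    show "(case p of (s, t) \<Rightarrow> t * (((\<epsilon> + s) ^ 3 + 1) * ((\<epsilon> + s) ^ 3 + 1 + t ^ 3))) =
      1 * (case case p of (s, t) \<Rightarrow> (\<beta> * (((\<epsilon> + s) ^ 3 + 1) + t ^ 3 / 2), \<gamma> * t) of
        (x, y) \<Rightarrow> x\<^sup>2 * y + y ^ (8 - 1))"
      unfolding p prod.case * by simp
  qed auto
qed

section \<open>The Fermat cubic\<close>

text \<open>The unknown scale cancels in the quotients of coordinates. The local coordinate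
  \<open>t\<close> is the value of \<open>z\<close>, so the line \<open>z = 0\<close> becomes
  \<open>t = 0\<close>.\<close>

lemma chart_flex:
  assumes "unital_hom \<iota>"
  shows "chart \<iota> (coords (hpoint 1 \<epsilon> 0)) s t = (1, \<iota> \<epsilon> + s, t)"
proof -
  obtain l where "l \<noteq> 0" "coords (hpoint 1 \<epsilon> 0) = (l * 1, l * \<epsilon>, l * 0)" by (rule coords_hpoint)
  thus ?thesis by (simp add: chart_def unital_hom_simps(4)[OF assms])
qed

lemma chart_origin: "chart \<iota> (coords (hpoint 0 0 1)) s t = (s, t, 1)"
proof -
  obtain l where "l \<noteq> 0" "coords (hpoint 0 0 1) = (l * 0, l * 0, l * 1)" by (rule coords_hpoint)
  thus ?thesis by (simp add: chart_def)
qed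

lemma tjurina_number_fermat_tangents:
  defines "u \<equiv> fermat2 3" and "w \<equiv> vz ^ 3"
  shows "tjurina_number (u * (u + w)) (hpoint 0 0 1) = 4"
    "tjurina_number (vz * (u * (u + w))) (hpoint 0 0 1) = 4"
    "\<epsilon> ^ 3 + 1 = 0 \<Longrightarrow> tjurina_number (u * (u + w)) (hpoint 1 \<epsilon> 0) = 5"
    "\<epsilon> ^ 3 + 1 = 0 \<Longrightarrow> tjurina_number (vz * (u * (u + w))) (hpoint 1 \<epsilon> 0) = 8"
proof -
  note e = eval3_simps[OF unital_hom_cst2]
  \<comment> \<open>In this chart \<open>z\<close> takes the value 1, so the two curves have the
    same local equation.\<close>
  show "tjurina_number (u * (u + w)) (hpoint 0 0 1) = 4"
    "tjurina_number (vz * (u * (u + w))) (hpoint 0 0 1) = 4"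
    unfolding tjurina_number_def local_series_def chart_origin u_def w_def
    by (rule tjurina_triple_point; simp add: e)+
  assume \<epsilon>: "\<epsilon> ^ 3 + 1 = 0"
  show "tjurina_number (u * (u + w)) (hpoint 1 \<epsilon> 0) = 5"
    unfolding tjurina_number_def local_series_def chart_flex[OF unital_hom_cst2] u_def w_def
    by (rule tjurina_flex_tangent[OF \<epsilon> refl]) (simp add: e add.commute[of 1])
  show "tjurina_number (vz * (u * (u + w))) (hpoint 1 \<epsilon> 0) = 8"
    unfolding tjurina_number_def local_series_def chart_flex[OF unital_hom_cst2] u_def w_def
    by (rule tjurina_flex_tangent_secant[OF \<epsilon> refl]) (simp add: e add.commute[of 1])
qed

lemma ADE_germ_fermat_tangents:
  defines "u \<equiv> fermat2 3" and "w \<equiv> vz ^ 3"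
  shows "ADE_germ (local_fun (u * (u + w)) (hpoint 0 0 1))"
    "ADE_germ (local_fun (vz * (u * (u + w))) (hpoint 0 0 1))"
    "\<epsilon> ^ 3 + 1 = 0 \<Longrightarrow> ADE_germ (local_fun (u * (u + w)) (hpoint 1 \<epsilon> 0))"
    "\<epsilon> ^ 3 + 1 = 0 \<Longrightarrow> ADE_germ (local_fun (vz * (u * (u + w))) (hpoint 1 \<epsilon> 0))"
proof -
  show "ADE_germ (local_fun (u * (u + w)) (hpoint 0 0 1))"
    "ADE_germ (local_fun (vz * (u * (u + w))) (hpoint 0 0 1))"
    using ADE_germ_triple_point by (simp_all add: local_fun_def chart_origin u_def w_def ev_simps)
  assume \<epsilon>: "\<epsilon> ^ 3 + 1 = 0"
  show "ADE_germ (local_fun (u * (u + w)) (hpoint 1 \<epsilon> 0))"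
    using ADE_germ_flex_tangent[OF \<epsilon>]
    by (simp add: local_fun_def chart_flex[OF unital_hom_id] u_def w_def ev_simps add.commute[of 1])
  show "ADE_germ (local_fun (vz * (u * (u + w))) (hpoint 1 \<epsilon> 0))"
    using ADE_germ_flex_tangent_secant[OF \<epsilon>]
    by (simp add: local_fun_def chart_flex[OF unital_hom_id] u_def w_def ev_simps add.commute[of 1])
qed

lemma maximizing_fermat_tangents:
  defines "u \<equiv> fermat2 3" and "w \<equiv> vz ^ 3"
  shows "maximizing 6 (u * (u + w))" "maximizing 7 (vz * (u * (u + w)))"
proof -
  define R :: "complex set" where "R = {\<epsilon>. \<epsilon> ^ 3 + 1 = 0}"
  have R: "finite R" "card R = 3" using fermat_roots[of 3] by (simp_all add: R_def)
  have S: "singular_points (u * (u + w)) = insert (hpoint 0 0 1) ((\<lambda>\<epsilon>. hpoint 1 \<epsilon> 0) ` R)"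
    "singular_points (vz * (u * (u + w))) = insert (hpoint 0 0 1) ((\<lambda>\<epsilon>. hpoint 1 \<epsilon> 0) ` R)"
    using singular_points_fermat_tangents[of 2] by (simp_all add: u_def w_def R_def numeral_3_eq_3)
  \<comment> \<open>The sum over a set of points needs \<open>(0:0:1)\<close> and the three tangency
    points to be pairwise different.\<close>
  have inj: "inj_on (\<lambda>\<epsilon>. hpoint 1 \<epsilon> 0) R" by (simp add: inj_on_def hpoint_eq_1)
  have notin: "hpoint 0 0 1 \<notin> (\<lambda>\<epsilon>. hpoint 1 \<epsilon> 0) ` R" using hpoint_third_neq by blast
  have sum: "(\<Sum>P\<in>insert (hpoint 0 0 1) ((\<lambda>\<epsilon>. hpoint 1 \<epsilon> 0) ` R). g P) =
      g (hpoint 0 0 1) + (\<Sum>\<epsilon>\<in>R. g (hpoint 1 \<epsilon> 0))" for g :: "point \<Rightarrow> nat"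
    using R notin by (simp add: sum.reindex[OF inj])
  have "total_tjurina_number (u * (u + w)) = 19" "total_tjurina_number (vz * (u * (u + w))) = 28"
    unfolding total_tjurina_number_def S sum
    using R tjurina_number_fermat_tangents[folded u_def w_def] by (simp_all add: R_def)
  moreover have "reduced_plane_curve 6 (u * (u + w))" "reduced_plane_curve 7 (vz * (u * (u + w)))"
    using reduced_fermat(2,3)[of 2] by (simp_all add: u_def w_def)
  moreover have "\<forall>P\<in>singular_points G. ADE_germ (local_fun G P)"
    if "G = u * (u + w) \<or> G = vz * (u * (u + w))" for G
    using that S ADE_germ_fermat_tangents[folded u_def w_def] by (auto simp: R_def)
  \<comment> \<open>\<open>m = 3\<close> in both cases: \<open>3 * 3 * 2 + 1 = 19\<close> and
    \<open>3 * 3^2 + 1 = 28\<close>.\<close>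
  ultimately show "maximizing 6 (u * (u + w))" "maximizing 7 (vz * (u * (u + w)))"
    unfolding maximizing_def by (auto intro: exI[of _ 3])
qed

theorem corollary1p6:
  fixes d :: nat and F F' F'' :: S and R :: "complex set"
    and p :: "complex \<Rightarrow> point" and L :: "complex \<Rightarrow> S"
  assumes "d \<ge> 2"
    and "F = vx ^ d + vy ^ d + vz ^ d"
    and "F' = (vx ^ d + vy ^ d) * F"
    and "F'' = vz * F'"
    and "R = {\<epsilon>. \<epsilon> ^ d + 1 = 0}"
    and "\<And>\<epsilon>. p \<epsilon> = hpoint 1 \<epsilon> 0"
    and "\<And>\<epsilon>. L \<epsilon> = vy - cst \<epsilon> * vx"
  shows
    \<comment> \<open>the geometric situation\<close>
    "(reduced_plane_curve d F \<and> singular_points F = {} \<and>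
      (\<forall>\<epsilon>\<in>R. p \<epsilon> \<in> zero_locus F \<and> zero_locus (L \<epsilon>) = tangent_line F (p \<epsilon>)) \<and>
      card ((\<lambda>\<epsilon>. zero_locus (L \<epsilon>)) ` R) = d \<and>
      (\<Inter>\<epsilon>\<in>R. zero_locus (L \<epsilon>)) = {hpoint 0 0 1} \<and>
      (\<Prod>\<epsilon>\<in>R. L \<epsilon>) = vx ^ d + vy ^ d \<and>
      (\<Union>\<epsilon>\<in>R. zero_locus (L \<epsilon>)) = zero_locus (vx ^ d + vy ^ d) \<and>
      zero_locus F' = zero_locus F \<union> (\<Union>\<epsilon>\<in>R. zero_locus (L \<epsilon>)) \<and>
      (\<forall>\<epsilon>\<in>R. p \<epsilon> \<in> zero_locus vz) \<and>
      zero_locus F'' = zero_locus F' \<union> zero_locus vz) \<and>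
    \<comment> \<open>(1)\<close>
     (reduced_plane_curve (2 * d) F' \<and> free_curve F' \<and> has_exponents F' (d - 1, d) \<and>
      (d = 3 \<longrightarrow> maximizing 6 F')) \<and>
    \<comment> \<open>(2)\<close>
     (reduced_plane_curve (2 * d + 1) F'' \<and> free_curve F'' \<and> has_exponents F'' (d - 1, d + 1) \<and>
      (d = 3 \<longrightarrow> maximizing 7 F''))"
proof -
  \<comment> \<open>The general lemmas use \<open>Suc m\<close> for the degree, which avoids the
    truncated subtraction in \<open>d - 1\<close>.\<close>
  define m where "m = d - 1"
  have d: "d = Suc m" "m \<ge> 1" using assms(1) by (auto simp: m_def)
  have F: "F = fermat2 (Suc m) + vz ^ Suc m"
    "F' = fermat2 (Suc m) * (fermat2 (Suc m) + vz ^ Suc m)"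
    "F'' = vz * (fermat2 (Suc m) * (fermat2 (Suc m) + vz ^ Suc m))"
    using assms(2-4) by (simp_all only: d(1))
  have pL: "p = (\<lambda>\<epsilon>. hpoint 1 \<epsilon> 0)" "L = line" using assms(6,7) by auto
  note geo = fermat_geometry[OF assms(1), folded assms(5), unfolded d(1)]
  note red = reduced_fermat[of m]
  have loci: "zero_locus F' = zero_locus F \<union> (\<Union>\<epsilon>\<in>R. zero_locus (line \<epsilon>))"
    "zero_locus F'' = zero_locus F' \<union> zero_locus vz"
    unfolding F geo(5) zero_locus_mult[OF homogeneous_vars(3) homogeneous_fermat(2)]
      zero_locus_mult[OF homogeneous_fermat2 homogeneous_fermat(1)] by blast+
  have prod: "(\<Prod>\<epsilon>\<in>R. line \<epsilon>) = fermat2 (Suc m)"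
    using prod_lines[of d] assms(1,5) by (simp add: d(1))
  have max: "maximizing 6 F'" "maximizing 7 F''" if "d = 3"
    using maximizing_fermat_tangents that unfolding assms(2-4) by simp_all
  have free: "free_curve F'" "free_curve F''"
    unfolding F using red free_curve_of_exponents by blast+
  show ?thesis
    using geo loci prod max free red singular_points_fermat[of m]
    unfolding pL by (simp add: F d(1) del: power_Suc)
qed

end
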